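(* Let $\theta^\star\in\Theta$ be the data-generating parameter, let actions in the finite set $\mathcal A$ be selected by an adaptive policy, and let $\widehat\theta_t$ be a joint maximum-likelihood estimator over $\Theta$. Then for every deterministic $t\ge1$ and every $x\ge0$, $$\mathbb P_{\theta^\star}\Big(\sum_{a\in\mathcal A}N_t(a)\operatorname{KL}\big(P_a^{\widehat\theta_t}\,\big\|\,P_a^{\theta^\star}\big)\ge x\Big)\le f_t(x),\qquad f_t(x):=\min\Big\{1,\ \big[e^{q}\,\mathcal N(\zeta_t(x))+1\big]e^{-\kappa_Bx}\Big\},$$ where $q,\kappa_B,\mathcal N(\cdot),\zeta_t(\cdot)$ are the explicit quantities defined in the context. In particular there is a polynomial $\mathrm{poly}$ (depending only on $p$ and the parameter bounds) such that $f_t(x)\le \mathrm{poly}(t,x,\log(t+1))\,e^{-\kappa_Bx}$ for all $t\ge1$, $x\ge0$.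
   Context: **Model.** Fix an integer $p\ge1$, $[p]=\{1,\dots,p\}$, intervals $[U_{j,1},U_{j,2}]$ ($j\in[p]$), and constants $\beta_{\min},A_{\max},\sigma_{\min},\sigma_{\max},C_{\max}>0$ with $\max_j\max_{u\in[U_{j,1},U_{j,2}]}|u|\le C_{\max}$. $\Theta$ is the set of all triples $\theta=(D,\mathbf A,\mathbf\Sigma)$ where $D$ is a directed acyclic graph on $[p]$; $\mathbf A\in\mathbb R^{p\times p}$ satisfies $A_{jk}\ne0$ if and only if $k\to j$ is an edge of $D$, and $\beta_{\min}\le|A_{jk}|\le A_{\max}$ for every nonzero $A_{jk}$; and $\mathbf\Sigma=\operatorname{diag}(\sigma_1^2,\dots,\sigma_p^2)$ with $\sigma_{\min}^2\le\sigma_j^2\le\sigma_{\max}^2$. **Actions and distributions.** $\mathcal A=\{0\}\cup\{(j,U_{j,s}):j\in[p],s\in\{1,2\}\}$, with $K=|\mathcal A|=2p+1$; $0$ is passive observation, $(j,u)$ is the intervention $\operatorname{do}(X_j=u)$. $P_0^\theta=\mathcal N(0,(\mathbf I-\mathbf A)^{-1}\mathbf\Sigma(\mathbf I-\mathbf A)^{-\mathsf T})$ on $\mathbb R^p$; for $a=(j,u)$, $R=[p]\setminus\{j\}$, $P_a^\theta=\mathcal N\big((\mathbf I-\mathbf A_{R,R})^{-1}\mathbf A_{R,j}u,\ (\mathbf I-\mathbf A_{R,R})^{-1}\mathbf\Sigma_{R,R}(\mathbf I-\mathbf A_{R,R})^{-\mathsf T}\big)$ on $\mathbb R^R$. $p_a^\theta$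 is the density of $P_a^\theta$. **Sampling and estimation.** At round $t$, $a_t\in\mathcal A$ is selected on the basis of the history $(a_1,\mathbf X_1,\dots,a_{t-1},\mathbf X_{t-1})$, by a rule not depending on $\theta^\star$, and then $\mathbf X_t\sim P_{a_t}^{\theta^\star}$ given the past and $a_t$. $N_t(a)=\sum_{s=1}^t\mathbf 1\{a_s=a\}$, $\ell_t(\theta)=\sum_{s=1}^t\log p_{a_s}^\theta(\mathbf X_s)$, and $\widehat\theta_t\in\arg\max_{\theta\in\Theta}\ell_t(\theta)$. **Constants.** $G_p=\sum_{k=0}^{p-1}(pA_{\max})^k$, $B_\mu=G_p\sqrt p\,A_{\max}C_{\max}$, $v_-=\sigma_{\min}^2/(1+pA_{\max})^2$, $v_+=G_p^2\sigma_{\max}^2$, $\kappa_V=v_+/v_-$. With $g(r)=\frac12(r-1-\log r)$, $h(r)=\frac12\log\frac{1+r}{2\sqrt r}$, and $h(1)/g(1):=1/4$ (continuous extension), set $\kappa_\mu=\frac{v_-}{4v_+}$, $\kappa_\Sigma=\min_{r\in[\kappa_V^{-1},\kappa_V]}h(r)/g(r)$, $\kappa_B=\min\{\kappa_\mu,\kappa_\Sigma\}$. Let $d_0=p$, $d_a=p-1$ for interventions $a$, $s_a=d_a(d_a+1)/2$, $q=\sum_{a\in\mathcal A}(d_a+s_a)$, and for $\zeta>0$ $$\mathcal N(\zeta)=\prod_{a\in\mathcal A}\Big(1+\frac{8B_\mu}{\zeta}\Big)^{d_a}\Big(1+\frac{8\sqrt{d_a}\,v_+}{\zeta}\Big)^{s_a}.$$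 $R(z)=B_\mu+\sqrt{v_+}(\sqrt p+\sqrt{2z})$; $L_\ell(R)=\frac{R+B_\mu}{v_-}+\frac12\Big\{\frac{\sqrt p}{v_-}+\frac{(R+B_\mu)^2}{v_-^2}\Big\}$; $L_{\mathrm{KL}}=\frac{2B_\mu+\sqrt p}{v_-}$; $z_t(x)=\kappa_Bx+2\log(t+1)$; $H_t(x)=\frac12L_\ell(R(z_t(x)))+\kappa_BL_{\mathrm{KL}}$; $\zeta_t(x)=\min\{1,\ q/(tH_t(x))\}$. *)

theory Defs
  imports "HOL-Probability.Probability"
begin

section \<open>Gaussian laws on coordinate subspaces\<close>

text \<open>
  The node set is a finite type \<open>'p\<close>, with \<open>p = CARD('p)\<close>. The principal submatrix
  \<open>M\<^sub>R\<^sub>,\<^sub>R\<close> is represented by the block diagonal matrix \<open>M\<^sub>R\<^sub>,\<^sub>R \<oplus> I\<close> (identity on the complement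
  of \<open>R\<close>), so that \<open>det\<close> and the \<open>R \<times> R\<close> block of \<open>matrix_inv\<close> are the determinant and the
  inverse of \<open>M\<^sub>R\<^sub>,\<^sub>R\<close>. For \<open>R = UNIV\<close> it is \<open>M\<close> itself.
\<close>

definition principal :: "'p::finite set \<Rightarrow> real^'p^'p \<Rightarrow> real^'p^'p" where
  "principal R M =
     (\<chi> i j. if i \<in> R \<and> j \<in> R then M $ i $ j else if i = j then 1 else 0)"

text \<open>
  Density and law of the nondegenerate Gaussian with mean \<open>\<mu>\<close> and covariance \<open>V\<close> on \<open>\<real>\<^sup>R\<close>;
  only entries of \<open>\<mu>\<close>, \<open>V\<close> with indices in \<open>R\<close> are used. Points of \<open>\<real>\<^sup>R\<close> are elements of the
  product space \<open>PiM R\<close>.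
\<close>

definition mvn_density ::
    "'p::finite set \<Rightarrow> real^'p \<Rightarrow> real^'p^'p \<Rightarrow> ('p \<Rightarrow> real) \<Rightarrow> real" where
  "mvn_density R \<mu> V x =
     exp (- (\<Sum>i\<in>R. \<Sum>j\<in>R. (x i - \<mu> $ i) * matrix_inv (principal R V) $ i $ j * (x j - \<mu> $ j)) / 2)
       / sqrt ((2 * pi) ^ card R * det (principal R V))"

definition mvn :: "'p::finite set \<Rightarrow> real^'p \<Rightarrow> real^'p^'p \<Rightarrow> ('p \<Rightarrow> real) measure" where
  "mvn R \<mu> V = density (PiM R (\<lambda>_. lborel)) (\<lambda>x. ennreal (mvn_density R \<mu> V x))"

section \<open>The model\<close>

record bounds =
  beta_min :: real
  A_max :: real
  sigma_min :: real
  sigma_max :: real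
  C_max :: real

text \<open>The endpoints of the \<open>j\<close>-th interval are \<open>U j 1\<close> and \<open>U j 2\<close>.\<close>

definition valid_bounds :: "bounds \<Rightarrow> ('p::finite \<Rightarrow> nat \<Rightarrow> real) \<Rightarrow> bool" where
  "valid_bounds b U \<longleftrightarrow>
     beta_min b > 0 \<and> A_max b > 0 \<and> sigma_min b > 0 \<and> sigma_max b > 0 \<and> C_max b > 0 \<and>
     (\<forall>j. U j 1 \<le> U j 2 \<and> (\<forall>u\<in>{U j 1..U j 2}. \<bar>u\<bar> \<le> C_max b))"

text \<open>A pair \<open>(k, j)\<close> in \<open>dag\<close> is the edge \<open>k \<rightarrow> j\<close>.\<close>

record 'p param =
  dag :: "('p \<times> 'p) set"
  coef :: "real^'p^'p"
  noise :: "real^'p^'p"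

definition param_space :: "bounds \<Rightarrow> 'p::finite param set" where
  "param_space b = {\<theta>.
     acyclic (dag \<theta>) \<and>
     (\<forall>j k. coef \<theta> $ j $ k \<noteq> 0 \<longleftrightarrow> (k, j) \<in> dag \<theta>) \<and>
     (\<forall>j k. coef \<theta> $ j $ k \<noteq> 0 \<longrightarrow>
        beta_min b \<le> \<bar>coef \<theta> $ j $ k\<bar> \<and> \<bar>coef \<theta> $ j $ k\<bar> \<le> A_max b) \<and>
     (\<exists>s. noise \<theta> = (\<chi> i j. if i = j then (s i)\<^sup>2 else 0) \<and>
        (\<forall>j. (sigma_min b)\<^sup>2 \<le> (s j)\<^sup>2 \<and> (s j)\<^sup>2 \<le> (sigma_max b)\<^sup>2))}"

text \<open>\<open>Do j s\<close> labels the intervention \<open>do(X\<^sub>j = U\<^sub>j\<^sub>,\<^sub>s)\<close>, so that there are exactly \<open>2p + 1\<close> actions.\<close>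

datatype 'p action = Observe | Do 'p nat

definition actions :: "'p action set" where
  "actions = insert Observe {Do j s |j s. s \<in> {1, 2}}"

text \<open>The coordinates that are random under an action.\<close>

fun coords :: "'p action \<Rightarrow> 'p set" where
  "coords Observe = UNIV"
| "coords (Do j s) = UNIV - {j}"

fun act_mean :: "('p::finite \<Rightarrow> nat \<Rightarrow> real) \<Rightarrow> 'p param \<Rightarrow> 'p action \<Rightarrow> real^'p" where
  "act_mean U \<theta> Observe = 0"
| "act_mean U \<theta> (Do j s) =
     matrix_inv (principal (UNIV - {j}) (mat 1 - coef \<theta>)) *v (U j s *s column j (coef \<theta>))"

fun act_cov :: "'p::finite param \<Rightarrow> 'p action \<Rightarrow> real^'p^'p" where
  "act_cov \<theta> Observe =
     matrix_inv (mat 1 - coef \<theta>) ** noise \<theta> ** transpose (matrix_inv (mat 1 - coef \<theta>))"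
| "act_cov \<theta> (Do j s) =
     (let R = UNIV - {j}; K = matrix_inv (principal R (mat 1 - coef \<theta>))
      in K ** principal R (noise \<theta>) ** transpose K)"

definition act_density ::
    "('p::finite \<Rightarrow> nat \<Rightarrow> real) \<Rightarrow> 'p param \<Rightarrow> 'p action \<Rightarrow> ('p \<Rightarrow> real) \<Rightarrow> real" where
  "act_density U \<theta> a = mvn_density (coords a) (act_mean U \<theta> a) (act_cov \<theta> a)"

definition act_law ::
    "('p::finite \<Rightarrow> nat \<Rightarrow> real) \<Rightarrow> 'p param \<Rightarrow> 'p action \<Rightarrow> ('p \<Rightarrow> real) measure" where
  "act_law U \<theta> a = mvn (coords a) (act_mean U \<theta> a) (act_cov \<theta> a)"

section \<open>Adaptive sampling and maximum likelihood\<close>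

text \<open>
  One round yields a pair (action, observation), a point of the disjoint union of the spaces
  \<open>\<real>\<^sup>R\<close> with \<open>R = coords a\<close>, \<open>a \<in> actions\<close>.
\<close>

definition obs_space :: "('p::finite action \<times> ('p \<Rightarrow> real)) measure" where
  "obs_space = sigma (SIGMA a:actions. space (PiM (coords a) (\<lambda>_. borel)))
     {{a} \<times> B |a B. a \<in> actions \<and> B \<in> sets (PiM (coords a) (\<lambda>_. borel))}"

text \<open>Histories available before round \<open>t\<close>, i.e. of the rounds \<open>1, \<dots>, t - 1\<close>.\<close>

definition hist_space :: "nat \<Rightarrow> (nat \<Rightarrow> 'p::finite action \<times> ('p \<Rightarrow> real)) measure" where
  "hist_space t = PiM {1..<t} (\<lambda>_. obs_space)"

definition history ::
    "(nat \<Rightarrow> 'w \<Rightarrow> 'p action) \<Rightarrow> (nat \<Rightarrow> 'w \<Rightarrow> 'p \<Rightarrow> real) \<Rightarrow> nat \<Rightarrow> 'w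
       \<Rightarrow> nat \<Rightarrow> 'p action \<times> ('p \<Rightarrow> real)" where
  "history act X t \<omega> = (\<lambda>s\<in>{1..<t}. (act s \<omega>, X s \<omega>))"

text \<open>
  A (possibly randomised) policy maps the history before round \<open>t\<close> measurably to a distribution
  on the actions; it has no access to the parameter.
\<close>

definition adaptive_policy ::
    "(nat \<Rightarrow> (nat \<Rightarrow> 'p::finite action \<times> ('p \<Rightarrow> real)) \<Rightarrow> 'p action pmf) \<Rightarrow> bool" where
  "adaptive_policy \<pi> \<longleftrightarrow>
     (\<forall>t\<ge>1. (\<forall>h\<in>space (hist_space t). set_pmf (\<pi> t h) \<subseteq> actions) \<and>
        (\<forall>a\<in>actions. (\<lambda>h. pmf (\<pi> t h) a) \<in> borel_measurable (hist_space t)))"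

text \<open>
  The last two clauses say: given the history, \<open>act t\<close> has conditional distribution
  \<open>\<pi> t\<close>(history); given the history and \<open>act t = a\<close>, \<open>X t\<close> has conditional distribution
  \<open>act_law U \<theta> a\<close>.
\<close>

definition sampling_process ::
    "'w measure \<Rightarrow> ('p::finite \<Rightarrow> nat \<Rightarrow> real) \<Rightarrow> 'p param
       \<Rightarrow> (nat \<Rightarrow> (nat \<Rightarrow> 'p action \<times> ('p \<Rightarrow> real)) \<Rightarrow> 'p action pmf)
       \<Rightarrow> (nat \<Rightarrow> 'w \<Rightarrow> 'p action) \<Rightarrow> (nat \<Rightarrow> 'w \<Rightarrow> 'p \<Rightarrow> real) \<Rightarrow> bool" where
  "sampling_process M U \<theta> \<pi> act X \<longleftrightarrow>
     prob_space M \<and>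
     (\<forall>t\<ge>1. (\<lambda>\<omega>. (act t \<omega>, X t \<omega>)) \<in> M \<rightarrow>\<^sub>M obs_space) \<and>
     (\<forall>t\<ge>1. \<forall>a\<in>actions. \<forall>H\<in>sets (hist_space t).
        measure M {\<omega>\<in>space M. history act X t \<omega> \<in> H \<and> act t \<omega> = a} =
          (LINT \<omega>|M. indicator H (history act X t \<omega>) * pmf (\<pi> t (history act X t \<omega>)) a)) \<and>
     (\<forall>t\<ge>1. \<forall>a\<in>actions. \<forall>H\<in>sets (hist_space t). \<forall>B\<in>sets (PiM (coords a) (\<lambda>_. borel)).
        measure M {\<omega>\<in>space M. history act X t \<omega> \<in> H \<and> act t \<omega> = a \<and> X t \<omega> \<in> B} =
          measure M {\<omega>\<in>space M. history act X t \<omega> \<in> H \<and> act t \<omega> = a}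
            * measure (act_law U \<theta> a) B)"

definition act_count :: "(nat \<Rightarrow> 'w \<Rightarrow> 'p action) \<Rightarrow> nat \<Rightarrow> 'p action \<Rightarrow> 'w \<Rightarrow> nat" where
  "act_count act t a \<omega> = card {s\<in>{1..t}. act s \<omega> = a}"

definition log_lik ::
    "('p::finite \<Rightarrow> nat \<Rightarrow> real) \<Rightarrow> (nat \<Rightarrow> 'w \<Rightarrow> 'p action) \<Rightarrow> (nat \<Rightarrow> 'w \<Rightarrow> 'p \<Rightarrow> real)
       \<Rightarrow> nat \<Rightarrow> 'w \<Rightarrow> 'p param \<Rightarrow> real" where
  "log_lik U act X t \<omega> \<theta> = (\<Sum>s=1..t. ln (act_density U \<theta> (act s \<omega>) (X s \<omega>)))"

text \<open>
  Joint maximum likelihood estimators: random elements of \<open>param_space b\<close> that maximise the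
  likelihood. Measurability of the graph component follows from that of \<open>coef\<close>, which
  determines it.
\<close>

definition mle_process ::
    "'w measure \<Rightarrow> bounds \<Rightarrow> ('p::finite \<Rightarrow> nat \<Rightarrow> real) \<Rightarrow> (nat \<Rightarrow> 'w \<Rightarrow> 'p action)
       \<Rightarrow> (nat \<Rightarrow> 'w \<Rightarrow> 'p \<Rightarrow> real) \<Rightarrow> (nat \<Rightarrow> 'w \<Rightarrow> 'p param) \<Rightarrow> bool" where
  "mle_process M b U act X est \<longleftrightarrow>
     (\<forall>t\<ge>1. (\<lambda>\<omega>. coef (est t \<omega>)) \<in> borel_measurable M \<and>
        (\<lambda>\<omega>. noise (est t \<omega>)) \<in> borel_measurable M \<and>
        (\<forall>\<omega>\<in>space M. is_arg_max (log_lik U act X t \<omega>) (\<lambda>\<theta>. \<theta> \<in> param_space b) (est t \<omega>)))"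

text \<open>
  \<open>KL(P || Q)\<close> in nats; note that \<open>KL_divergence b Q P\<close> integrates over its last argument.
\<close>

definition KL :: "'x measure \<Rightarrow> 'x measure \<Rightarrow> real" where
  "KL P Q = KL_divergence (exp 1) Q P"

section \<open>Constants\<close>

definition G_p :: "nat \<Rightarrow> bounds \<Rightarrow> real" where
  "G_p p b = (\<Sum>k<p. (real p * A_max b) ^ k)"

definition B_mu :: "nat \<Rightarrow> bounds \<Rightarrow> real" where
  "B_mu p b = G_p p b * sqrt (real p) * A_max b * C_max b"

definition v_minus :: "nat \<Rightarrow> bounds \<Rightarrow> real" where
  "v_minus p b = (sigma_min b)\<^sup>2 / (1 + real p * A_max b)\<^sup>2"

definition v_plus :: "nat \<Rightarrow> bounds \<Rightarrow> real" where
  "v_plus p b = (G_p p b)\<^sup>2 * (sigma_max b)\<^sup>2"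

definition kappa_V :: "nat \<Rightarrow> bounds \<Rightarrow> real" where
  "kappa_V p b = v_plus p b / v_minus p b"

definition g_fun :: "real \<Rightarrow> real" where
  "g_fun r = (r - 1 - ln r) / 2"

definition h_fun :: "real \<Rightarrow> real" where
  "h_fun r = ln ((1 + r) / (2 * sqrt r)) / 2"

definition hg_ratio :: "real \<Rightarrow> real" where
  "hg_ratio r = (if r = 1 then 1 / 4 else h_fun r / g_fun r)"

definition kappa_mu :: "nat \<Rightarrow> bounds \<Rightarrow> real" where
  "kappa_mu p b = v_minus p b / (4 * v_plus p b)"

text \<open>The infimum is a minimum, since \<open>hg_ratio\<close> is continuous on the compact interval.\<close>

definition kappa_Sigma :: "nat \<Rightarrow> bounds \<Rightarrow> real" where
  "kappa_Sigma p b = (INF r\<in>{1 / kappa_V p b..kappa_V p b}. hg_ratio r)"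

definition kappa_B :: "nat \<Rightarrow> bounds \<Rightarrow> real" where
  "kappa_B p b = min (kappa_mu p b) (kappa_Sigma p b)"

fun d_act :: "'p::finite action \<Rightarrow> nat" where
  "d_act (Observe :: 'p action) = CARD('p)"
| "d_act (Do j s :: 'p action) = CARD('p) - 1"

definition s_act :: "'p::finite action \<Rightarrow> nat" where
  "s_act a = d_act a * (d_act a + 1) div 2"

definition q_dim :: "'p::finite itself \<Rightarrow> nat" where
  "q_dim _ = (\<Sum>a\<in>(actions :: 'p action set). d_act a + s_act a)"

definition cover_num :: "'p::finite itself \<Rightarrow> bounds \<Rightarrow> real \<Rightarrow> real" where
  "cover_num _ b \<zeta> =
     (\<Prod>a\<in>(actions :: 'p action set).
        (1 + 8 * B_mu CARD('p) b / \<zeta>) ^ d_act a *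
        (1 + 8 * sqrt (real (d_act a)) * v_plus CARD('p) b / \<zeta>) ^ s_act a)"

definition R_rad :: "nat \<Rightarrow> bounds \<Rightarrow> real \<Rightarrow> real" where
  "R_rad p b z = B_mu p b + sqrt (v_plus p b) * (sqrt (real p) + sqrt (2 * z))"

definition L_ell :: "nat \<Rightarrow> bounds \<Rightarrow> real \<Rightarrow> real" where
  "L_ell p b R =
     (R + B_mu p b) / v_minus p b +
     (sqrt (real p) / v_minus p b + (R + B_mu p b)\<^sup>2 / (v_minus p b)\<^sup>2) / 2"

definition L_KL :: "nat \<Rightarrow> bounds \<Rightarrow> real" where
  "L_KL p b = (2 * B_mu p b + sqrt (real p)) / v_minus p b"

definition z_lev :: "nat \<Rightarrow> bounds \<Rightarrow> nat \<Rightarrow> real \<Rightarrow> real" where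
  "z_lev p b t x = kappa_B p b * x + 2 * ln (real t + 1)"

definition H_lip :: "nat \<Rightarrow> bounds \<Rightarrow> nat \<Rightarrow> real \<Rightarrow> real" where
  "H_lip p b t x = L_ell p b (R_rad p b (z_lev p b t x)) / 2 + kappa_B p b * L_KL p b"

definition zeta :: "'p::finite itself \<Rightarrow> bounds \<Rightarrow> nat \<Rightarrow> real \<Rightarrow> real" where
  "zeta T b t x = min 1 (real (q_dim T) / (real t * H_lip CARD('p) b t x))"

definition tail_bound :: "'p::finite itself \<Rightarrow> bounds \<Rightarrow> nat \<Rightarrow> real \<Rightarrow> real" where
  "tail_bound T b t x =
     min 1 ((exp (real (q_dim T)) * cover_num T b (zeta T b t x) + 1)
              * exp (- kappa_B CARD('p) b * x))"

end

theory Submission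
  imports Defs
begin

text \<open>
  For a fixed \<open>\<theta>\<close>, half the log-likelihood ratio of \<open>\<theta>\<close> against the true parameter, compensated in
  every round by the Bhattacharyya distance of the two laws of the chosen action, is the logarithm
  of a martingale with mean one. Diagonalising the two covariances of an action simultaneously
  reduces Bhattacharyya distance and divergence to sums over coordinates, and the constant
  \<open>\<kappa>\<^sub>B\<close> is such that the former is at least \<open>\<kappa>\<^sub>B\<close> times the latter. Hence, by Markov's
  inequality, half the log-likelihood ratio plus \<open>\<kappa>\<^sub>B\<close> times the accumulated divergence exceeds
  \<open>\<kappa>\<^sub>B x - q\<close> with probability at most \<open>exp (q - \<kappa>\<^sub>B x)\<close>.

  The maximum likelihood estimator has a nonnegative log-likelihood ratio. It is replaced by a
  nearby point of a finite net, which is built from the means and covariances of all actions; when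
  no observation is far from its mean, this costs at most \<open>q\<close> in the exponent, by the choice of
  the mesh. By a chi-square tail bound, a far observation occurs in the first \<open>t\<close> rounds with
  probability at most \<open>exp (- \<kappa>\<^sub>B x)\<close>.
\<close>

section \<open>Simultaneous diagonalisation\<close>

text \<open>The full likelihood ratio has mean exactly one under the true law, which leaves no
  slack. Its square root has mean exp (- Bhattacharyya distance), finite for every pair of
  nondegenerate Gaussians, and that distance pays for the divergence term; hence the factor 1/2 and
  the comparison of two divergences in \<open>kappa_B\<close>. Markov's inequality serves a \<theta>
  fixed in advance, whereas the estimator depends on the same data: this forces the net and the
  union bound over it. The log-likelihood is a sum of t terms, so the mesh must shrink like 1 / t,
  and its Lipschitz constant grows with the observation, so far observations must be cut off. The
  other obstacle is that the actions live on coordinate spaces of different dimension. Matrices on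
  \<open>R\<close> are completed by an identity block and Gaussians by standard normal coordinates.
  Every action is then handled in one type by invertible matrices of full size, and the added
  coordinates contribute equally to both laws and cancel from every ratio.\<close>

lemma matrix_inv_eqI:
  fixes A B :: "real^'n^'n"
  assumes "A ** B = mat 1"
  shows "matrix_inv A = B"
proof -
  have BA: "B ** A = mat 1" using assms matrix_left_right_inverse by blast
  have "A ** matrix_inv A = mat 1 \<and> matrix_inv A ** A = mat 1"
    unfolding matrix_inv_def using assms BA by (intro someI_ex[where P="\<lambda>A'. A ** A' = mat 1 \<and> A' ** A = mat 1"]) auto
  then have "matrix_inv A = matrix_inv A ** (A ** B)" "matrix_inv A ** A = mat 1"
    using assms by simp_all
  then show ?thesis by (simp add: matrix_mul_assoc)
qed

lemma inner_matrix_transpose: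
  fixes A :: "real^'n^'n"
  shows "x \<bullet> (A *v y) = (transpose A *v x) \<bullet> y"
  by (simp add: dot_lmul_matrix[symmetric])

lemma inner_symmetric_matrix:
  fixes A :: "real^'n^'n"
  assumes "transpose A = A"
  shows "x \<bullet> (A *v y) = y \<bullet> (A *v x)"
  using inner_matrix_transpose[of x A y] assms by (simp add: inner_commute)

text \<open>The first-order condition at a maximum, in a form that avoids derivatives.\<close>

lemma linear_term_zero:
  fixes a b :: real
  assumes "\<And>s. 2 * s * a + s\<^sup>2 * b \<le> 0"
  shows "a = 0"
proof (rule ccontr)
  assume "a \<noteq> 0"
  \<comment> \<open>This \<open>s\<close> has the sign of \<open>a\<close> and is small enough for
    the linear term to beat the quadratic one, whatever the sign of \<open>b\<close>.\<close>
  define s where "s = a / (1 + \<bar>b\<bar>)"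
  have a: "a = s * (1 + \<bar>b\<bar>)" and "s \<noteq> 0"
    using \<open>a \<noteq> 0\<close> by (auto simp: s_def field_simps)
  have "2 * s * a + s\<^sup>2 * b = s\<^sup>2 * (2 * (1 + \<bar>b\<bar>) + b)"
    by (subst a) (simp add: algebra_simps power2_eq_square)
  also have "\<dots> > 0" using \<open>s \<noteq> 0\<close> by (intro mult_pos_pos) (auto simp: abs_if)
  finally show False using assms[of s] by simp
qed

text \<open>The V-unit sphere of \<open>S\<close> is compact because V is positive definite, so the
  W-form attains its maximum there. The first variation at the maximiser is the eigenvalue equation,
  but tested against directions in \<open>S\<close> only.\<close>

lemma rayleigh_maximizer:
  fixes V W :: "real^'n^'n"
  assumes V: "transpose V = V" and W: "transpose W = W"
    and c: "c > 0" and pd: "\<And>x. c * (x \<bullet> x) \<le> x \<bullet> (V *v x)"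
    and S: "subspace S" and z: "z \<in> S" "z \<noteq> 0"
  shows "\<exists>v\<in>S. v \<bullet> (V *v v) = 1 \<and> (\<forall>w\<in>S. w \<bullet> (W *v v) = (v \<bullet> (W *v v)) * (w \<bullet> (V *v v)))"
proof -
  define K where "K = {x \<in> S. x \<bullet> (V *v x) = 1}"
  have cont: "continuous_on A (\<lambda>x. x \<bullet> (Q *v x))" for A and Q :: "real^'n^'n"
    by (intro continuous_intros linear_continuous_on_compose[OF continuous_on_id]) auto
  have vpos: "x \<bullet> (V *v x) > 0" if "x \<noteq> 0" for x
    using pd[of x] c that by (smt (verit) inner_gt_zero_iff mult_pos_pos)
  have "closed K"
  proof -
    have "closed {x. x \<bullet> (V *v x) = 1}"
      using continuous_closed_preimage[OF cont[of UNIV V] closed_UNIV, of "{1}"]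
      by (simp add: vimage_def)
    then show ?thesis
      unfolding K_def using closed_subspace[OF S] by (simp add: Collect_conj_eq closed_Int)
  qed
  moreover have "bounded K"
  proof (rule boundedI)
    fix x assume "x \<in> K"
    then have "c * (norm x)\<^sup>2 \<le> 1" using pd[of x] by (simp add: K_def power2_norm_eq_inner)
    then have "(norm x)\<^sup>2 \<le> 1 / c" using c by (simp add: field_simps)
    then show "norm x \<le> sqrt (1 / c)" using real_le_rsqrt by blast
  qed
  ultimately have "compact K" by (simp add: compact_eq_bounded_closed)
  moreover have scale: "(1 / sqrt (y \<bullet> (V *v y))) *\<^sub>R y \<in> K" if "y \<in> S" "y \<noteq> 0" for y
    using vpos[OF that(2)] that S
    by (auto simp: K_def subspace_scale matrix_vector_mult_scaleR field_simps)
  then have "K \<noteq> {}" using z by blast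
  ultimately obtain v where v: "v \<in> K" "\<And>y. y \<in> K \<Longrightarrow> y \<bullet> (W *v y) \<le> v \<bullet> (W *v v)"
    using continuous_attains_sup[OF _ _ cont[of K W]] by blast
  let ?l = "v \<bullet> (W *v v)"
  have le: "y \<bullet> (W *v y) \<le> ?l * (y \<bullet> (V *v y))" if "y \<in> S" for y
  proof (cases "y = 0")
    case False
    have "(y \<bullet> (W *v y)) / (y \<bullet> (V *v y)) \<le> ?l"
      using v(2)[OF scale[OF that False]] vpos[OF False]
      by (simp add: matrix_vector_mult_scaleR field_simps)
    then show ?thesis using vpos[OF False] by (simp add: field_simps)
  qed simp
  have "w \<bullet> (W *v v) = ?l * (w \<bullet> (V *v v))" if "w \<in> S" for w
  proof -
    \<comment> \<open>The W-form minus \<open>?l\<close> times the V-form, evaluated at v + s w, is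
      a polynomial in s with these coefficients; its constant term vanishes because v is
      V-normalised.\<close>
    let ?a = "w \<bullet> (W *v v) - ?l * (w \<bullet> (V *v v))"
    let ?b = "w \<bullet> (W *v w) - ?l * (w \<bullet> (V *v w))"
    have vS: "v \<in> S" and v1: "v \<bullet> (V *v v) = 1" using v by (auto simp: K_def)
    have q: "2 * s * ?a + s\<^sup>2 * ?b \<le> 0" for s
    proof -
      have "v + s *\<^sub>R w \<in> S" using vS that S by (simp add: subspace_add subspace_scale)
      from le[OF this] show ?thesis using v1
        by (simp add: matrix_vector_right_distrib matrix_vector_mult_scaleR inner_add_left
            inner_add_right inner_symmetric_matrix[OF V, of v w] inner_symmetric_matrix[OF W, of v w]
            algebra_simps power2_eq_square)
    qed
    show ?thesis using linear_term_zero[OF q] by linarith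
  qed
  moreover have "v \<in> S" "v \<bullet> (V *v v) = 1" using v(1) by (simp_all add: K_def)
  ultimately show ?thesis by blast
qed

text \<open>
  Each new eigenvector maximises the Rayleigh quotient of \<open>W\<close> relative to \<open>V\<close> on the
  \<open>V\<close>-orthogonal complement of those already found.
\<close>

lemma generalized_eigenbasis:
  fixes V W :: "real^'n^'n"
  assumes V: "transpose V = V" and W: "transpose W = W"
    and c: "c > 0" and pd: "\<And>x. c * (x \<bullet> x) \<le> x \<bullet> (V *v x)"
  shows "\<exists>f :: 'n \<Rightarrow> real^'n. \<exists>r. \<forall>i j.
     f i \<bullet> (V *v f j) = (if i = j then 1 else 0) \<and> W *v f i = r i *\<^sub>R (V *v f i)"
proof -
  have "\<exists>f :: 'n \<Rightarrow> real^'n. \<exists>r. (\<forall>i\<in>A. W *v f i = r i *\<^sub>R (V *v f i)) \<and>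
     (\<forall>i\<in>A. \<forall>j\<in>A. f i \<bullet> (V *v f j) = (if i = j then 1 else 0))" for A :: "'n set"
    using finite[of A]
  proof (induction A rule: finite_induct)
    case (insert a A)
    then obtain f :: "'n \<Rightarrow> real^'n" and r where
      fr: "(\<forall>i\<in>A. W *v f i = r i *\<^sub>R (V *v f i)) \<and>
        (\<forall>i\<in>A. \<forall>j\<in>A. f i \<bullet> (V *v f j) = (if i = j then 1 else 0))"
      by blast
    have eig: "W *v f i = r i *\<^sub>R (V *v f i)" if "i \<in> A" for i
      using fr that by blast
    have orth: "f i \<bullet> (V *v f j) = (if i = j then 1 else 0)" if "i \<in> A" "j \<in> A" for i j
      using fr that by blast
    define S where "S = {x. \<forall>i\<in>A. x \<bullet> (V *v f i) = 0}"
    have S: "subspace S" unfolding S_def subspace_def by (auto simp: inner_add_left)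
    \<comment> \<open>Fewer than n vectors cannot span, and a vector orthogonal to all of them shows
      that the complement \<open>S\<close> is not trivial.\<close>
    have "dim ((\<lambda>i. V *v f i) ` A) \<le> card A"
      by (meson card_image_le dim_le_card' finite_imageI insert.hyps(1) le_trans)
    also have "\<dots> < DIM(real^'n)"
      using psubset_card_mono[of UNIV A] insert.hyps(2) by auto
    finally obtain z where z: "z \<noteq> 0"
      "\<And>x. x \<in> span ((\<lambda>i. V *v f i) ` A) \<Longrightarrow> orthogonal z x"
      using orthogonal_to_subspace_exists by blast
    have "z \<in> S" 
      unfolding S_def using z(2)[OF span_base] by (auto simp: orthogonal_def)
    from rayleigh_maximizer[OF V W c pd S this z(1)] obtain v where
      v: "v \<in> S" "v \<bullet> (V *v v) = 1"
      "\<And>w. w \<in> S \<Longrightarrow> w \<bullet> (W *v v) = (v \<bullet> (W *v v)) * (w \<bullet> (V *v v))" by blast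
    obtain l where l: "l = v \<bullet> (W *v v)" by simp
    have vl: "w \<bullet> (W *v v) = l * (w \<bullet> (V *v v))" if "w \<in> S" for w
      using v(3)[OF that] l by simp
    have vf: "f i \<bullet> (V *v v) = 0" "v \<bullet> (V *v f i) = 0" if "i \<in> A" for i
      using v(1) that inner_symmetric_matrix[OF V, of "f i" v] by (auto simp: S_def)
    have wf: "f i \<bullet> (W *v v) = 0" if "i \<in> A" for i
      using eig[OF that] vf[OF that] inner_symmetric_matrix[OF W, of "f i" v] by simp
    have "u \<bullet> (W *v v) = u \<bullet> (l *\<^sub>R (V *v v))" for u
    proof -
      \<comment> \<open>The eigenvalue equation is known against \<open>S\<close> only. An arbitrary
        u is split into its V-projection w onto \<open>S\<close> and a combination of the
        \<open>f i\<close>; by \<open>wf\<close> and \<open>vf\<close> the latter contributes zero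
        to both sides.\<close>
      define w where "w = u - (\<Sum>i\<in>A. (u \<bullet> (V *v f i)) *\<^sub>R f i)"
      have "w \<in> S"
      proof -
        have "(\<Sum>i\<in>A. (u \<bullet> (V *v f i)) * (f i \<bullet> (V *v f j))) = u \<bullet> (V *v f j)" if "j \<in> A" for j
        proof -
          have "(\<Sum>i\<in>A. (u \<bullet> (V *v f i)) * (f i \<bullet> (V *v f j)))
              = (\<Sum>i\<in>A. if i = j then u \<bullet> (V *v f j) else 0)"
            using orth that by (intro sum.cong) auto
          then show ?thesis using insert.hyps(1) that by simp
        qed
        then show ?thesis by (auto simp: S_def w_def inner_diff_left inner_sum_left)
      qed
      have dec: "u \<bullet> y = w \<bullet> y + (\<Sum>i\<in>A. (u \<bullet> (V *v f i)) * (f i \<bullet> y))" for y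
        by (simp add: w_def inner_diff_left inner_sum_left)
      have "u \<bullet> (W *v v) = w \<bullet> (W *v v)"
        by (subst dec) (simp add: wf)
      moreover have "u \<bullet> (V *v v) = w \<bullet> (V *v v)"
        by (subst dec) (simp add: vf)
      ultimately show ?thesis using vl[OF \<open>w \<in> S\<close>] by simp
    qed
    then have ev: "W *v v = l *\<^sub>R (V *v v)" by (metis vector_eq_ldot)
    have fa: "(f(a := v)) i = f i" "(r(a := l)) i = r i" if "i \<in> A" for i
      using that insert.hyps(2) by auto
    show ?case
    proof (intro exI conjI ballI)
      fix i assume "i \<in> insert a A"
      then show "W *v (f(a := v)) i = (r(a := l)) i *\<^sub>R (V *v (f(a := v)) i)"
        using fa[of i] eig[of i] ev by (cases "i = a") (simp_all only: fun_upd_same, simp)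
      fix j assume "j \<in> insert a A"
      then show "(f(a := v)) i \<bullet> (V *v (f(a := v)) j) = (if i = j then 1 else 0)"
        using \<open>i \<in> insert a A\<close> fa[of i] fa[of j] orth[of i j] vf[of i] vf[of j] v(2) insert.hyps(2)
        by (cases "i = a"; cases "j = a") simp_all
    qed
  qed simp
  from this[of UNIV] obtain f :: "'n \<Rightarrow> real^'n" and r where
    "(\<forall>i\<in>UNIV. W *v f i = r i *\<^sub>R (V *v f i)) \<and>
     (\<forall>i\<in>UNIV. \<forall>j\<in>UNIV. f i \<bullet> (V *v f j) = (if i = j then 1 else 0))"
    by blast
  then show ?thesis by (intro exI[of _ f] exI[of _ r]) blast
qed

definition diag_mat :: "('n \<Rightarrow> real) \<Rightarrow> real^'n^'n::finite" where
  "diag_mat r = (\<chi> i j. if i = j then r i else 0)"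

lemma simultaneous_diagonalization:
  fixes V W :: "real^'n^'n"
  assumes V: "transpose V = V" and W: "transpose W = W"
    and c: "c > 0" and pd: "\<And>x. c * (x \<bullet> x) \<le> x \<bullet> (V *v x)"
  obtains T :: "real^'n^'n" and r where "transpose T ** V ** T = mat 1" "transpose T ** W ** T = diag_mat r"
proof -
  obtain f :: "'n \<Rightarrow> real^'n" and r where
    f: "\<And>i j. f i \<bullet> (V *v f j) = (if i = j then 1 else 0)"
    and e: "\<And>i. W *v f i = r i *\<^sub>R (V *v f i)"
    using generalized_eigenbasis[OF assms] by blast
  define T :: "real^'n^'n" where "T = (\<chi> i j. f j $ i)"
  have ent: "(transpose T ** Q ** T) $ i $ j = f i \<bullet> (Q *v f j)" for Q :: "real^'n^'n" and i j
    by (simp add: matrix_mul_assoc[symmetric])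
       (simp add: matrix_matrix_mult_def transpose_def inner_vec_def matrix_vector_mult_def T_def)
  have "transpose T ** V ** T = mat 1" by (simp add: vec_eq_iff ent f mat_def)
  moreover have "transpose T ** W ** T = diag_mat r"
    by (simp add: vec_eq_iff ent e f diag_mat_def)
  ultimately show ?thesis using that by blast
qed

section \<open>Covariance matrices of the structural model\<close>

text \<open>Vectors supported on \<open>R\<close> stand for the elements of
  \<real>\<open>\<^sup>R\<close>, so that all actions share one vector type;
  \<open>on R x = x\<close> is the membership condition.\<close>

definition on :: "'n set \<Rightarrow> real^'n \<Rightarrow> real^'n::finite" where
  "on R x = (\<chi> i. if i \<in> R then x $ i else 0)"

lemma on_component [simp]: "on R x $ i = (if i \<in> R then x $ i else 0)"
  by (simp add: on_def)

lemma on_UNIV [simp]: "on UNIV x = x"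
  by (simp add: vec_eq_iff)

lemma on_eq_iff: "on R x = x \<longleftrightarrow> (\<forall>i. i \<notin> R \<longrightarrow> x $ i = 0)"
  by (auto simp: vec_eq_iff)

lemma on_on [simp]: "on R (on R x) = on R x"
  by (simp add: vec_eq_iff)

lemma on_diff: "on R (x - y) = on R x - on R y"
  by (simp add: vec_eq_iff)

lemma norm_on_le: "norm (on R x) \<le> norm x"
  unfolding norm_vec_def by (intro L2_set_mono) auto

text \<open>Covariance matrices on \<open>\<real>\<^sup>R\<close> in block form (identity off \<open>R\<close>), with spectrum in \<open>[lo, hi]\<close>.\<close>

definition cov_class :: "'n set \<Rightarrow> real \<Rightarrow> real \<Rightarrow> (real^'n^'n::finite) set" where
  "cov_class R lo hi = {V. transpose V = V \<and> principal R V = V \<and>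
     (\<forall>u. on R u = u \<longrightarrow> lo * (u \<bullet> u) \<le> u \<bullet> (V *v u) \<and> u \<bullet> (V *v u) \<le> hi * (u \<bullet> u))}"

lemma principal_entry:
  assumes "principal R V = V" "i \<notin> R \<or> j \<notin> R"
  shows "V $ i $ j = (if i = j then 1 else 0)"
  using assms(2) by (subst assms(1)[symmetric]) (auto simp: principal_def)

lemma principal_eqI:
  fixes V :: "real^'n^'n"
  assumes sym: "transpose V = V" and col: "\<And>j. j \<notin> R \<Longrightarrow> V *v axis j 1 = axis j 1"
  shows "principal R V = V"
proof -
  have ent: "V $ i $ j = (if i = j then 1 else 0)" if "j \<notin> R" for i j
    using col[OF that] unfolding matrix_vector_mult_basis by (auto simp: column_def vec_eq_iff axis_def)
  have swap: "V $ i $ j = V $ j $ i" for i j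
    using arg_cong[OF sym, of "\<lambda>M. M $ j $ i"] by (simp add: transpose_def)
  have "V $ i $ j = (if i = j then 1 else 0)" if "i \<notin> R" for i j
    using ent[OF that, of j] by (subst swap) auto
  with ent show ?thesis unfolding principal_def vec_eq_iff vec_lambda_beta by metis
qed

lemma block_mult_component:
  assumes "principal R V = V"
  shows "(V *v x) $ i = (if i \<in> R then (V *v on R x) $ i else x $ i)"
proof (cases "i \<in> R")
  case True
  have "V $ i $ j * x $ j = V $ i $ j * on R x $ j" for j
    using principal_entry[OF assms, of i j] True by auto
  then show ?thesis using True unfolding matrix_vector_mult_def vec_lambda_beta by (simp only: if_True)
next
  case False
  have "(V *v x) $ i = (\<Sum>j\<in>UNIV. if i = j then x $ j else 0)"
    unfolding matrix_vector_mult_def vec_lambda_beta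
    using principal_entry[OF assms, of i] False by (intro sum.cong) auto
  then show ?thesis using False by simp
qed

lemma block_mult_on:
  assumes "principal R V = V"
  shows "on R (V *v on R x) = V *v on R x"
  by (auto simp: on_eq_iff block_mult_component[OF assms])

text \<open>The identity block decouples from the block on \<open>R\<close>. This identity converts
  bounds assumed on \<open>R\<close> into bounds on the whole space and back.\<close>

lemma block_form:
  assumes "principal R V = V"
  shows "x \<bullet> (V *v x) = on R x \<bullet> (V *v on R x) + (\<Sum>i\<in>-R. (x $ i)\<^sup>2)"
proof -
  have "x \<bullet> (V *v x) = (\<Sum>i\<in>R. x $ i * (V *v x) $ i) + (\<Sum>i\<in>-R. x $ i * (V *v x) $ i)"
    unfolding inner_vec_def inner_real_def
    by (subst sum.union_disjoint[symmetric]) (auto intro!: sum.cong)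
  also have "(\<Sum>i\<in>R. x $ i * (V *v x) $ i) = (\<Sum>i\<in>UNIV. on R x $ i * (V *v on R x) $ i)"
    by (intro sum.mono_neutral_cong_left) (auto simp: block_mult_component[OF assms, of x])
  also have "(\<Sum>i\<in>-R. x $ i * (V *v x) $ i) = (\<Sum>i\<in>-R. (x $ i)\<^sup>2)"
    by (intro sum.cong) (auto simp: block_mult_component[OF assms, of x] power2_eq_square)
  finally show ?thesis by (simp add: inner_vec_def)
qed

lemma inner_self_on: "x \<bullet> x = on R x \<bullet> on R x + (\<Sum>i\<in>-R. (x $ i)\<^sup>2)"
proof -
  have "principal R (mat 1) = mat 1" by (simp add: principal_def vec_eq_iff mat_def)
  from block_form[OF this, of x] show ?thesis by simp
qed

section \<open>Spectral bounds for padded covariance matrices\<close>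

context
  fixes R :: "'n::finite set" and lo hi :: real
  assumes lo: "0 < lo" and lohi: "lo \<le> hi"
begin

text \<open>The padding adds the eigenvalue one, which may lie below \<open>lo\<close>; hence the
  minimum.\<close>

lemma cov_class_pd:
  assumes "V \<in> cov_class R lo hi"
  shows "min lo 1 * (x \<bullet> x) \<le> x \<bullet> (V *v x)"
proof -
  have P: "principal R V = V" using assms by (simp add: cov_class_def)
  have "min lo 1 * (on R x \<bullet> on R x) \<le> lo * (on R x \<bullet> on R x)"
    by (intro mult_right_mono) auto
  moreover have "min lo 1 * (\<Sum>i\<in>-R. (x $ i)\<^sup>2) \<le> 1 * (\<Sum>i\<in>-R. (x $ i)\<^sup>2)"
    by (intro mult_right_mono sum_nonneg) auto
  moreover have "lo * (on R x \<bullet> on R x) \<le> on R x \<bullet> (V *v on R x)"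
    using assms by (simp add: cov_class_def)
  ultimately show ?thesis
    unfolding block_form[OF P, of x] inner_self_on[of x R] by (simp add: distrib_left)
qed

text \<open>On the padding the two forms have ratio one, which is at least \<open>lo / hi\<close>.
  Comparing V with W directly, rather than both with the Euclidean form, thus keeps the constant
  free of the padding.\<close>

lemma cov_class_compare:
  assumes "V \<in> cov_class R lo hi" "W \<in> cov_class R lo hi"
  shows "lo / hi * (x \<bullet> (V *v x)) \<le> x \<bullet> (W *v x)"
proof -
  have P: "principal R V = V" "principal R W = W" using assms by (simp_all add: cov_class_def)
  have "lo / hi * (on R x \<bullet> (V *v on R x)) \<le> lo / hi * (hi * (on R x \<bullet> on R x))"
    using assms lo lohi by (intro mult_left_mono) (auto simp: cov_class_def)
  also have "\<dots> = lo * (on R x \<bullet> on R x)" using lo lohi by simp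
  also have "\<dots> \<le> on R x \<bullet> (W *v on R x)" using assms by (simp add: cov_class_def)
  finally have "lo / hi * (on R x \<bullet> (V *v on R x)) \<le> on R x \<bullet> (W *v on R x)" .
  moreover have "lo / hi * (\<Sum>i\<in>-R. (x $ i)\<^sup>2) \<le> 1 * (\<Sum>i\<in>-R. (x $ i)\<^sup>2)"
    using lo lohi by (intro mult_right_mono sum_nonneg) auto
  ultimately show ?thesis
    unfolding block_form[OF P(1), of x] block_form[OF P(2), of x] by (simp add: distrib_left)
qed

text \<open>The range obtained for the relative eigenvalues is the interval from 1 /
  \<open>kappa_V\<close> to \<open>kappa_V\<close> over which \<open>kappa_Sigma\<close> is taken,
  once \<open>lo\<close> and \<open>hi\<close> are \<open>v_minus\<close> and
  \<open>v_plus\<close>.\<close>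

lemma whitening:
  assumes V: "V \<in> cov_class R lo hi" and W: "W \<in> cov_class R lo hi"
  obtains T :: "real^'n^'n" and r where "transpose T ** V ** T = mat 1" "transpose T ** W ** T = diag_mat r"
    "\<forall>i. lo / hi \<le> r i \<and> r i \<le> hi / lo"
proof -
  have sym: "transpose V = V" "transpose W = W" using V W by (simp_all add: cov_class_def)
  obtain T :: "real^'n^'n" and r where T: "transpose T ** V ** T = mat 1" "transpose T ** W ** T = diag_mat r"
    by (rule simultaneous_diagonalization[OF sym, of "min lo 1"])
       (use lo cov_class_pd[OF V] in auto)
  have ent: "(transpose T ** Q ** T) $ i $ i = column i T \<bullet> (Q *v column i T)" for Q :: "real^'n^'n" and i
    by (simp add: matrix_mul_assoc[symmetric])
       (simp add: matrix_matrix_mult_def transpose_def inner_vec_def matrix_vector_mult_def column_def)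
  have r: "r i = column i T \<bullet> (W *v column i T)" and o: "column i T \<bullet> (V *v column i T) = 1" for i
    using ent[of V i] ent[of W i] T by (simp_all add: diag_mat_def mat_def)
  have "lo / hi \<le> r i" for i
    using cov_class_compare[OF V W, of "column i T"] r[of i] o[of i] by simp
  moreover have "r i \<le> hi / lo" for i
    using cov_class_compare[OF W V, of "column i T"] r[of i] o[of i] lo lohi
    by (simp add: field_simps)
  ultimately show ?thesis using that T by blast
qed

lemma whitening_self:
  assumes V: "V \<in> cov_class R lo hi"
  obtains T :: "real^'n^'n" where "transpose T ** V ** T = mat 1"
  using whitening[OF V V] by metis

lemma cov_class_inverse:
  assumes V: "V \<in> cov_class R lo hi"
  shows "V ** matrix_inv V = mat 1" "matrix_inv V ** V = mat 1"
    "transpose (matrix_inv V) = matrix_inv V" "det V > 0"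
proof -
  obtain T :: "real^'n^'n" where T: "transpose T ** V ** T = mat 1" using whitening_self[OF V] .
  have "T ** (transpose T ** V) = mat 1"
    using T matrix_left_right_inverse by blast
  then have *: "V ** (T ** transpose T) = mat 1"
    using matrix_left_right_inverse by (metis matrix_mul_assoc)
  then have eq: "matrix_inv V = T ** transpose T" by (rule matrix_inv_eqI)
  show "V ** matrix_inv V = mat 1" using * eq by simp
  then show "matrix_inv V ** V = mat 1" using matrix_left_right_inverse by blast
  show "transpose (matrix_inv V) = matrix_inv V" by (simp add: eq matrix_transpose_mul)
  have "det T * det V * det T = 1" using arg_cong[OF T, of det] by (simp add: det_mul det_transpose)
  then have "det V * (det T)\<^sup>2 = 1" by (simp add: power2_eq_square mult_ac)
  then show "det V > 0" by (smt (verit) mult_nonpos_nonneg zero_le_power2)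
qed

lemma cov_class_inverse_on:
  assumes V: "V \<in> cov_class R lo hi" and u: "on R u = u"
  shows "on R (matrix_inv V *v u) = matrix_inv V *v u" "norm (matrix_inv V *v u) \<le> norm u / lo"
proof -
  let ?w = "matrix_inv V *v u"
  have P: "principal R V = V" using V by (simp add: cov_class_def)
  have Vw: "V *v ?w = u" by (simp add: matrix_vector_mul_assoc cov_class_inverse[OF V])
  show on: "on R ?w = ?w"
    unfolding on_eq_iff using block_mult_component[OF P, of ?w] Vw u by (metis on_eq_iff)
  have "lo * (?w \<bullet> ?w) \<le> ?w \<bullet> u" using V on Vw by (auto simp: cov_class_def)
  also have "\<dots> \<le> norm ?w * norm u" by (rule norm_cauchy_schwarz)
  finally have "norm ?w * (lo * norm ?w) \<le> norm ?w * norm u"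
    by (simp add: power2_norm_eq_inner[symmetric] power2_eq_square mult_ac)
  then have "lo * norm ?w \<le> norm u \<or> norm ?w = 0"
    by (auto simp: mult_le_cancel_left)
  then show "norm ?w \<le> norm u / lo" using lo by (auto simp: field_simps)
qed

text \<open>This is the operator inequality V V \<le> hi V on \<open>R\<close>, obtained without a
  spectral decomposition: evaluate the nonnegative V-form at u - V u / hi and bound the term (V u)
  \<bullet> V (V u) by the upper spectral bound at V u.\<close>

lemma cov_class_norm_square:
  assumes V: "V \<in> cov_class R lo hi" and u: "on R u = u"
  shows "(V *v u) \<bullet> (V *v u) \<le> hi * (u \<bullet> (V *v u))"
proof -
  have P: "principal R V = V" and sym: "transpose V = V" using V by (simp_all add: cov_class_def)
  have hi: "hi > 0" using lo lohi by simp
  let ?w = "V *v u"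
  have won: "on R ?w = ?w" using block_mult_on[OF P, of u] u by simp
  have "on R (u - (1 / hi) *\<^sub>R ?w) = u - (1 / hi) *\<^sub>R ?w"
    using u won unfolding on_eq_iff by simp
  then have "0 \<le> (u - (1 / hi) *\<^sub>R ?w) \<bullet> (V *v (u - (1 / hi) *\<^sub>R ?w))"
    using V lo unfolding cov_class_def by (smt (verit) inner_ge_zero mem_Collect_eq mult_nonneg_nonneg)
  also have "\<dots> = u \<bullet> ?w - 2 / hi * (?w \<bullet> ?w) + (1 / hi)\<^sup>2 * (?w \<bullet> (V *v ?w))"
    by (simp add: matrix_vector_mult_diff_distrib matrix_vector_mult_scaleR inner_diff_left inner_diff_right
        inner_symmetric_matrix[OF sym, of u ?w] power2_eq_square algebra_simps)
  also have "\<dots> \<le> u \<bullet> ?w - 2 / hi * (?w \<bullet> ?w) + (1 / hi)\<^sup>2 * (hi * (?w \<bullet> ?w))"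
    using V u won hi by (intro add_mono diff_mono mult_left_mono) (auto simp: cov_class_def)
  also have "\<dots> = u \<bullet> ?w - (?w \<bullet> ?w) / hi"
    using hi by (simp add: power2_eq_square field_simps)
  finally show ?thesis using hi by (simp add: field_simps)
qed

lemma cov_class_norm:
  assumes V: "V \<in> cov_class R lo hi" and u: "on R u = u"
  shows "norm (V *v u) \<le> hi * norm u"
proof -
  have hi: "hi > 0" using lo lohi by simp
  have "(V *v u) \<bullet> (V *v u) \<le> hi * (u \<bullet> (V *v u))" by (rule cov_class_norm_square[OF V u])
  also have "\<dots> \<le> hi * (hi * (u \<bullet> u))" using V u hi by (intro mult_left_mono) (auto simp: cov_class_def)
  finally have "(norm (V *v u))\<^sup>2 \<le> (hi * norm u)\<^sup>2"
    unfolding power_mult_distrib power2_norm_eq_inner by (simp add: power2_eq_square mult_ac)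
  then show ?thesis using hi by (simp add: power2_le_iff_abs_le)
qed

end

section \<open>Inverses of I - A along an acyclic graph, and the bounds on means and
  covariances\<close>

lemma acyclic_rank:
  fixes D :: "('p::finite \<times> 'p) set"
  assumes "acyclic D"
  obtains \<rho> :: "'p \<Rightarrow> nat" where "\<And>k j. (k, j) \<in> D \<Longrightarrow> \<rho> k < \<rho> j" "\<And>j. \<rho> j < CARD('p)"
proof
  \<comment> \<open>The number of proper ancestors strictly increases along an edge, and it stays
    below p because no node is its own ancestor.\<close>
  define \<rho> where "\<rho> j = card {k. (k, j) \<in> D\<^sup>+}" for j
  show "\<rho> k < \<rho> j" if "(k, j) \<in> D" for k j
    unfolding \<rho>_def
  proof (rule psubset_card_mono)
    have "k \<notin> {i. (i, k) \<in> D\<^sup>+}" using assms by (auto simp: acyclic_def)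
    moreover have "k \<in> {i. (i, j) \<in> D\<^sup>+}" using that by auto
    moreover have "{i. (i, k) \<in> D\<^sup>+} \<subseteq> {i. (i, j) \<in> D\<^sup>+}" using that by auto
    ultimately show "{i. (i, k) \<in> D\<^sup>+} \<subset> {i. (i, j) \<in> D\<^sup>+}" by blast
  qed simp
  show "\<rho> j < CARD('p)" for j
    unfolding \<rho>_def using assms by (intro psubset_card_mono) (auto simp: acyclic_def)
qed

text \<open>Cauchy-Schwarz in each row. The resulting factor, with \<open>a = A_max\<close>, is the
  ratio of the geometric sum \<open>G_p\<close>.\<close>

lemma norm_mult_entries_le:
  fixes A :: "real^'n^'n"
  assumes "\<And>i j. \<bar>A $ i $ j\<bar> \<le> a"
  shows "norm (A *v v) \<le> real CARD('n) * a * norm v"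
proof -
  have a: "0 \<le> a" using assms[of undefined undefined] by simp
  have "((A *v v) $ i)\<^sup>2 \<le> real CARD('n) * a\<^sup>2 * (norm v)\<^sup>2" for i
  proof -
    have "((A *v v) $ i)\<^sup>2 = (row i A \<bullet> v)\<^sup>2" by (simp add: matrix_vector_mul_component row_def inner_vec_def)
    also have "\<dots> \<le> (row i A \<bullet> row i A) * (v \<bullet> v)" by (rule Cauchy_Schwarz_ineq)
    also have "row i A \<bullet> row i A = (\<Sum>j\<in>UNIV. (\<bar>A $ i $ j\<bar>)\<^sup>2)"
      by (simp add: row_def inner_vec_def power2_eq_square)
    also have "\<dots> \<le> (\<Sum>j\<in>(UNIV::'n set). a\<^sup>2)"
      using assms by (intro sum_mono power_mono) auto
    finally show ?thesis by (simp add: power2_norm_eq_inner mult_right_mono)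
  qed
  then have "(\<Sum>i\<in>UNIV. ((A *v v) $ i)\<^sup>2) \<le> (\<Sum>i\<in>(UNIV::'n set). real CARD('n) * a\<^sup>2 * (norm v)\<^sup>2)"
    by (intro sum_mono)
  then have "(norm (A *v v))\<^sup>2 \<le> (real CARD('n) * a * norm v)\<^sup>2"
    unfolding power2_norm_eq_inner[of "A *v v"] inner_vec_def inner_real_def
    by (simp add: power2_eq_square mult_ac)
  then show ?thesis using a by (simp add: power2_le_iff_abs_le)
qed

text \<open>The rank function forces \<open>A\<^sup>p = 0\<close>, so the Neumann series of \<open>(I - A)\<^sup>-\<^sup>1\<close> is finite.\<close>

lemma neumann_bound:
  fixes A :: "real^'n^'n"
  assumes rank: "\<And>j k. A $ j $ k \<noteq> 0 \<Longrightarrow> \<rho> k < \<rho> j" and bd: "\<And>j. \<rho> j < CARD('n)"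
    and A: "\<And>v. norm (A *v v) \<le> a * norm v" and a: "a \<ge> 0"
    and v: "v = u + A *v v"
  shows "norm v \<le> (\<Sum>k<CARD('n). a ^ k) * norm u"
proof -
  let ?f = "(*v) A"
  \<comment> \<open>Coordinate j of the k-th iterate collects the paths of length k ending in j, and
    each edge of such a path raises the rank, so none exists once k exceeds the rank of j.\<close>
  have zero: "((?f ^^ k) w) $ j = 0" if "\<rho> j < k" for k j w
    using that
  proof (induction k arbitrary: j)
    case (Suc k)
    have "A $ j $ i * ((?f ^^ k) w) $ i = 0" for i
      using Suc rank[of j i] by (cases "A $ j $ i = 0") auto
    then have "(\<Sum>i\<in>UNIV. A $ j $ i * ((?f ^^ k) w) $ i) = 0" by (intro sum.neutral ballI)
    then show ?case by (simp add: matrix_vector_mul_component inner_vec_def)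
  qed simp
  have nrm: "norm ((?f ^^ k) w) \<le> a ^ k * norm w" for k w
  proof (induction k)
    case (Suc k)
    have "norm ((?f ^^ Suc k) w) \<le> a * norm ((?f ^^ k) w)" using A by simp
    also have "\<dots> \<le> a * (a ^ k * norm w)" using Suc a by (intro mult_left_mono)
    finally show ?case by (simp add: mult_ac)
  qed simp
  have ser: "v = (\<Sum>k<n. (?f ^^ k) u) + (?f ^^ n) v" for n
  proof (induction n)
    case (Suc n)
    have lin: "linear (?f ^^ n)"
    proof (induction n)
      case (Suc n)
      from linear_compose[OF this matrix_vector_mul_linear[of A]] show ?case by (simp add: o_def)
    qed (simp add: linear_iff)
    have "(?f ^^ n) v = (?f ^^ n) (u + ?f v)" by (rule arg_cong[OF v])
    also have "\<dots> = (?f ^^ n) u + (?f ^^ n) (?f v)" using lin by (rule linear_add)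
    also have "(?f ^^ n) (?f v) = (?f ^^ Suc n) v" by (simp add: funpow_swap1)
    finally have "(\<Sum>k<n. (?f ^^ k) u) + (?f ^^ n) v = (\<Sum>k<Suc n. (?f ^^ k) u) + (?f ^^ Suc n) v"
      by (simp only: sum.lessThan_Suc add.assoc)
    with Suc show ?case by (rule trans)
  qed simp
  have "(?f ^^ CARD('n)) v = 0" by (simp add: vec_eq_iff zero bd)
  with ser[of "CARD('n)"] have "v = (\<Sum>k<CARD('n). (?f ^^ k) u)" by (simp only: add_0_right)
  then have "norm v \<le> (\<Sum>k<CARD('n). norm ((?f ^^ k) u))" by (metis norm_sum)
  also have "\<dots> \<le> (\<Sum>k<CARD('n). a ^ k * norm u)" by (intro sum_mono nrm)
  finally show ?thesis by (simp add: sum_distrib_right)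
qed


text \<open>Here the padding is zero, whereas \<open>principal\<close> pads by the identity. Both
  agree on I - A, and the zero padding keeps the support of A inside the original graph.\<close>

definition sub_coef :: "'p set \<Rightarrow> real^'p^'p \<Rightarrow> real^'p^'p::finite" where
  "sub_coef R A = (\<chi> i j. if i \<in> R \<and> j \<in> R then A $ i $ j else 0)"

lemma principal_mat_1_minus: "principal R (mat 1 - A) = mat 1 - sub_coef R A"
  by (auto simp: principal_def sub_coef_def vec_eq_iff mat_def)

lemma principal_UNIV [simp]: "principal UNIV M = M"
  by (simp add: principal_def vec_eq_iff)

lemma transpose_sub_coef: "transpose (sub_coef R A) = sub_coef R (transpose A)"
  by (auto simp: sub_coef_def transpose_def vec_eq_iff)

lemma sub_coef_mult_off: "i \<notin> R \<Longrightarrow> (sub_coef R A *v x) $ i = 0"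
  by (simp add: matrix_vector_mult_def sub_coef_def)

lemma sub_coef_mult_axis: "j \<notin> R \<Longrightarrow> sub_coef R A *v axis j 1 = 0"
  by (simp add: matrix_vector_mult_basis column_def sub_coef_def vec_eq_iff)

lemma act_cov_eq:
  "act_cov \<theta> a = (let K = matrix_inv (mat 1 - sub_coef (coords a) (coef \<theta>))
     in K ** principal (coords a) (noise \<theta>) ** transpose K)"
proof (cases a)
  case Observe
  moreover have "sub_coef UNIV A = A" for A :: "real^'a^'a"
    by (simp add: sub_coef_def vec_eq_iff)
  ultimately show ?thesis by (simp add: Let_def)
next
  case (Do j s)
  then show ?thesis by (simp add: Let_def principal_mat_1_minus)
qed

lemma G_p_nonneg: "A_max b > 0 \<Longrightarrow> 0 \<le> G_p p b"
  unfolding G_p_def by (intro sum_nonneg) auto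

lemma G_p_ge_1: "A_max b > 0 \<Longrightarrow> p \<ge> 1 \<Longrightarrow> 1 \<le> G_p p b"
  unfolding G_p_def
  using member_le_sum[of 0 "{..<p}" "\<lambda>k. (real p * A_max b) ^ k"] by auto

text \<open>Restriction to \<open>R\<close> deletes edges, so one rank function serves every
  \<open>R\<close>. The bound of \<open>neumann_bound\<close> at u = 0 also gives injectivity of I -
  A, hence its invertibility. The transposed matrix reverses the edges; its norm bound is obtained
  by duality from that of K.\<close>

lemma sub_system_inverse:
  fixes \<theta> :: "'p::finite param" and R :: "'p set"
  assumes pos: "A_max b > 0" and \<theta>: "\<theta> \<in> param_space b"
  defines "A \<equiv> sub_coef R (coef \<theta>)"
  defines "K \<equiv> matrix_inv (mat 1 - A)"
  shows "K *v u = u + A *v (K *v u)" "transpose K *v u = u + transpose A *v (transpose K *v u)"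
    "norm (A *v u) \<le> real CARD('p) * A_max b * norm u"
    "norm (transpose A *v u) \<le> real CARD('p) * A_max b * norm u"
    "norm (K *v u) \<le> G_p CARD('p) b * norm u"
    "norm (transpose K *v u) \<le> G_p CARD('p) b * norm u"
    "v = u + A *v v \<Longrightarrow> v = K *v u" "v = u + transpose A *v v \<Longrightarrow> v = transpose K *v u"
proof -
  have ac: "acyclic (dag \<theta>)" and edge: "\<And>j k. coef \<theta> $ j $ k \<noteq> 0 \<longleftrightarrow> (k, j) \<in> dag \<theta>"
    and bd: "\<And>j k. coef \<theta> $ j $ k \<noteq> 0 \<Longrightarrow> \<bar>coef \<theta> $ j $ k\<bar> \<le> A_max b"
    using \<theta> by (auto simp: param_space_def)
  obtain \<rho> :: "'p \<Rightarrow> nat" where \<rho>: "\<And>k j. (k, j) \<in> dag \<theta> \<Longrightarrow> \<rho> k < \<rho> j" "\<And>j. \<rho> j < CARD('p)"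
    using acyclic_rank[OF ac] by blast
  have rank: "\<rho> k < \<rho> j" if "A $ j $ k \<noteq> 0" for j k
    using that \<rho>(1) edge by (auto simp: A_def sub_coef_def split: if_splits)
  have ent: "\<bar>A $ i $ j\<bar> \<le> A_max b" for i j
    using bd[of i j] pos by (cases "coef \<theta> $ i $ j = 0") (auto simp: A_def sub_coef_def)
  then have entT: "\<bar>transpose A $ i $ j\<bar> \<le> A_max b" for i j
    by (simp add: transpose_def)
  show nA: "norm (A *v u) \<le> real CARD('p) * A_max b * norm u" for u
    by (rule norm_mult_entries_le[OF ent])
  show "norm (transpose A *v u) \<le> real CARD('p) * A_max b * norm u"
    by (rule norm_mult_entries_le[OF entT])
  have nb: "norm v \<le> G_p CARD('p) b * norm u" if "v = u + A *v v" for u v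
    unfolding G_p_def
    by (rule neumann_bound[of A \<rho>, OF rank \<rho>(2) nA _ that]) (use pos in auto)
  have "inj ((*v) (mat 1 - A))"
  proof (rule injI)
    fix x y assume "(mat 1 - A) *v x = (mat 1 - A) *v y"
    then have "x - y = 0 + A *v (x - y)"
      by (simp add: matrix_vector_mult_diff_rdistrib matrix_vector_mult_diff_distrib algebra_simps)
    from nb[OF this] show "x = y" by simp
  qed
  then obtain B where B: "B ** (mat 1 - A) = mat 1"
    using matrix_left_invertible_injective by blast
  then have AB: "(mat 1 - A) ** B = mat 1" using matrix_left_right_inverse by blast
  then have K: "K = B" unfolding K_def by (rule matrix_inv_eqI)
  have BT: "transpose (mat 1 - A) ** transpose B = mat 1" "transpose B ** transpose (mat 1 - A) = mat 1"
    using B AB by (simp_all add: matrix_transpose_mul[symmetric])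
  have trd: "transpose (mat 1 - A) = mat 1 - transpose A"
    by (auto simp: transpose_def vec_eq_iff mat_def)
  have "(mat 1 - A) *v (K *v u) = u" for u
    by (simp add: matrix_vector_mul_assoc AB K)
  then show eq: "K *v u = u + A *v (K *v u)" for u
    by (simp add: matrix_vector_mult_diff_rdistrib algebra_simps)
  have "(mat 1 - transpose A) *v (transpose K *v u) = u"
    using BT(1) by (simp add: matrix_vector_mul_assoc K trd del: transpose_matrix_vector)
  then show "transpose K *v u = u + transpose A *v (transpose K *v u)"
    by (simp add: matrix_vector_mult_diff_rdistrib algebra_simps)
  show nK: "norm (K *v u) \<le> G_p CARD('p) b * norm u" for u
    by (rule nb[OF eq])
  show "v = K *v u" if "v = u + A *v v"
  proof -
    have "(mat 1 - A) *v v = u"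
      using that by (simp add: matrix_vector_mult_diff_rdistrib algebra_simps)
    then have "K *v u = (B ** (mat 1 - A)) *v v" by (simp add: K matrix_vector_mul_assoc[symmetric])
    then show ?thesis by (simp add: B)
  qed
  show "v = transpose K *v u" if "v = u + transpose A *v v"
  proof -
    have "(mat 1 - transpose A) *v v = u"
      using that by (simp add: matrix_vector_mult_diff_rdistrib algebra_simps)
    then have "transpose K *v u = (transpose B ** transpose (mat 1 - A)) *v v"
      by (simp add: K trd matrix_vector_mul_assoc[symmetric])
    then show ?thesis by (simp add: BT)
  qed
  show "norm (transpose K *v u) \<le> G_p CARD('p) b * norm u"
  proof -
    let ?w = "transpose K *v u"
    have "norm ?w * norm ?w = u \<bullet> (K *v ?w)"
      using inner_matrix_transpose[of u K ?w] by (simp add: norm_eq_sqrt_inner)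
    also have "\<dots> \<le> norm u * norm (K *v ?w)" by (rule norm_cauchy_schwarz)
    also have "\<dots> \<le> norm u * (G_p CARD('p) b * norm ?w)" by (intro mult_left_mono nK) auto
    finally have "norm ?w * norm ?w \<le> norm ?w * (G_p CARD('p) b * norm u)" by (simp add: mult_ac)
    then show ?thesis
      using G_p_nonneg[OF pos, of "CARD('p)"] by (cases "norm ?w = 0") (auto simp: mult_le_cancel_left)
  qed
qed

text \<open>With w = K\<open>\<^sup>T\<close> u the form u \<bullet> V u is the noise-weighted
  square norm of w, so only |w| / |u| matters. From u = (I - A\<open>\<^sup>T\<close>) w comes |u|
  \<le> (1 + p A_max) |w|, and the Neumann bound gives |w| \<le> G_p |u|: these are the origins of
  \<open>v_minus\<close> and \<open>v_plus\<close>.\<close>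

lemma act_cov_in_class:
  fixes \<theta> :: "'p::finite param"
  assumes b: "valid_bounds b U" and \<theta>: "\<theta> \<in> param_space b"
  shows "act_cov \<theta> a \<in> cov_class (coords a) (v_minus CARD('p) b) (v_plus CARD('p) b)"
proof -
  have pos: "A_max b > 0" "sigma_min b > 0" "sigma_max b > 0" using b by (auto simp: valid_bounds_def)
  let ?p = "CARD('p)"
  define R where "R = coords a"
  define A where "A = sub_coef R (coef \<theta>)"
  define K where "K = matrix_inv (mat 1 - A)"
  define S where "S = principal R (noise \<theta>)"
  define V where "V = act_cov \<theta> a"
  have V: "V = K ** S ** transpose K"
    unfolding V_def act_cov_eq K_def A_def S_def R_def by (simp add: Let_def)
  note inv = sub_system_inverse[OF pos(1) \<theta>, where R = R, folded A_def, folded K_def]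
  obtain s where s: "noise \<theta> = (\<chi> i j. if i = j then (s i)\<^sup>2 else 0)"
    "\<And>j. (sigma_min b)\<^sup>2 \<le> (s j)\<^sup>2" "\<And>j. (s j)\<^sup>2 \<le> (sigma_max b)\<^sup>2"
    using \<theta> unfolding param_space_def by blast
  define d where "d i = (if i \<in> R then (s i)\<^sup>2 else 1)" for i
  have S: "S = diag_mat d"
    by (auto simp: S_def s principal_def diag_mat_def d_def vec_eq_iff)
  have Smul: "(S *v x) $ i = d i * x $ i" for x i
  proof -
    have "(S *v x) $ i = (\<Sum>j\<in>UNIV. if i = j then d i * x $ j else 0)"
      unfolding matrix_vector_mult_def vec_lambda_beta S diag_mat_def by (intro sum.cong) auto
    then show ?thesis by simp
  qed
  have symS: "transpose S = S" by (auto simp: S diag_mat_def transpose_def vec_eq_iff)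
  have sym: "transpose V = V"
    by (simp add: V matrix_transpose_mul symS matrix_mul_assoc)
  have col: "V *v axis j 1 = axis j 1" if "j \<notin> R" for j
  proof -
    have "transpose K *v axis j 1 = axis j 1"
      by (rule inv(8)[symmetric])
        (use that in \<open>simp add: A_def transpose_sub_coef sub_coef_mult_axis\<close>)
    moreover have "K *v axis j 1 = axis j 1"
      by (rule inv(7)[symmetric]) (use that in \<open>simp add: A_def sub_coef_mult_axis\<close>)
    moreover have "S *v axis j 1 = axis j 1"
      using that by (auto simp: vec_eq_iff Smul d_def axis_def)
    ultimately show ?thesis by (simp add: V matrix_vector_mul_assoc[symmetric])
  qed
  have "principal R V = V" by (rule principal_eqI[OF sym col])
  moreover have "v_minus ?p b * (u \<bullet> u) \<le> u \<bullet> (V *v u) \<and> u \<bullet> (V *v u) \<le> v_plus ?p b * (u \<bullet> u)"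
    if u: "on R u = u" for u
  proof -
    define w where "w = transpose K *v u"
    have weq: "w = u + transpose A *v w" unfolding w_def by (rule inv(2))
    \<comment> \<open>Since w is supported on \<open>R\<close>, the artificial noise level 1 off
      \<open>R\<close> never enters the form.\<close>
    have won: "w $ i = 0" if "i \<notin> R" for i
      using arg_cong[OF weq, of "\<lambda>x. x $ i"] that u
      by (simp add: A_def transpose_sub_coef sub_coef_mult_off on_eq_iff)
    have form: "u \<bullet> (V *v u) = (\<Sum>i\<in>UNIV. d i * (w $ i)\<^sup>2)"
    proof -
      have "u \<bullet> (V *v u) = w \<bullet> (S *v w)"
        unfolding w_def V by (simp add: matrix_vector_mul_assoc[symmetric] inner_matrix_transpose[of u K])
      then show ?thesis by (simp add: inner_vec_def Smul power2_eq_square mult_ac)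
    qed
    have ww: "w \<bullet> w = (\<Sum>i\<in>UNIV. (w $ i)\<^sup>2)" by (simp add: inner_vec_def power2_eq_square)
    have low: "(sigma_min b)\<^sup>2 * (w \<bullet> w) \<le> u \<bullet> (V *v u)"
      unfolding form ww sum_distrib_left
      by (intro sum_mono) (use s won in \<open>auto simp: d_def intro!: mult_right_mono\<close>)
    have up: "u \<bullet> (V *v u) \<le> (sigma_max b)\<^sup>2 * (w \<bullet> w)"
      unfolding form ww sum_distrib_left
      by (intro sum_mono) (use s won in \<open>auto simp: d_def intro!: mult_right_mono\<close>)
    have "norm u \<le> (1 + real ?p * A_max b) * norm w"
    proof -
      have "u = w - transpose A *v w" using weq by (simp add: algebra_simps)
      then have "norm u \<le> norm w + norm (transpose A *v w)" by (metis norm_triangle_ineq4)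
      also have "\<dots> \<le> norm w + real ?p * A_max b * norm w" using inv(4)[of w] by simp
      finally show ?thesis by (simp add: algebra_simps)
    qed
    then have "(norm u)\<^sup>2 \<le> (1 + real ?p * A_max b)\<^sup>2 * (norm w)\<^sup>2"
      by (metis norm_ge_zero power_mono power_mult_distrib)
    then have "v_minus ?p b * (u \<bullet> u) \<le> v_minus ?p b * ((1 + real ?p * A_max b)\<^sup>2 * (w \<bullet> w))"
      unfolding power2_norm_eq_inner by (intro mult_left_mono) (auto simp: v_minus_def)
    also have "\<dots> = (sigma_min b)\<^sup>2 * (w \<bullet> w)"
    proof -
      have "1 + real ?p * A_max b > 0" using pos by (simp add: add_pos_nonneg)
      then show ?thesis by (simp add: v_minus_def)
    qed
    finally have 1: "v_minus ?p b * (u \<bullet> u) \<le> u \<bullet> (V *v u)" using low by simp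
    have "(norm w)\<^sup>2 \<le> (G_p ?p b)\<^sup>2 * (norm u)\<^sup>2"
      using power_mono[OF inv(6)[of u], of 2] by (simp add: w_def power_mult_distrib)
    then have "(sigma_max b)\<^sup>2 * (w \<bullet> w) \<le> (sigma_max b)\<^sup>2 * ((G_p ?p b)\<^sup>2 * (u \<bullet> u))"
      unfolding power2_norm_eq_inner by (intro mult_left_mono) auto
    then have 2: "u \<bullet> (V *v u) \<le> v_plus ?p b * (u \<bullet> u)"
      using up by (simp add: v_plus_def mult_ac)
    show ?thesis using 1 2 by blast
  qed
  ultimately have "V \<in> cov_class R (v_minus ?p b) (v_plus ?p b)"
    using sym by (auto simp: cov_class_def)
  then show ?thesis by (simp add: V_def R_def)
qed

lemma act_mean_bound:
  fixes \<theta> :: "'p::finite param"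
  assumes b: "valid_bounds b U" and \<theta>: "\<theta> \<in> param_space b" and a: "a \<in> actions"
  shows "on (coords a) (act_mean U \<theta> a) = act_mean U \<theta> a"
    "norm (act_mean U \<theta> a) \<le> B_mu CARD('p) b"
proof -
  have pos: "A_max b > 0" "C_max b > 0" using b by (auto simp: valid_bounds_def)
  have G: "0 \<le> G_p CARD('p) b" by (rule G_p_nonneg[OF pos(1)])
  have "on (coords a) (act_mean U \<theta> a) = act_mean U \<theta> a \<and>
    norm (act_mean U \<theta> a) \<le> B_mu CARD('p) b"
  proof (cases a)
    case Observe
    then show ?thesis using G pos by (simp add: B_mu_def)
  next
    case (Do j s)
    define R where "R = UNIV - {j}"
    define A where "A = sub_coef R (coef \<theta>)"
    define K where "K = matrix_inv (mat 1 - A)"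
    define c where "c = U j s *s column j (coef \<theta>)"
    note inv = sub_system_inverse[OF pos(1) \<theta>, where R = R, folded A_def, folded K_def]
    have m: "act_mean U \<theta> a = K *v c"
      by (simp add: Do K_def A_def R_def c_def principal_mat_1_minus)
    \<comment> \<open>A self-loop would be a cycle, so the source term c vanishes at the intervened
      node, and then so does the mean.\<close>
    have "acyclic (dag \<theta>)" "coef \<theta> $ j $ j \<noteq> 0 \<longleftrightarrow> (j, j) \<in> dag \<theta>"
      using \<theta> by (auto simp: param_space_def)
    then have "coef \<theta> $ j $ j = 0" by (auto simp: acyclic_def)
    then have cj: "c $ j = 0" by (simp add: c_def column_def)
    have "(K *v c) $ j = 0"
      using arg_cong[OF inv(1)[of c], of "\<lambda>x. x $ j"] cj
      by (simp add: A_def sub_coef_mult_off R_def)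
    then have 1: "on (coords a) (act_mean U \<theta> a) = act_mean U \<theta> a"
      unfolding m on_eq_iff by (simp add: Do)
    have ent: "\<bar>coef \<theta> $ i $ k\<bar> \<le> A_max b" for i k
      using \<theta> pos by (cases "coef \<theta> $ i $ k = 0") (auto simp: param_space_def)
    have Us: "\<bar>U j s\<bar> \<le> C_max b"
    proof -
      have "U j 1 \<le> U j 2" "\<forall>u\<in>{U j 1..U j 2}. \<bar>u\<bar> \<le> C_max b" using b by (auto simp: valid_bounds_def)
      moreover have "s = 1 \<or> s = 2" using a Do by (auto simp: actions_def)
      ultimately show ?thesis by auto
    qed
    have "\<bar>c $ i\<bar> \<le> C_max b * A_max b" for i
      unfolding c_def column_def using Us ent[of i j] pos
      by (simp add: abs_mult mult_mono)
    then have "(c $ i)\<^sup>2 \<le> (C_max b * A_max b)\<^sup>2" for i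
      by (metis abs_ge_zero power2_abs power_mono)
    then have "(\<Sum>i\<in>UNIV. (c $ i)\<^sup>2) \<le> (\<Sum>i\<in>(UNIV::'p set). (C_max b * A_max b)\<^sup>2)"
      by (intro sum_mono)
    then have "(norm c)\<^sup>2 \<le> (sqrt (real CARD('p)) * (C_max b * A_max b))\<^sup>2"
      unfolding power2_norm_eq_inner by (simp add: inner_vec_def power2_eq_square mult_ac)
    then have nc: "norm c \<le> sqrt (real CARD('p)) * (C_max b * A_max b)"
      using pos by (simp add: power2_le_iff_abs_le)
    have "norm (K *v c) \<le> G_p CARD('p) b * norm c" by (rule inv(5))
    also have "\<dots> \<le> G_p CARD('p) b * (sqrt (real CARD('p)) * (C_max b * A_max b))"
      using nc G by (rule mult_left_mono)
    finally have "norm (act_mean U \<theta> a) \<le> B_mu CARD('p) b" by (simp add: m B_mu_def mult_ac)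
    with 1 show ?thesis by blast
  qed
  then show "on (coords a) (act_mean U \<theta> a) = act_mean U \<theta> a"
    "norm (act_mean U \<theta> a) \<le> B_mu CARD('p) b" by auto
qed

lemma v_minus_pos:
  assumes "valid_bounds b U"
  shows "0 < v_minus p b"
proof -
  have "1 + real p * A_max b > 0" "sigma_min b > 0"
    using assms by (auto simp: valid_bounds_def add_pos_nonneg)
  then show ?thesis by (simp add: v_minus_def)
qed

text \<open>\<open>valid_bounds\<close> does not order the two noise levels; a parameter in the
  space witnesses the order through its own variances. Strictness comes from 1 + p A_max >
  1.\<close>

lemma v_minus_less_v_plus:
  fixes \<theta> :: "'p::finite param"
  assumes b: "valid_bounds b U" and \<theta>: "\<theta> \<in> param_space b"
  shows "v_minus CARD('p) b < v_plus CARD('p) b"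
proof -
  have pos: "A_max b > 0" "sigma_min b > 0" "sigma_max b > 0" using b by (auto simp: valid_bounds_def)
  have p: "CARD('p) \<ge> 1" by (simp add: Suc_leI)
  have "(1 + real CARD('p) * A_max b) > 1" using pos by simp
  then have "(1 + real CARD('p) * A_max b)\<^sup>2 > 1" by simp
  then have "v_minus CARD('p) b < (sigma_min b)\<^sup>2"
    using pos unfolding v_minus_def by (simp add: divide_less_eq)
  also have "\<dots> \<le> (sigma_max b)\<^sup>2"
    using \<theta> unfolding param_space_def by force
  also have "\<dots> \<le> v_plus CARD('p) b"
    using mult_right_mono[OF one_le_power[OF G_p_ge_1[OF pos(1) p], of 2], of "(sigma_max b)\<^sup>2"]
    unfolding v_plus_def by simp
  finally show ?thesis .
qed

section \<open>Linear change of variables on product spaces\<close>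

abbreviation leb :: "'n set \<Rightarrow> ('n \<Rightarrow> real) measure" where
  "leb I \<equiv> PiM I (\<lambda>_. lborel)"

interpretation leb: product_sigma_finite "\<lambda>_. lborel :: real measure"
  by standard

text \<open>Tonelli isolates coordinate \<open>m\<close>, and the one-dimensional affine
  substitution acts there with the others frozen, on which alone \<open>h\<close> depends. A
  constant \<open>h\<close> gives a scaling with translation, and c = 1 gives a shear, the two
  elementary moves other than permutations.\<close>

lemma nn_integral_shear_coordinate:
  fixes f :: "('n::finite \<Rightarrow> real) \<Rightarrow> ennreal"
  assumes f: "f \<in> borel_measurable (leb UNIV)" and c: "c \<noteq> 0"
    and h: "h \<in> borel_measurable (leb UNIV)" "\<And>z y. h (z(m := y)) = h z"
  shows "(\<integral>\<^sup>+z. f z \<partial>leb UNIV) = ennreal \<bar>c\<bar> * (\<integral>\<^sup>+z. f (z(m := h z + c * z m)) \<partial>leb UNIV)"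
proof -
  have U: "insert m (UNIV - {m}) = UNIV" by blast
  note [measurable] = f h(1)
  have upd [measurable]: "(\<lambda>z. z(m := h z + c * z m)) \<in> measurable (leb UNIV) (leb UNIV)"
    by (rule measurable_fun_upd[where J="UNIV"]) auto
  have "(\<integral>\<^sup>+z. f z \<partial>leb UNIV) = (\<integral>\<^sup>+x. (\<integral>\<^sup>+y. f (x(m := y)) \<partial>lborel) \<partial>leb (UNIV - {m}))"
    using leb.product_nn_integral_insert[of "UNIV - {m}" m f] f by (simp add: U)
  also have "\<dots> = (\<integral>\<^sup>+x. \<bar>c\<bar> * (\<integral>\<^sup>+y. f (x(m := h x + c * y)) \<partial>lborel) \<partial>leb (UNIV - {m}))"
  proof (rule nn_integral_cong)
    fix x assume x: "x \<in> space (leb (UNIV - {m}))"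
    have "(\<lambda>y. x(m := y)) \<in> measurable lborel (leb (insert m (UNIV - {m})))"
      by (rule measurable_component_update[OF x]) simp
    then have "(\<lambda>y. f (x(m := y))) \<in> borel_measurable lborel"
      unfolding U by measurable
    then have "(\<lambda>y. f (x(m := y))) \<in> borel_measurable borel" by simp
    then show "(\<integral>\<^sup>+y. f (x(m := y)) \<partial>lborel) = ennreal \<bar>c\<bar> * (\<integral>\<^sup>+y. f (x(m := h x + c * y)) \<partial>lborel)"
      using nn_integral_real_affine[of "\<lambda>y. f (x(m := y))" c "h x"] c by simp
  qed
  also have "\<dots> = ennreal \<bar>c\<bar> * (\<integral>\<^sup>+x. (\<integral>\<^sup>+y. f (x(m := h x + c * y)) \<partial>lborel) \<partial>leb (UNIV - {m}))"
  proof (rule nn_integral_cmult)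
    have "(\<lambda>(x, y). x(m := y)) \<in> measurable (leb (UNIV - {m}) \<Otimes>\<^sub>M lborel) (leb (insert m (UNIV - {m})))"
      by measurable
    then have [measurable]: "(\<lambda>(x, y). x(m := y)) \<in> measurable (leb (UNIV - {m}) \<Otimes>\<^sub>M lborel) (leb UNIV)"
      unfolding U .
    have "(\<lambda>(x, y). f ((\<lambda>z. z(m := h z + c * z m)) (x(m := y)))) \<in> borel_measurable (leb (UNIV - {m}) \<Otimes>\<^sub>M lborel)"
      by measurable
    then have "(\<lambda>(x, y). f (x(m := h x + c * y))) \<in> borel_measurable (leb (UNIV - {m}) \<Otimes>\<^sub>M lborel)"
      by (simp add: h(2) case_prod_unfold)
    then show "(\<lambda>x. \<integral>\<^sup>+y. f (x(m := h x + c * y)) \<partial>lborel) \<in> borel_measurable (leb (UNIV - {m}))"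
      by (rule lborel.borel_measurable_nn_integral)
  qed
  also have "(\<integral>\<^sup>+x. (\<integral>\<^sup>+y. f (x(m := h x + c * y)) \<partial>lborel) \<partial>leb (UNIV - {m}))
      = (\<integral>\<^sup>+z. f (z(m := h z + c * z m)) \<partial>leb UNIV)"
    using leb.product_nn_integral_insert[of "UNIV - {m}" m "\<lambda>z. f (z(m := h z + c * z m))"] 
    by (simp add: U h(2))
  finally show ?thesis .
qed

text \<open>Points of a product measure space are functions, so the matrix acts on functions rather
  than on vectors.\<close>

definition mat_app :: "real^'n^'n \<Rightarrow> ('n::finite \<Rightarrow> real) \<Rightarrow> 'n \<Rightarrow> real" where
  "mat_app M z = (\<lambda>i. \<Sum>j\<in>UNIV. M $ i $ j * z j)"

lemma measurable_mat_app [measurable]: "mat_app M \<in> measurable (leb UNIV) (leb UNIV)"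
  unfolding mat_app_def by (rule measurable_PiM_single') (auto simp: space_PiM)

lemma mat_app_mult: "mat_app (A ** B) z = mat_app A (mat_app B z)"
  by (auto simp: mat_app_def matrix_matrix_mult_def sum_distrib_left sum_distrib_right mult.assoc
      intro!: sum.swap)

lemma mat_app_vec: "mat_app M z = (\<lambda>i. (M *v (\<chi> i. z i)) $ i)"
  by (simp add: mat_app_def matrix_vector_mult_def)

lemma nn_integral_diagonal_affine:
  fixes f :: "('n::finite \<Rightarrow> real) \<Rightarrow> ennreal"
  assumes f: "f \<in> borel_measurable (leb UNIV)" and d: "\<And>i. d i \<noteq> 0"
  shows "(\<integral>\<^sup>+z. f z \<partial>leb UNIV) =
    ennreal \<bar>\<Prod>i\<in>UNIV. d i\<bar> * (\<integral>\<^sup>+z. f (\<lambda>i. t i + d i * z i) \<partial>leb UNIV)"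
proof -
  have "(\<integral>\<^sup>+z. f z \<partial>leb UNIV) = ennreal \<bar>\<Prod>i\<in>A. d i\<bar> *
      (\<integral>\<^sup>+z. f (\<lambda>i. if i \<in> A then t i + d i * z i else z i) \<partial>leb UNIV)" for A :: "'n set"
    using finite[of A]
  proof (induction A rule: finite_induct)
    case (insert m A)
    let ?g = "\<lambda>z. f (\<lambda>i. if i \<in> A then t i + d i * z i else z i)"
    have "(\<lambda>z i. if i \<in> A then t i + d i * z i else z i) \<in> measurable (leb UNIV) (leb UNIV)"
      by (rule measurable_PiM_single') (auto simp: space_PiM)
    then have g: "?g \<in> borel_measurable (leb UNIV)"
      using f by (rule measurable_compose)
    have "(\<integral>\<^sup>+z. ?g z \<partial>leb UNIV) = ennreal \<bar>d m\<bar> * (\<integral>\<^sup>+z. ?g (z(m := t m + d m * z m)) \<partial>leb UNIV)"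
      by (rule nn_integral_shear_coordinate[OF g d]) auto
    also have "(\<lambda>z. ?g (z(m := t m + d m * z m)))
        = (\<lambda>z. f (\<lambda>i. if i \<in> insert m A then t i + d i * z i else z i))"
      using insert.hyps(2) by (intro ext arg_cong[of _ _ f]) auto
    finally have step: "(\<integral>\<^sup>+z. ?g z \<partial>leb UNIV) = ennreal \<bar>d m\<bar> *
        (\<integral>\<^sup>+z. f (\<lambda>i. if i \<in> insert m A then t i + d i * z i else z i) \<partial>leb UNIV)" .
    show ?case
      unfolding insert.IH step prod.insert[OF insert.hyps]
      by (simp only: abs_mult ennreal_mult abs_ge_zero mult_ac)
  qed simp
  from this[of UNIV] show ?thesis by simp
qed

lemma nn_integral_permute:
  fixes f :: "('n::finite \<Rightarrow> real) \<Rightarrow> ennreal" and \<tau> :: "'n \<Rightarrow> 'n"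
  assumes f: "f \<in> borel_measurable (leb UNIV)" and t: "bij \<tau>"
  shows "(\<integral>\<^sup>+z. f z \<partial>leb UNIV) = (\<integral>\<^sup>+z. f (\<lambda>i. z (\<tau> i)) \<partial>leb UNIV)"
proof -
  have m [measurable]: "(\<lambda>z i. z (\<tau> i)) \<in> measurable (leb UNIV) (leb UNIV)"
    by (rule measurable_PiM_single') (auto simp: space_PiM)
  have "distr (leb UNIV) (leb UNIV) (\<lambda>z i. z (\<tau> i)) = leb UNIV"
  proof (rule leb.PiM_eqI)
    fix A :: "'n \<Rightarrow> real set" assume A: "\<And>i. i \<in> UNIV \<Longrightarrow> A i \<in> sets lborel"
    have eq: "(\<lambda>z i. z (\<tau> i)) -` Pi\<^sub>E UNIV A \<inter> space (leb UNIV) = Pi\<^sub>E UNIV (\<lambda>i. A (inv \<tau> i))"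
    proof -
      have "(\<forall>i. z (\<tau> i) \<in> A i) \<longleftrightarrow> (\<forall>i. z i \<in> A (inv \<tau> i))" for z
        using t by (metis bij_inv_eq_iff)
      then show ?thesis by (auto simp: space_PiM PiE_iff)
    qed
    have "emeasure (distr (leb UNIV) (leb UNIV) (\<lambda>z i. z (\<tau> i))) (Pi\<^sub>E UNIV A)
        = emeasure (leb UNIV) (Pi\<^sub>E UNIV (\<lambda>i. A (inv \<tau> i)))"
      using A by (subst emeasure_distr[OF m]) (auto simp: eq intro!: sets_PiM_I_finite)
    also have "\<dots> = (\<Prod>i\<in>UNIV. emeasure lborel (A (inv \<tau> i)))"
      using A by (intro leb.emeasure_PiM) auto
    also have "\<dots> = (\<Prod>i\<in>UNIV. emeasure lborel (A i))"
      using prod.reindex_bij_betw[OF bij_imp_bij_inv[OF t], of "\<lambda>i. emeasure lborel (A i)"] .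
    finally show "emeasure (distr (leb UNIV) (leb UNIV) (\<lambda>z i. z (\<tau> i))) (Pi\<^sub>E UNIV A)
        = (\<Prod>i\<in>UNIV. emeasure lborel (A i))" .
  qed auto
  then have "(\<integral>\<^sup>+z. f z \<partial>leb UNIV) = (\<integral>\<^sup>+z. f z \<partial>distr (leb UNIV) (leb UNIV) (\<lambda>z i. z (\<tau> i)))" by simp
  also have "\<dots> = (\<integral>\<^sup>+z. f (\<lambda>i. z (\<tau> i)) \<partial>leb UNIV)" using f by (intro nn_integral_distr m) simp
  finally show ?thesis .
qed

text \<open>
  The library's \<open>measure_linear_image\<close> needs a well-ordered index type, which the node type is
  not; the formula is checked on elementary matrices instead.
\<close>

proposition nn_integral_linear_change:
  fixes M :: "real^'n^'n" and f :: "('n \<Rightarrow> real) \<Rightarrow> ennreal"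
  assumes "det M \<noteq> 0" "f \<in> borel_measurable (leb UNIV)"
  shows "(\<integral>\<^sup>+z. f z \<partial>leb UNIV) = ennreal \<bar>det M\<bar> * (\<integral>\<^sup>+z. f (mat_app M z) \<partial>leb UNIV)"
proof -
  let ?P = "\<lambda>M::real^'n^'n. det M \<noteq> 0 \<longrightarrow> (\<forall>f\<in>borel_measurable (leb UNIV).
    (\<integral>\<^sup>+z. f z \<partial>leb UNIV) = ennreal \<bar>det M\<bar> * (\<integral>\<^sup>+z. f (mat_app M z) \<partial>leb UNIV))"
  have "?P M"
  proof (induction M rule: induct_matrix_elementary)
    case (1 A B)
    show ?case
    proof (intro impI ballI)
      fix f :: "('n \<Rightarrow> real) \<Rightarrow> ennreal"
      assume d: "det (A ** B) \<noteq> 0" and f: "f \<in> borel_measurable (leb UNIV)"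
      then have d': "det A \<noteq> 0" "det B \<noteq> 0" by (auto simp: det_mul)
      have fA: "(\<lambda>z. f (mat_app A z)) \<in> borel_measurable (leb UNIV)" using f by measurable
      have "(\<integral>\<^sup>+z. f z \<partial>leb UNIV) = ennreal \<bar>det A\<bar> * (\<integral>\<^sup>+z. f (mat_app A z) \<partial>leb UNIV)"
        using 1(1) d'(1) f by blast
      also have "(\<integral>\<^sup>+z. f (mat_app A z) \<partial>leb UNIV)
          = ennreal \<bar>det B\<bar> * (\<integral>\<^sup>+z. f (mat_app A (mat_app B z)) \<partial>leb UNIV)"
        using 1(2) d'(2) fA by blast
      finally show "(\<integral>\<^sup>+z. f z \<partial>leb UNIV) = \<bar>det (A ** B)\<bar> * (\<integral>\<^sup>+z. f (mat_app (A ** B) z) \<partial>leb UNIV)"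
        by (simp only: mat_app_mult det_mul abs_mult ennreal_mult abs_ge_zero mult.assoc)
    qed
  next
    case (2 A i)
    then show ?case by (simp add: det_zero_row)
  next
    case (3 A)
    have app: "mat_app A z = (\<lambda>i. A $ i $ i * z i)" for z
    proof
      fix i
      have "mat_app A z i = (\<Sum>j\<in>UNIV. if j = i then A $ i $ i * z i else 0)"
        unfolding mat_app_def using 3 by (intro sum.cong) auto
      then show "mat_app A z i = A $ i $ i * z i" by simp
    qed
    have "det A = (\<Prod>i\<in>UNIV. A $ i $ i)" using 3 by (rule det_diagonal)
    then show ?case
      using nn_integral_diagonal_affine[of _ "\<lambda>i. A $ i $ i" "\<lambda>_. 0"] by (auto simp: app)
  next
    case (4 m n)
    let ?A = "(\<chi> i j. mat 1 $ i $ Transposition.transpose m n j) :: real^'n^'n"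
    have app: "mat_app ?A z = (\<lambda>i. z (Transposition.transpose m n i))" for z
    proof
      fix i
      have "mat_app ?A z i = (\<Sum>j\<in>UNIV. if j = Transposition.transpose m n i then z j else 0)"
        unfolding mat_app_def by (intro sum.cong) (auto simp: mat_def)
      then show "mat_app ?A z i = z (Transposition.transpose m n i)" by simp
    qed
    have "\<bar>det ?A\<bar> = 1"
      by (simp add: det_permute_columns permutes_swap_id sign_swap_id abs_mult)
    then show ?case unfolding app by (auto intro!: nn_integral_permute)
  next
    case (5 m n c)
    let ?A = "(\<chi> i j. if i = m \<and> j = n then c else of_bool (i = j)) :: real^'n^'n"
    have app: "mat_app ?A z = z(m := c * z n + 1 * z m)" for z
    proof
      fix i
      have "mat_app ?A z i = (\<Sum>j\<in>UNIV. (if j = n then (if i = m then c * z n else if i = n then z n else 0) else 0)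
          + (if j = i then (if i = n then 0 else z i) else 0))"
        unfolding mat_app_def using 5 by (intro sum.cong) auto
      then show "mat_app ?A z i = (z(m := c * z n + 1 * z m)) i"
        using 5 by (auto simp: sum.distrib)
    qed
    have "?A = (\<chi> k. if k = m then row m (mat 1) + c *s row n (mat 1) else row k (mat 1))"
      using 5 by (auto simp: vec_eq_iff row_def mat_def)
    then have "det ?A = 1" using det_row_operation[OF 5, of "mat 1 :: real^'n^'n" c] by simp
    then show ?case unfolding app
      using nn_integral_shear_coordinate[of _ 1 "\<lambda>z. c * z n" m] 5 by (auto simp: fun_upd_def)
  qed
  with assms show ?thesis by blast
qed


corollary nn_integral_affine_change:
  fixes M :: "real^'n^'n" and f :: "('n \<Rightarrow> real) \<Rightarrow> ennreal"
  assumes M: "det M \<noteq> 0" and f: "f \<in> borel_measurable (leb UNIV)"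
  shows "(\<integral>\<^sup>+z. f z \<partial>leb UNIV) = ennreal \<bar>det M\<bar> * (\<integral>\<^sup>+z. f (\<lambda>i. t i + mat_app M z i) \<partial>leb UNIV)"
proof -
  have "(\<lambda>z i. t i + z i) \<in> measurable (leb UNIV) (leb UNIV)"
    by (rule measurable_PiM_single') (auto simp: space_PiM)
  then have "(\<lambda>z. f (\<lambda>i. t i + z i)) \<in> borel_measurable (leb UNIV)"
    using f by (rule measurable_compose)
  from nn_integral_linear_change[OF M this]
  show ?thesis using nn_integral_diagonal_affine[OF f, of "\<lambda>_. 1" t] by simp
qed

section \<open>Gaussian integrals\<close>

definition std_gauss :: "('n::finite \<Rightarrow> real) measure" where
  "std_gauss = density (leb UNIV) (\<lambda>y. ennreal (\<Prod>i\<in>UNIV. std_normal_density (y i)))"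

text \<open>The source is the full-dimensional standard normal for every \<open>R\<close>; the
  coordinates off \<open>R\<close> are produced by M and then discarded.\<close>

definition gauss_map :: "'n set \<Rightarrow> real^'n \<Rightarrow> real^'n^'n \<Rightarrow> ('n::finite \<Rightarrow> real) \<Rightarrow> 'n \<Rightarrow> real" where
  "gauss_map R \<mu> M y = (\<lambda>i\<in>R. \<mu> $ i + mat_app M y i)"

lemma measurable_gauss_map [measurable]: "gauss_map R \<mu> M \<in> measurable (leb UNIV) (leb R)"
proof -
  have "(\<lambda>y. mat_app M y i) \<in> borel_measurable (leb UNIV)" for i
    unfolding mat_app_def by measurable
  then show ?thesis unfolding gauss_map_def by (intro measurable_restrict) simp
qed

lemma measurable_mvn_density:
  assumes "\<And>i. i \<in> R \<Longrightarrow> (\<lambda>x. x i) \<in> borel_measurable N"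
  shows "mvn_density R \<mu> V \<in> borel_measurable N"
  unfolding mvn_density_def using assms by measurable

lemma measurable_mvn_density_leb [measurable]: "mvn_density R \<mu> V \<in> borel_measurable (leb R)"
  by (rule measurable_mvn_density) auto

definition dev_vec :: "'n set \<Rightarrow> real^'n \<Rightarrow> ('n::finite \<Rightarrow> real) \<Rightarrow> real^'n" where
  "dev_vec R \<mu> x = (\<chi> i. if i \<in> R then x i - \<mu> $ i else 0)"

lemma on_dev_vec [simp]: "on R (dev_vec R \<mu> x) = dev_vec R \<mu> x"
  by (simp add: dev_vec_def on_eq_iff)

lemma mvn_density_eq:
  assumes "principal R V = V"
  shows "mvn_density R \<mu> V x =
    exp (- (dev_vec R \<mu> x \<bullet> (matrix_inv V *v dev_vec R \<mu> x)) / 2) / sqrt ((2 * pi) ^ card R * det V)"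
proof -
  have "dev_vec R \<mu> x \<bullet> (matrix_inv V *v dev_vec R \<mu> x)
      = (\<Sum>i\<in>UNIV. \<Sum>j\<in>UNIV. dev_vec R \<mu> x $ i * matrix_inv V $ i $ j * dev_vec R \<mu> x $ j)"
    by (simp add: inner_vec_def matrix_vector_mult_def sum_distrib_left mult.assoc)
  also have "\<dots> = (\<Sum>i\<in>R. \<Sum>j\<in>UNIV. dev_vec R \<mu> x $ i * matrix_inv V $ i $ j * dev_vec R \<mu> x $ j)"
    by (intro sum.mono_neutral_right) (auto simp: dev_vec_def)
  also have "\<dots> = (\<Sum>i\<in>R. \<Sum>j\<in>R. dev_vec R \<mu> x $ i * matrix_inv V $ i $ j * dev_vec R \<mu> x $ j)"
    by (intro sum.cong refl sum.mono_neutral_right) (auto simp: dev_vec_def)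
  also have "\<dots> = (\<Sum>i\<in>R. \<Sum>j\<in>R. (x i - \<mu> $ i) * matrix_inv V $ i $ j * (x j - \<mu> $ j))"
    by (intro sum.cong refl) (auto simp: dev_vec_def)
  finally show ?thesis by (simp add: mvn_density_def assms)
qed

lemma std_normal_prod:
  "(\<Prod>i\<in>A. std_normal_density (y i)) = exp (- (\<Sum>i\<in>A. (y i)\<^sup>2) / 2) / sqrt (2 * pi) ^ card A"
  if "finite A"
  using that
  by (induction A rule: finite_induct)
     (auto simp: std_normal_density_def exp_add[symmetric] add_divide_distrib field_simps)

context
  fixes R :: "'n::finite set" and lo hi :: real
  assumes lo: "0 < lo" and lohi: "lo \<le> hi"
begin

lemma cov_class_inverse_principal:
  assumes V: "V \<in> cov_class R lo hi"
  shows "principal R (matrix_inv V) = matrix_inv V"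
proof -
  have P: "principal R V = V" and sym: "transpose (matrix_inv V) = matrix_inv V"
    using V cov_class_inverse[OF lo lohi V] by (simp_all add: cov_class_def)
  have "matrix_inv V *v axis j 1 = axis j 1" if "j \<notin> R" for j
  proof -
    have "V *v axis j 1 = axis j 1"
      using that principal_entry[OF P, of _ j]
      unfolding matrix_vector_mult_basis by (auto simp: vec_eq_iff column_def axis_def)
    then have "matrix_inv V *v axis j 1 = (matrix_inv V ** V) *v axis j 1"
      by (simp add: matrix_vector_mul_assoc[symmetric])
    then show ?thesis by (simp add: cov_class_inverse[OF lo lohi V])
  qed
  then show ?thesis by (rule principal_eqI[OF sym])
qed

text \<open>Since T T\<open>\<^sup>T\<close> is the inverse of V, the matrix V T is a square root of
  V: (V T) (V T)\<open>\<^sup>T\<close> = V. It therefore sends a standard normal vector to one with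
  covariance V.\<close>

lemma whitening_facts:
  assumes V: "V \<in> cov_class R lo hi" and T: "transpose T ** V ** T = mat 1"
  shows "matrix_inv V = T ** transpose T" "\<bar>det (V ** T)\<bar> = sqrt (det V)" "det (V ** T) \<noteq> 0"
    "transpose T *v ((V ** T) *v y) = y"
    "matrix_inv V *v ((V ** T) *v y) = T *v y"
proof -
  note d = cov_class_inverse(4)[OF lo lohi V]
  have "T ** (transpose T ** V) = mat 1"
    using T matrix_left_right_inverse by blast
  then have "V ** (T ** transpose T) = mat 1"
    using matrix_left_right_inverse by (metis matrix_mul_assoc)
  then show "matrix_inv V = T ** transpose T" by (rule matrix_inv_eqI)
  have "det T * det V * det T = 1" using arg_cong[OF T, of det] by (simp add: det_mul det_transpose)
  then have e: "det V * (det T)\<^sup>2 = 1" by (simp add: power2_eq_square mult_ac)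
  have "(det (V ** T))\<^sup>2 = det V * (det V * (det T)\<^sup>2)"
    by (simp add: det_mul power2_eq_square mult_ac)
  then have sq: "(det (V ** T))\<^sup>2 = det V" using e by simp
  then show "\<bar>det (V ** T)\<bar> = sqrt (det V)" by (metis real_sqrt_abs)
  show "det (V ** T) \<noteq> 0" using sq d by auto
  show "transpose T *v ((V ** T) *v y) = y"
    using T by (simp add: matrix_vector_mul_assoc matrix_mul_assoc del: transpose_matrix_vector)
  show "matrix_inv V *v ((V ** T) *v y) = T *v y"
    by (simp add: matrix_vector_mul_assoc matrix_mul_assoc cov_class_inverse[OF lo lohi V])
qed

lemma whitening_quadratic:
  fixes y :: "'n \<Rightarrow> real"
  assumes V: "V \<in> cov_class R lo hi" and T: "transpose T ** V ** T = mat 1"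
  defines "z \<equiv> (V ** T) *v (\<chi> i. y i)"
  shows "z \<bullet> (matrix_inv V *v z) = (\<Sum>i\<in>UNIV. (y i)\<^sup>2)"
proof -
  have "z \<bullet> (matrix_inv V *v z) = z \<bullet> (T *v (\<chi> i. y i))"
    unfolding z_def whitening_facts(5)[OF V T] ..
  also have "\<dots> = (\<chi> i. y i) \<bullet> (transpose T *v z)"
    by (simp add: inner_matrix_transpose[of z T] inner_commute del: transpose_matrix_vector)
  also have "\<dots> = (\<Sum>i\<in>UNIV. (y i)\<^sup>2)"
    unfolding z_def whitening_facts(4)[OF V T] by (simp add: inner_vec_def power2_eq_square)
  finally show ?thesis .
qed

text \<open>The density on \<open>R\<close> is completed by standard normal factors off
  \<open>R\<close>, which is the density belonging to the identity block. By
  \<open>block_form\<close> the two exponents add up to the full form, which whitening turns into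
  the sum of squares of y.\<close>

lemma gauss_density_transform:
  fixes y :: "'n \<Rightarrow> real"
  assumes V: "V \<in> cov_class R lo hi" and T: "transpose T ** V ** T = mat 1" and \<mu>: "on R \<mu> = \<mu>"
  defines "x \<equiv> \<lambda>i. \<mu> $ i + mat_app (V ** T) y i"
  shows "sqrt (det V) * (mvn_density R \<mu> V x * (\<Prod>i\<in>-R. std_normal_density (x i)))
      = (\<Prod>i\<in>UNIV. std_normal_density (y i))"
proof -
  have P: "principal R V = V" and sym: "transpose V = V" using V by (simp_all add: cov_class_def)
  note d = cov_class_inverse(4)[OF lo lohi V]
  define z where "z = (V ** T) *v (\<chi> i. y i)"
  have xz: "x i = \<mu> $ i + z $ i" for i by (simp add: x_def z_def mat_app_vec)
  have dz: "dev_vec R \<mu> x = on R z" by (simp add: dev_vec_def vec_eq_iff xz)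
  have off: "(\<Sum>i\<in>-R. (x i)\<^sup>2) = (\<Sum>i\<in>-R. (z $ i)\<^sup>2)"
    using \<mu> by (intro sum.cong) (auto simp: xz on_eq_iff)
  have "on R z \<bullet> (matrix_inv V *v on R z) + (\<Sum>i\<in>-R. (z $ i)\<^sup>2) = z \<bullet> (matrix_inv V *v z)"
    using block_form[OF cov_class_inverse_principal[OF V], of z] by simp
  also have "\<dots> = (\<Sum>i\<in>UNIV. (y i)\<^sup>2)"
    unfolding z_def by (rule whitening_quadratic[OF V T])
  finally have q: "on R z \<bullet> (matrix_inv V *v on R z) + (\<Sum>i\<in>-R. (x i)\<^sup>2) = (\<Sum>i\<in>UNIV. (y i)\<^sup>2)"
    by (simp add: off)
  have a: "sqrt (2 * pi) ^ card R * sqrt (2 * pi) ^ card (-R) = sqrt (2 * pi) ^ CARD('n)"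
    by (simp add: power_add[symmetric] card_Un_disjoint[symmetric])
  have b: "sqrt ((2 * pi) ^ card R * det V) = sqrt (2 * pi) ^ card R * sqrt (det V)"
    by (simp only: real_sqrt_mult real_sqrt_power)
  have c: "sqrt ((2 * pi) ^ card R * det V) * sqrt (2 * pi) ^ card (-R)
      = sqrt (det V) * sqrt (2 * pi) ^ CARD('n)"
    unfolding a[symmetric] b by (simp only: mult_ac)
  have "sqrt (det V) * (mvn_density R \<mu> V x * (\<Prod>i\<in>-R. std_normal_density (x i)))
      = sqrt (det V) * (exp (- (on R z \<bullet> (matrix_inv V *v on R z)) / 2) * exp (- (\<Sum>i\<in>-R. (x i)\<^sup>2) / 2))
        / (sqrt ((2 * pi) ^ card R * det V) * sqrt (2 * pi) ^ card (-R))"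
    by (simp add: mvn_density_eq[OF P] dz std_normal_prod)
  also have "exp (- (on R z \<bullet> (matrix_inv V *v on R z)) / 2) * exp (- (\<Sum>i\<in>-R. (x i)\<^sup>2) / 2)
      = exp (- (\<Sum>i\<in>UNIV. (y i)\<^sup>2) / 2)"
    unfolding q[symmetric] by (simp add: exp_add[symmetric] add_divide_distrib)
  also have "sqrt (det V) * exp (- (\<Sum>i\<in>UNIV. (y i)\<^sup>2) / 2) /
        (sqrt ((2 * pi) ^ card R * det V) * sqrt (2 * pi) ^ card (-R))
      = exp (- (\<Sum>i\<in>UNIV. (y i)\<^sup>2) / 2) / sqrt (2 * pi) ^ CARD('n)"
    unfolding c using d by simp
  finally show ?thesis by (simp add: std_normal_prod)
qed

text \<open>A change of variables needs equal dimensions on both sides, so the integral over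
  \<real>\<open>\<^sup>R\<close> is first multiplied by an integral over the complement that equals
  one. After the substitution by V T the whole density is standard normal.\<close>

lemma nn_integral_gauss:
  assumes V: "V \<in> cov_class R lo hi" and T: "transpose T ** V ** T = mat 1" and \<mu>: "on R \<mu> = \<mu>"
    and f: "f \<in> borel_measurable (leb R)"
  shows "(\<integral>\<^sup>+x. ennreal (mvn_density R \<mu> V x) * f x \<partial>leb R) = (\<integral>\<^sup>+y. f (gauss_map R \<mu> (V ** T) y) \<partial>std_gauss)"
proof -
  note [measurable] = f
  define \<phi> where "\<phi> x = (\<Prod>i\<in>-R. std_normal_density (x i))" for x :: "'n \<Rightarrow> real"
  define F where "F x = ennreal (mvn_density R \<mu> V x) * f (restrict x R) * ennreal (\<phi> x)" for x
  have [measurable]: "(\<lambda>x. restrict x R) \<in> measurable (leb UNIV) (leb R)"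
    by (rule measurable_restrict_subset) simp
  have [measurable]: "mvn_density R \<mu> V \<in> borel_measurable (leb UNIV)"
    by (rule measurable_mvn_density) simp
  have [measurable]: "\<phi> \<in> borel_measurable (leb UNIV)" "\<phi> \<in> borel_measurable (leb (-R))"
    unfolding \<phi>_def by measurable
  have Fm: "F \<in> borel_measurable (leb UNIV)" unfolding F_def by measurable
  have \<phi>1: "(\<integral>\<^sup>+y. ennreal (\<phi> y) \<partial>leb (-R)) = 1"
  proof -
    have "(\<integral>\<^sup>+y. ennreal (\<phi> y) \<partial>leb (-R)) = (\<integral>\<^sup>+y. (\<Prod>i\<in>-R. ennreal (std_normal_density (y i))) \<partial>leb (-R))"
      by (simp add: \<phi>_def prod_ennreal)
    also have "\<dots> = (\<Prod>i\<in>-R. \<integral>\<^sup>+y. ennreal (std_normal_density y) \<partial>lborel)"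
      by (rule leb.product_nn_integral_prod) auto
    also have "\<dots> = 1"
      by (simp add: nn_integral_eq_integral)
    finally show ?thesis .
  qed
  have U: "R \<union> -R = UNIV" by blast
  have "(\<integral>\<^sup>+x. F x \<partial>leb UNIV) = (\<integral>\<^sup>+x. (\<integral>\<^sup>+y. F (merge R (-R) (x, y)) \<partial>leb (-R)) \<partial>leb R)"
    using leb.product_nn_integral_fold[of R "-R" F] Fm by (simp add: U)
  also have "\<dots> = (\<integral>\<^sup>+x. ennreal (mvn_density R \<mu> V x) * f x \<partial>leb R)"
  proof (rule nn_integral_cong)
    fix x assume x: "x \<in> space (leb R)"
    have m: "mvn_density R \<mu> V (merge R (-R) (x, y)) = mvn_density R \<mu> V x" for y
      by (simp add: mvn_density_def cong: sum.cong)
    have r: "restrict (merge R (-R) (x, y)) R = x" for y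
      using x by (auto simp: space_PiM PiE_iff extensional_def restrict_def fun_eq_iff)
    have p: "\<phi> (merge R (-R) (x, y)) = \<phi> y" for y
      unfolding \<phi>_def by (intro prod.cong) auto
    have "(\<integral>\<^sup>+y. F (merge R (-R) (x, y)) \<partial>leb (-R))
        = (\<integral>\<^sup>+y. (ennreal (mvn_density R \<mu> V x) * f x) * ennreal (\<phi> y) \<partial>leb (-R))"
      by (simp add: F_def m r p)
    also have "\<dots> = ennreal (mvn_density R \<mu> V x) * f x * (\<integral>\<^sup>+y. ennreal (\<phi> y) \<partial>leb (-R))"
      by (rule nn_integral_cmult) measurable
    finally show "(\<integral>\<^sup>+y. F (merge R (-R) (x, y)) \<partial>leb (-R)) = ennreal (mvn_density R \<mu> V x) * f x"
      by (simp add: \<phi>1)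
  qed
  finally have 1: "(\<integral>\<^sup>+x. ennreal (mvn_density R \<mu> V x) * f x \<partial>leb R) = (\<integral>\<^sup>+x. F x \<partial>leb UNIV)" ..
  let ?x = "\<lambda>y i. \<mu> $ i + mat_app (V ** T) y i"
  note wf = whitening_facts[OF V T]
  have "(\<integral>\<^sup>+x. F x \<partial>leb UNIV) = ennreal \<bar>det (V ** T)\<bar> * (\<integral>\<^sup>+y. F (?x y) \<partial>leb UNIV)"
    by (rule nn_integral_affine_change[OF wf(3) Fm])
  also have "\<dots> = (\<integral>\<^sup>+y. ennreal \<bar>det (V ** T)\<bar> * F (?x y) \<partial>leb UNIV)"
  proof (rule nn_integral_cmult[symmetric])
    have "(\<lambda>y. mat_app (V ** T) y i) \<in> borel_measurable (leb UNIV)" for i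
      unfolding mat_app_def by measurable
    then have "?x \<in> measurable (leb UNIV) (leb UNIV)"
      by (intro measurable_PiM_single') (auto simp: space_PiM)
    then show "(\<lambda>y. F (?x y)) \<in> borel_measurable (leb UNIV)" using Fm by (rule measurable_compose)
  qed
  also have "\<dots> = (\<integral>\<^sup>+y. ennreal (\<Prod>i\<in>UNIV. std_normal_density (y i)) * f (gauss_map R \<mu> (V ** T) y) \<partial>leb UNIV)"
  proof (rule nn_integral_cong)
    fix y :: "'n \<Rightarrow> real"
    have nn: "0 \<le> mvn_density R \<mu> V (?x y)" "0 \<le> \<phi> (?x y)" "0 \<le> sqrt (det V)"
      using cov_class_inverse(4)[OF lo lohi V] V
      by (auto simp: mvn_density_def \<phi>_def cov_class_def intro!: prod_nonneg)
    have "ennreal \<bar>det (V ** T)\<bar> * F (?x y)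
        = ennreal (sqrt (det V) * (mvn_density R \<mu> V (?x y) * \<phi> (?x y))) * f (restrict (?x y) R)"
      unfolding F_def wf(2) using nn by (simp add: ennreal_mult mult_ac)
    also have "sqrt (det V) * (mvn_density R \<mu> V (?x y) * \<phi> (?x y)) = (\<Prod>i\<in>UNIV. std_normal_density (y i))"
      unfolding \<phi>_def by (rule gauss_density_transform[OF V T \<mu>])
    finally show "ennreal \<bar>det (V ** T)\<bar> * F (?x y)
        = ennreal (\<Prod>i\<in>UNIV. std_normal_density (y i)) * f (gauss_map R \<mu> (V ** T) y)"
      unfolding gauss_map_def .
  qed
  also have "\<dots> = (\<integral>\<^sup>+y. f (gauss_map R \<mu> (V ** T) y) \<partial>std_gauss)"
    unfolding std_gauss_def by (subst nn_integral_density) measurable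
  finally show ?thesis using 1 by simp
qed

end

lemma sets_std_gauss [measurable_cong]: "sets std_gauss = sets (leb UNIV)"
  by (simp add: std_gauss_def)

lemma nn_integral_std_gauss_prod:
  fixes f :: "'n::finite \<Rightarrow> real \<Rightarrow> real"
  assumes [measurable]: "\<And>i. f i \<in> borel_measurable borel" and nn: "\<And>i y. 0 \<le> f i y"
  shows "(\<integral>\<^sup>+y. ennreal (\<Prod>i\<in>UNIV. f i (y i)) \<partial>std_gauss)
    = (\<Prod>i\<in>UNIV. \<integral>\<^sup>+y. ennreal (std_normal_density y * f i y) \<partial>lborel)"
proof -
  have "(\<integral>\<^sup>+y. ennreal (\<Prod>i\<in>UNIV. f i (y i)) \<partial>(std_gauss :: ('n \<Rightarrow> real) measure))
      = (\<integral>\<^sup>+y. (\<Prod>i\<in>UNIV. ennreal (std_normal_density (y i) * f i (y i))) \<partial>leb UNIV)"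
    unfolding std_gauss_def
    by (subst nn_integral_density, measurable)
       (simp add: prod_ennreal nn ennreal_mult[symmetric] prod_nonneg prod.distrib)
  also have "\<dots> = (\<Prod>i\<in>UNIV. \<integral>\<^sup>+y. ennreal (std_normal_density y * f i y) \<partial>lborel)"
    by (rule leb.product_nn_integral_prod) auto
  finally show ?thesis .
qed

lemma prob_space_std_gauss: "prob_space (std_gauss :: ('n::finite \<Rightarrow> real) measure)"
proof
  have "emeasure std_gauss (space (std_gauss :: ('n \<Rightarrow> real) measure))
      = (\<integral>\<^sup>+y. ennreal (\<Prod>i\<in>(UNIV::'n set). 1) \<partial>(std_gauss :: ('n \<Rightarrow> real) measure))" by simp
  also have "\<dots> = (\<Prod>i\<in>(UNIV::'n set). \<integral>\<^sup>+y. ennreal (std_normal_density y * 1) \<partial>lborel)"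
    by (rule nn_integral_std_gauss_prod) auto
  also have "\<dots> = 1" by (simp add: nn_integral_eq_integral)
  finally show "emeasure std_gauss (space (std_gauss :: ('n \<Rightarrow> real) measure)) = 1" .
qed

lemma std_gauss_coordinate:
  fixes f :: "real \<Rightarrow> real" and k :: "'n::finite"
  assumes f: "has_bochner_integral lborel (\<lambda>y. std_normal_density y * f y) c"
    and [measurable]: "f \<in> borel_measurable borel"
  shows "has_bochner_integral std_gauss (\<lambda>y. f (y k)) c"
proof -
  let ?g = "\<lambda>i y. std_normal_density y * (if i = k then f y else 1)"
  have int: "integrable lborel (?g i)" for i
    using f by (cases "i = k") (auto simp: has_bochner_integral_iff)
  have eq: "(\<Prod>i\<in>UNIV. std_normal_density (y i)) * f (y k) = (\<Prod>i\<in>UNIV. ?g i (y i))" for y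
    by (simp add: prod.distrib prod.delta)
  have "integrable (leb UNIV) (\<lambda>y. \<Prod>i\<in>UNIV. ?g i (y i))"
    by (rule leb.product_integrable_prod[OF _ int]) simp
  moreover have "(\<integral>y. (\<Prod>i\<in>UNIV. ?g i (y i)) \<partial>leb UNIV) = (\<Prod>i\<in>UNIV. integral\<^sup>L lborel (?g i))"
    by (rule leb.product_integral_prod[OF _ int]) simp
  moreover have "integral\<^sup>L lborel (?g i) = (if i = k then c else 1)" for i
    using f by (auto simp: has_bochner_integral_iff)
  ultimately have "has_bochner_integral (leb UNIV) (\<lambda>y. (\<Prod>i\<in>UNIV. std_normal_density (y i)) * f (y k)) c"
    unfolding eq by (simp add: has_bochner_integral_iff prod.delta)
  then show ?thesis
    unfolding std_gauss_def
    by (intro has_bochner_integral_density) (auto intro!: prod_nonneg simp: mult.commute)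
qed

section \<open>Divergence and affinity of Gaussians\<close>

lemma prod_le_1_ennreal: "(\<And>i. i \<in> A \<Longrightarrow> f i \<le> (1::ennreal)) \<Longrightarrow> prod f A \<le> 1"
proof (induction A rule: infinite_finite_induct)
  case (insert a A)
  then have "f a * prod f A \<le> 1 * 1" by (intro mult_mono) auto
  with insert show ?case by simp
qed auto

text \<open>The closed form of the divergence of two Gaussians on \<real>\<open>\<^sup>R\<close>,
  written with padded matrices. The full dimension is subtracted because every padded coordinate
  adds one to the trace.\<close>

definition gauss_kl :: "real^'n \<Rightarrow> real^'n^'n \<Rightarrow> real^'n \<Rightarrow> real^'n^'n::finite \<Rightarrow> real" where
  "gauss_kl \<mu> V \<nu> W = (trace (matrix_inv W ** V) - real CARD('n) + ln (det W) - ln (det V)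
     + (\<mu> - \<nu>) \<bullet> (matrix_inv W *v (\<mu> - \<nu>))) / 2"

lemma diag_mat_mult: "diag_mat a ** diag_mat b = diag_mat (\<lambda>i. a i * b i)"
proof -
  have "(diag_mat a ** diag_mat b) $ i $ j = (\<Sum>k\<in>UNIV. if k = i then (if i = j then a i * b i else 0) else 0)" for i j
    unfolding matrix_matrix_mult_def diag_mat_def vec_lambda_beta by (intro sum.cong) auto
  then show ?thesis by (simp add: vec_eq_iff diag_mat_def)
qed

lemma diag_mat_vec: "(diag_mat a *v x) $ i = a i * x $ i"
proof -
  have "(diag_mat a *v x) $ i = (\<Sum>j\<in>UNIV. if i = j then a i * x $ j else 0)"
    unfolding matrix_vector_mult_def vec_lambda_beta diag_mat_def by (intro sum.cong) auto
  then show ?thesis by simp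
qed

lemma det_diag_mat: "det (diag_mat a) = (\<Prod>i\<in>UNIV. a i)"
  by (subst det_diagonal) (auto simp: diag_mat_def)

lemma trace_diag_mat: "trace (diag_mat a) = (\<Sum>i\<in>UNIV. a i)"
  by (simp add: trace_def diag_mat_def)

context
  fixes R :: "'n::finite set" and lo hi :: real
  assumes lo: "0 < lo" and lohi: "lo \<le> hi"
begin

lemma simultaneous_whitening_facts:
  fixes V W T :: "real^'n^'n"
  assumes V: "V \<in> cov_class R lo hi" and T: "transpose T ** V ** T = mat 1"
    and D: "transpose T ** W ** T = diag_mat r" and r: "\<And>i. 0 < r i"
  shows "matrix_inv W = T ** diag_mat (\<lambda>i. 1 / r i) ** transpose T"
    "det W = det V * (\<Prod>i\<in>UNIV. r i)"
    "trace (matrix_inv W ** V) = (\<Sum>i\<in>UNIV. 1 / r i)"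
    "x \<bullet> (matrix_inv W *v x) = (\<Sum>i\<in>UNIV. ((transpose T *v x) $ i)\<^sup>2 / r i)"
    "ln (det W) = ln (det V) + (\<Sum>i\<in>UNIV. ln (r i))"
proof -
  let ?D = "diag_mat (\<lambda>i. 1 / r i) :: real^'n^'n"
  have "diag_mat r ** ?D = mat 1"
    using r by (simp add: diag_mat_mult less_imp_neq[symmetric]) (simp add: diag_mat_def mat_def)
  then have "transpose T ** (W ** T ** ?D) = mat 1" by (simp add: D[symmetric] matrix_mul_assoc)
  then have "(W ** T ** ?D) ** transpose T = mat 1" using matrix_left_right_inverse by blast
  then have "W ** (T ** ?D ** transpose T) = mat 1" by (simp add: matrix_mul_assoc)
  then show eq: "matrix_inv W = T ** ?D ** transpose T" by (rule matrix_inv_eqI)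
  have "det V * (det T)\<^sup>2 = 1"
    using arg_cong[OF T, of det] by (simp add: det_mul det_transpose power2_eq_square mult_ac)
  moreover have "det W * (det T)\<^sup>2 = (\<Prod>i\<in>UNIV. r i)"
    using arg_cong[OF D, of det] by (simp add: det_mul det_transpose det_diag_mat power2_eq_square mult_ac)
  ultimately show dW: "det W = det V * (\<Prod>i\<in>UNIV. r i)" by (metis mult.left_commute mult.right_neutral)
  have "0 < (\<Prod>i\<in>UNIV. r i)" using r by (simp add: prod_pos)
  then show "ln (det W) = ln (det V) + (\<Sum>i\<in>UNIV. ln (r i))"
    unfolding dW using cov_class_inverse(4)[OF lo lohi V]
    by (simp add: ln_mult ln_prod r less_imp_neq[OF r, symmetric])
  have "trace (matrix_inv W ** V) = trace ((T ** ?D) ** (transpose T ** V))"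
    by (simp add: eq matrix_mul_assoc)
  also have "\<dots> = trace ((transpose T ** V) ** (T ** ?D))" by (rule trace_mul_sym)
  also have "(transpose T ** V) ** (T ** ?D) = ?D" using T by (simp add: matrix_mul_assoc)
  finally show "trace (matrix_inv W ** V) = (\<Sum>i\<in>UNIV. 1 / r i)" by (simp add: trace_diag_mat)
  have "x \<bullet> (matrix_inv W *v x) = (transpose T *v x) \<bullet> (?D *v (transpose T *v x))"
    unfolding eq by (simp add: matrix_vector_mul_assoc[symmetric] inner_matrix_transpose[of x T]
        del: transpose_matrix_vector)
  then show "x \<bullet> (matrix_inv W *v x) = (\<Sum>i\<in>UNIV. ((transpose T *v x) $ i)\<^sup>2 / r i)"
    by (simp add: inner_vec_def diag_mat_vec power2_eq_square)
qed

lemma mvn_density_pos: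
  assumes "V \<in> cov_class R lo hi"
  shows "0 < mvn_density R \<mu> V x"
  using cov_class_inverse(4)[OF lo lohi assms] assms
  by (simp add: mvn_density_def cov_class_def)

lemma ln_mvn_density:
  assumes V: "V \<in> cov_class R lo hi"
  shows "ln (mvn_density R \<mu> V x) = - (dev_vec R \<mu> x \<bullet> (matrix_inv V *v dev_vec R \<mu> x)) / 2
    - (ln ((2 * pi) ^ card R) + ln (det V)) / 2"
proof -
  have d: "det V > 0" by (rule cov_class_inverse(4)[OF lo lohi V])
  have P: "principal R V = V" using V by (simp add: cov_class_def)
  have "(2 * pi) ^ card R * det V > 0" using d by simp
  then show ?thesis unfolding mvn_density_eq[OF P] using d
    by (simp add: ln_div ln_sqrt ln_mult)
qed

text \<open>In the coordinates y the V-form is the Euclidean square and the W-form is diagonal, so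
  the log-ratio becomes a sum of one-dimensional log-ratios. Divergence and affinity both follow
  from this separation.\<close>

lemma log_ratio_gauss_map:
  fixes y :: "'n \<Rightarrow> real"
  assumes V: "V \<in> cov_class R lo hi" and W: "W \<in> cov_class R lo hi"
    and T: "transpose T ** V ** T = mat 1"
    and D: "transpose T ** W ** T = diag_mat r" and r: "\<And>i. 0 < r i"
    and \<mu>: "on R \<mu> = \<mu>" and \<nu>: "on R \<nu> = \<nu>"
  shows "ln (mvn_density R \<mu> V (gauss_map R \<mu> (V ** T) y)) - ln (mvn_density R \<nu> W (gauss_map R \<mu> (V ** T) y))
    = (\<Sum>i\<in>UNIV. (ln (r i) + (y i + (transpose T *v (\<mu> - \<nu>)) $ i)\<^sup>2 / r i - (y i)\<^sup>2) / 2)"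
proof -
  let ?x = "gauss_map R \<mu> (V ** T) y"
  define z where "z = (V ** T) *v (\<chi> i. y i)"
  define w where "w = z + (\<mu> - \<nu>)"
  note wf = whitening_facts[OF lo lohi V T]
  note sf = simultaneous_whitening_facts[OF V T D r]
  have d1: "dev_vec R \<mu> ?x = on R z"
    by (auto simp: dev_vec_def gauss_map_def vec_eq_iff z_def mat_app_vec)
  have d2: "dev_vec R \<nu> ?x = on R w"
    by (auto simp: dev_vec_def gauss_map_def vec_eq_iff z_def w_def mat_app_vec)
  \<comment> \<open>Both means vanish off \<open>R\<close>, so the padding contributes the same
    squares to both forms, and they cancel in the difference.\<close>
  have off: "(\<Sum>i\<in>-R. (z $ i)\<^sup>2) = (\<Sum>i\<in>-R. (w $ i)\<^sup>2)"
    using \<mu> \<nu> by (intro sum.cong) (auto simp: w_def on_eq_iff)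
  have qV: "on R z \<bullet> (matrix_inv V *v on R z) = (\<Sum>i\<in>UNIV. (y i)\<^sup>2) - (\<Sum>i\<in>-R. (w $ i)\<^sup>2)"
    using block_form[OF cov_class_inverse_principal[OF lo lohi V], of z] off
      whitening_quadratic[OF lo lohi V T, of y, folded z_def] by simp
  have "(transpose T *v w) $ i = y i + (transpose T *v (\<mu> - \<nu>)) $ i" for i
    unfolding w_def matrix_vector_right_distrib z_def wf(4) by simp
  then have "w \<bullet> (matrix_inv W *v w) = (\<Sum>i\<in>UNIV. (y i + (transpose T *v (\<mu> - \<nu>)) $ i)\<^sup>2 / r i)"
    by (simp only: sf(4))
  then have qW: "on R w \<bullet> (matrix_inv W *v on R w)
      = (\<Sum>i\<in>UNIV. (y i + (transpose T *v (\<mu> - \<nu>)) $ i)\<^sup>2 / r i) - (\<Sum>i\<in>-R. (w $ i)\<^sup>2)"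
    using block_form[OF cov_class_inverse_principal[OF lo lohi W], of w] by simp
  show ?thesis
    unfolding ln_mvn_density[OF V] ln_mvn_density[OF W] d1 d2 qV qW sf(5)
    by (simp add: sum.distrib sum_subtractf sum_divide_distrib[symmetric] field_simps)
qed

lemma gauss_kl_eq:
  fixes V W T :: "real^'n^'n"
  assumes V: "V \<in> cov_class R lo hi" and T: "transpose T ** V ** T = mat 1"
    and D: "transpose T ** W ** T = diag_mat r" and r: "\<And>i. 0 < r i"
  shows "gauss_kl \<mu> V \<nu> W
    = (\<Sum>i\<in>UNIV. (ln (r i) + (1 + ((transpose T *v (\<mu> - \<nu>)) $ i)\<^sup>2) / r i - 1) / 2)"
proof -
  note sf = simultaneous_whitening_facts[OF V T D r]
  show ?thesis
    unfolding gauss_kl_def sf(3,4,5)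
    by (simp add: sum.distrib sum_subtractf sum_divide_distrib[symmetric] add_divide_distrib)
qed

lemma mvn_eq_distr:
  assumes V: "V \<in> cov_class R lo hi" and T: "transpose T ** V ** T = mat 1" and \<mu>: "on R \<mu> = \<mu>"
  shows "mvn R \<mu> V = distr std_gauss (leb R) (gauss_map R \<mu> (V ** T))"
proof (rule measure_eqI)
  fix A assume "A \<in> sets (mvn R \<mu> V)"
  then have A: "A \<in> sets (leb R)" by (simp add: mvn_def)
  have "emeasure (mvn R \<mu> V) A = (\<integral>\<^sup>+x. ennreal (mvn_density R \<mu> V x) * indicator A x \<partial>leb R)"
    unfolding mvn_def using A by (subst emeasure_density) auto
  also have "\<dots> = (\<integral>\<^sup>+y. indicator A (gauss_map R \<mu> (V ** T) y) \<partial>std_gauss)"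
    by (rule nn_integral_gauss[OF lo lohi V T \<mu>]) (use A in auto)
  also have "\<dots> = (\<integral>\<^sup>+x. indicator A x \<partial>distr std_gauss (leb R) (gauss_map R \<mu> (V ** T)))"
    using A by (subst nn_integral_distr) auto
  also have "\<dots> = emeasure (distr std_gauss (leb R) (gauss_map R \<mu> (V ** T))) A"
    using A by (subst nn_integral_indicator) auto
  finally show "emeasure (mvn R \<mu> V) A = emeasure (distr std_gauss (leb R) (gauss_map R \<mu> (V ** T))) A" .
qed (simp add: mvn_def)

lemma prob_space_mvn:
  assumes V: "V \<in> cov_class R lo hi" and \<mu>: "on R \<mu> = \<mu>"
  shows "prob_space (mvn R \<mu> V)"
proof -
  obtain T :: "real^'n^'n" where T: "transpose T ** V ** T = mat 1" using whitening_self[OF lo lohi V] .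
  show ?thesis unfolding mvn_eq_distr[OF V T \<mu>]
    by (rule prob_space.prob_space_distr[OF prob_space_std_gauss]) simp
qed

end

section \<open>One-dimensional Gaussian integrals\<close>

lemma normal_quadratic_expectation:
  fixes c m r :: real
  shows "has_bochner_integral lborel (\<lambda>y. std_normal_density y * ((c + (y + m)\<^sup>2 / r - y\<^sup>2) / 2))
    ((c + (1 + m\<^sup>2) / r - 1) / 2)"
proof -
  have h0: "has_bochner_integral lborel (\<lambda>y. std_normal_density y) 1"
    by (simp add: has_bochner_integral_iff)
  have h1: "has_bochner_integral lborel (\<lambda>y. std_normal_density y * y) 0"
    using std_normal_moment_odd[of 0] by simp
  have h2: "has_bochner_integral lborel (\<lambda>y. std_normal_density y * y\<^sup>2) 1"
    using std_normal_moment_even[of 1] by simp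
  have "has_bochner_integral lborel (\<lambda>y. (c + m\<^sup>2 / r) / 2 * std_normal_density y
      + m / r * (std_normal_density y * y) + (1 / r - 1) / 2 * (std_normal_density y * y\<^sup>2))
    ((c + m\<^sup>2 / r) / 2 * 1 + m / r * 0 + (1 / r - 1) / 2 * 1)"
    by (intro has_bochner_integral_add has_bochner_integral_mult_right) (use h0 h1 h2 in auto)
  moreover have "(\<lambda>y. (c + m\<^sup>2 / r) / 2 * std_normal_density y
      + m / r * (std_normal_density y * y) + (1 / r - 1) / 2 * (std_normal_density y * y\<^sup>2))
     = (\<lambda>y. std_normal_density y * ((c + (y + m)\<^sup>2 / r - y\<^sup>2) / 2))"
    by (intro ext) (cases "r = 0"; simp add: field_simps power2_eq_square)
  moreover have "(c + m\<^sup>2 / r) / 2 * 1 + m / r * 0 + (1 / r - 1) / 2 * 1 = (c + (1 + m\<^sup>2) / r - 1) / 2"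
    by (cases "r = 0") (simp_all add: field_simps)
  ultimately show ?thesis by (simp only:)
qed

text \<open>The Bhattacharyya affinity of the normal laws with means 0, - m and variances 1, r.
  Completing the square exhibits the integrand as a constant times the normal density with mean - m
  / (1 + r) and variance 2 r / (1 + r).\<close>

lemma normal_affinity:
  fixes m r :: real
  assumes r: "r > 0"
  shows "(\<integral>\<^sup>+y. ennreal (std_normal_density y * exp (- ((ln r + (y + m)\<^sup>2 / r - y\<^sup>2) / 4))) \<partial>lborel)
    = ennreal (exp (- (h_fun r + m\<^sup>2 / (4 * (1 + r)))))"
proof -
  define \<sigma> where "\<sigma> = sqrt (2 * r / (1 + r))"
  have \<sigma>: "\<sigma> > 0" "\<sigma>\<^sup>2 = 2 * r / (1 + r)" using r by (auto simp: \<sigma>_def)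
  define C where "C = exp (- (h_fun r + m\<^sup>2 / (4 * (1 + r))))"
  have h: "h_fun r = (ln (1 + r) - ln 2 - ln r / 2) / 2"
    using r by (simp add: h_fun_def ln_div ln_mult ln_sqrt)
  have s: "1 / sqrt (2 * pi * \<sigma>\<^sup>2) = 1 / sqrt (2 * pi) * exp (- (ln 2 + ln r - ln (1 + r)) / 2)"
  proof -
    have "exp (- (ln 2 + ln r - ln (1 + r)) / 2) = exp (- (ln (\<sigma>\<^sup>2) / 2))"
      unfolding \<sigma>(2) using r by (simp add: ln_div ln_mult field_simps)
    also have "\<dots> = 1 / \<sigma>" using \<sigma>(1) by (simp add: ln_realpow exp_minus inverse_eq_divide)
    finally show ?thesis using \<sigma>(1) by (simp add: real_sqrt_mult)
  qed
  have "std_normal_density y * exp (- ((ln r + (y + m)\<^sup>2 / r - y\<^sup>2) / 4))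
      = C * normal_density (- m / (1 + r)) \<sigma> y" for y
  proof -
    have e: "- y\<^sup>2 / 2 - (ln r + (y + m)\<^sup>2 / r - y\<^sup>2) / 4
      = - (h_fun r + m\<^sup>2 / (4 * (1 + r))) - (ln 2 + ln r - ln (1 + r)) / 2
        - (y - (- m / (1 + r)))\<^sup>2 / (2 * \<sigma>\<^sup>2)"
    proof -
      have "(y + m)\<^sup>2 / r + y\<^sup>2 = m\<^sup>2 / (1 + r) + (y + m / (1 + r))\<^sup>2 * (1 + r) / r"
        using r by (simp add: divide_simps power2_eq_square) algebra
      moreover define A B C' where "A = (y + m)\<^sup>2 / r" and "B = m\<^sup>2 / (1 + r)"
        and "C' = (y + m / (1 + r))\<^sup>2 * (1 + r) / r"
      ultimately have "A + y\<^sup>2 = B + C'" by simp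
      then have "- y\<^sup>2 / 2 - (ln r + A - y\<^sup>2) / 4 = - ((ln (1 + r) - ln 2 - ln r / 2) / 2 + B / 4)
        - (ln 2 + ln r - ln (1 + r)) / 2 - C' / 4" by (simp add: field_simps)
      moreover have "m\<^sup>2 / (4 * (1 + r)) = B / 4" by (simp add: B_def)
      moreover have "(y - (- m / (1 + r)))\<^sup>2 / (2 * \<sigma>\<^sup>2) = C' / 4"
        unfolding \<sigma>(2) C'_def using r by simp
      ultimately show ?thesis unfolding h by (simp only: A_def)
    qed
    have "std_normal_density y * exp (- ((ln r + (y + m)\<^sup>2 / r - y\<^sup>2) / 4))
      = 1 / sqrt (2 * pi) * exp (- y\<^sup>2 / 2 - (ln r + (y + m)\<^sup>2 / r - y\<^sup>2) / 4)"
      unfolding std_normal_density_def by (simp only: mult.assoc mult_exp_exp add_uminus_conv_diff)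
    also have "\<dots> = C * normal_density (- m / (1 + r)) \<sigma> y"
    proof -
      have ex: "exp (- K - X / 2 - Q) = exp (- K) * exp (- X / 2) * exp (- Q)" for K X Q :: real
        by (simp add: mult_exp_exp)
      show ?thesis
        unfolding e normal_density_def s C_def ex by (simp only: mult_ac minus_divide_left)
    qed
    finally show ?thesis .
  qed
  then have "(\<integral>\<^sup>+y. ennreal (std_normal_density y * exp (- ((ln r + (y + m)\<^sup>2 / r - y\<^sup>2) / 4))) \<partial>lborel)
      = (\<integral>\<^sup>+y. ennreal C * ennreal (normal_density (- m / (1 + r)) \<sigma> y) \<partial>lborel)"
    by (simp add: ennreal_mult C_def)
  also have "\<dots> = ennreal C * (\<integral>\<^sup>+y. ennreal (normal_density (- m / (1 + r)) \<sigma> y) \<partial>lborel)"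
    by (rule nn_integral_cmult) simp
  also have "(\<integral>\<^sup>+y. ennreal (normal_density (- m / (1 + r)) \<sigma> y) \<partial>lborel) = 1"
    using \<sigma> by (simp add: nn_integral_eq_integral)
  finally show ?thesis by (simp add: C_def)
qed

text \<open>The moment generating function of the chi-square law with one degree of freedom, which
  feeds the Chernoff bound in \<open>mvn_tail\<close>.\<close>

lemma normal_square_mgf:
  fixes l :: real
  assumes l: "l < 1 / 2"
  shows "(\<integral>\<^sup>+y. ennreal (std_normal_density y * exp (l * y\<^sup>2)) \<partial>lborel) = ennreal (1 / sqrt (1 - 2 * l))"
proof -
  define \<sigma> where "\<sigma> = 1 / sqrt (1 - 2 * l)"
  have \<sigma>: "\<sigma> > 0" "\<sigma>\<^sup>2 = 1 / (1 - 2 * l)" using l by (auto simp: \<sigma>_def power_divide)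
  have "std_normal_density y * exp (l * y\<^sup>2) = \<sigma> * normal_density 0 \<sigma> y" for y
  proof -
    have "y\<^sup>2 / (2 * \<sigma>\<^sup>2) = y\<^sup>2 / 2 - l * y\<^sup>2" unfolding \<sigma>(2) by (simp add: field_simps)
    then show ?thesis
      using \<sigma>(1) by (simp add: normal_density_def real_sqrt_mult exp_add[symmetric])
  qed
  then have "(\<integral>\<^sup>+y. ennreal (std_normal_density y * exp (l * y\<^sup>2)) \<partial>lborel)
      = (\<integral>\<^sup>+y. ennreal \<sigma> * ennreal (normal_density 0 \<sigma> y) \<partial>lborel)"
    using \<sigma>(1) by (simp add: ennreal_mult)
  also have "\<dots> = ennreal \<sigma> * (\<integral>\<^sup>+y. ennreal (normal_density 0 \<sigma> y) \<partial>lborel)"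
    by (rule nn_integral_cmult) simp
  also have "(\<integral>\<^sup>+y. ennreal (normal_density 0 \<sigma> y) \<partial>lborel) = 1"
    using \<sigma> by (simp add: nn_integral_eq_integral)
  finally show ?thesis by (simp add: \<sigma>_def)
qed

section \<open>Divergence and affinity of Gaussians on a coordinate subspace\<close>

context
  fixes R :: "'n::finite set" and lo hi :: real
  assumes lo: "0 < lo" and lohi: "lo \<le> hi"
begin

text \<open>The divergence is the mean of the log-ratio under the first law. In whitened coordinates
  this is a sum of quadratic polynomials in single standard normals, so moments up to order two
  determine it.\<close>

theorem KL_mvn:
  assumes V: "V \<in> cov_class R lo hi" and W: "W \<in> cov_class R lo hi"
    and \<mu>: "on R \<mu> = \<mu>" and \<nu>: "on R \<nu> = \<nu>"
  shows "KL (mvn R \<mu> V) (mvn R \<nu> W) = gauss_kl \<mu> V \<nu> W"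
proof -
  obtain T :: "real^'n^'n" and r where T: "transpose T ** V ** T = mat 1"
    and D: "transpose T ** W ** T = diag_mat r" and r': "\<forall>i. lo / hi \<le> r i \<and> r i \<le> hi / lo"
    using whitening[OF lo lohi V W] by blast
  have rb: "lo / hi \<le> r i" "r i \<le> hi / lo" for i using r' by auto
  have r: "0 < r i" for i using rb(1)[of i] lo lohi by (smt (verit) divide_pos_pos)
  let ?p = "mvn_density R \<mu> V" and ?q = "mvn_density R \<nu> W"
  let ?L = "\<lambda>x. ln (?p x) - ln (?q x)"
  note pos = mvn_density_pos[OF lo lohi V] mvn_density_pos[OF lo lohi W]
  interpret sigma_finite_measure "leb R" by (rule leb.sigma_finite) simp
  have Lm: "?L \<in> borel_measurable (leb R)" by measurable
  have "KL (mvn R \<mu> V) (mvn R \<nu> W) = (\<integral>x. ?p x * log (exp 1) (?p x / ?q x) \<partial>leb R)"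
    unfolding KL_def mvn_def
    by (rule KL_density_density) (use pos in \<open>auto simp: less_imp_le less_imp_neq[symmetric]\<close>)
  also have "\<dots> = (\<integral>x. ?p x * ?L x \<partial>leb R)"
    using less_imp_neq[OF pos(1), symmetric] less_imp_neq[OF pos(2), symmetric]
    by (simp add: log_def ln_div)
  also have "\<dots> = (\<integral>x. ?L x \<partial>mvn R \<mu> V)"
    unfolding mvn_def by (subst integral_density) (use pos in \<open>auto simp: less_imp_le\<close>)
  also have "\<dots> = (\<integral>y. ?L (gauss_map R \<mu> (V ** T) y) \<partial>std_gauss)"
    unfolding mvn_eq_distr[OF lo lohi V T \<mu>] by (rule integral_distr) (use Lm in auto)
  also have "\<dots> = gauss_kl \<mu> V \<nu> W"
    unfolding log_ratio_gauss_map[OF lo lohi V W T D r \<mu> \<nu>] gauss_kl_eq[OF lo lohi V T D r]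
    by (intro has_bochner_integral_integral_eq has_bochner_integral_sum std_gauss_coordinate
        normal_quadratic_expectation) measurable
  finally show ?thesis .
qed

text \<open>
  The Bhattacharyya affinity factorises in the whitened coordinates, where the claim reduces to
  a comparison of one-dimensional Gaussians.
\<close>

theorem half_likelihood_ratio_bound:
  assumes V: "V \<in> cov_class R lo hi" and W: "W \<in> cov_class R lo hi"
    and \<mu>: "on R \<mu> = \<mu>" and \<nu>: "on R \<nu> = \<nu>"
    and \<kappa>: "\<And>r m. lo / hi \<le> r \<Longrightarrow> r \<le> hi / lo \<Longrightarrow>
      \<kappa> * ((ln r + (1 + m\<^sup>2) / r - 1) / 2) \<le> h_fun r + m\<^sup>2 / (4 * (1 + r))"
  shows "(\<integral>\<^sup>+x. ennreal (exp ((ln (mvn_density R \<mu> V x) - ln (mvn_density R \<nu> W x)) / 2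
      + \<kappa> * gauss_kl \<mu> V \<nu> W)) \<partial>mvn R \<nu> W) \<le> 1"
proof -
  obtain T :: "real^'n^'n" and r where T: "transpose T ** V ** T = mat 1"
    and D: "transpose T ** W ** T = diag_mat r" and r': "\<forall>i. lo / hi \<le> r i \<and> r i \<le> hi / lo"
    using whitening[OF lo lohi V W] by blast
  have rb: "lo / hi \<le> r i" "r i \<le> hi / lo" for i using r' by auto
  have r: "0 < r i" for i using rb(1)[of i] lo lohi by (smt (verit) divide_pos_pos)
  let ?p = "mvn_density R \<mu> V" and ?q = "mvn_density R \<nu> W" and ?k = "gauss_kl \<mu> V \<nu> W"
  let ?L = "\<lambda>x. ln (?p x) - ln (?q x)"
  define m where "m = transpose T *v (\<mu> - \<nu>)"
  note pos = mvn_density_pos[OF lo lohi V] mvn_density_pos[OF lo lohi W]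
  \<comment> \<open>Writing q sqrt (p / q) as p sqrt (q / p) moves the expectation to the V-law, the
    one that T whitens to the standard normal.\<close>
  have swap: "?q x * exp (?L x / 2 + \<kappa> * ?k) = ?p x * exp (- ?L x / 2 + \<kappa> * ?k)" for x
  proof -
    have "?q x * exp (?L x / 2 + \<kappa> * ?k) = exp (ln (?q x) + (?L x / 2 + \<kappa> * ?k))"
      using pos by (simp add: exp_add)
    also have "ln (?q x) + (?L x / 2 + \<kappa> * ?k) = ln (?p x) + (- ?L x / 2 + \<kappa> * ?k)"
      by (simp add: field_simps)
    also have "exp \<dots> = ?p x * exp (- ?L x / 2 + \<kappa> * ?k)" using pos by (simp add: exp_add)
    finally show ?thesis .
  qed
  have "(\<integral>\<^sup>+x. ennreal (exp (?L x / 2 + \<kappa> * ?k)) \<partial>mvn R \<nu> W)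
      = (\<integral>\<^sup>+x. ennreal (?q x) * ennreal (exp (?L x / 2 + \<kappa> * ?k)) \<partial>leb R)"
    unfolding mvn_def by (rule nn_integral_density) measurable
  also have "\<dots> = (\<integral>\<^sup>+x. ennreal (?p x) * ennreal (exp (- ?L x / 2 + \<kappa> * ?k)) \<partial>leb R)"
    using pos by (simp only: ennreal_mult[symmetric] swap less_imp_le exp_ge_zero)
  also have "\<dots> = (\<integral>\<^sup>+y. ennreal (exp (- ?L (gauss_map R \<mu> (V ** T) y) / 2 + \<kappa> * ?k)) \<partial>std_gauss)"
    by (rule nn_integral_gauss[OF lo lohi V T \<mu>]) measurable
  also have "\<dots> = (\<integral>\<^sup>+y. ennreal (\<Prod>i\<in>UNIV. exp (\<kappa> * ((ln (r i) + (1 + (m $ i)\<^sup>2) / r i - 1) / 2))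
      * exp (- ((ln (r i) + (y i + m $ i)\<^sup>2 / r i - (y i)\<^sup>2) / 4))) \<partial>std_gauss)"
  proof (intro nn_integral_cong arg_cong[of _ _ ennreal])
    fix y :: "'n \<Rightarrow> real"
    have "- ?L (gauss_map R \<mu> (V ** T) y) / 2 + \<kappa> * ?k
      = (\<Sum>i\<in>UNIV. \<kappa> * ((ln (r i) + (1 + (m $ i)\<^sup>2) / r i - 1) / 2)
          - (ln (r i) + (y i + m $ i)\<^sup>2 / r i - (y i)\<^sup>2) / 4)"
      unfolding log_ratio_gauss_map[OF lo lohi V W T D r \<mu> \<nu>] gauss_kl_eq[OF lo lohi V T D r] m_def
      by (simp add: sum_subtractf sum_distrib_left sum_divide_distrib)
    then show "exp (- ?L (gauss_map R \<mu> (V ** T) y) / 2 + \<kappa> * ?k)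
      = (\<Prod>i\<in>UNIV. exp (\<kappa> * ((ln (r i) + (1 + (m $ i)\<^sup>2) / r i - 1) / 2))
      * exp (- ((ln (r i) + (y i + m $ i)\<^sup>2 / r i - (y i)\<^sup>2) / 4)))"
      by (simp add: exp_sum exp_add[symmetric])
  qed
  also have "\<dots> = (\<Prod>i\<in>UNIV. \<integral>\<^sup>+y. ennreal (std_normal_density y *
      (exp (\<kappa> * ((ln (r i) + (1 + (m $ i)\<^sup>2) / r i - 1) / 2))
      * exp (- ((ln (r i) + (y + m $ i)\<^sup>2 / r i - y\<^sup>2) / 4)))) \<partial>lborel)"
    by (rule nn_integral_std_gauss_prod) auto
  also have "\<dots> \<le> 1"
  proof (rule prod_le_1_ennreal)
    fix i :: 'n
    let ?c = "\<kappa> * ((ln (r i) + (1 + (m $ i)\<^sup>2) / r i - 1) / 2)"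
    have "(\<integral>\<^sup>+y. ennreal (std_normal_density y *
      (exp ?c * exp (- ((ln (r i) + (y + m $ i)\<^sup>2 / r i - y\<^sup>2) / 4)))) \<partial>lborel)
      = (\<integral>\<^sup>+y. ennreal (exp ?c) * ennreal (std_normal_density y * exp (- ((ln (r i) + (y + m $ i)\<^sup>2 / r i - y\<^sup>2) / 4))) \<partial>lborel)"
      by (simp add: ennreal_mult[symmetric] mult_ac)
    also have "\<dots> = ennreal (exp ?c) * ennreal (exp (- (h_fun (r i) + (m $ i)\<^sup>2 / (4 * (1 + r i)))))"
      by (subst nn_integral_cmult) (auto simp: normal_affinity[OF r])
    also have "\<dots> = ennreal (exp (?c - (h_fun (r i) + (m $ i)\<^sup>2 / (4 * (1 + r i)))))"
      by (simp add: ennreal_mult[symmetric] exp_add[symmetric])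
    also have "\<dots> \<le> 1" using \<kappa>[OF rb, of i "m $ i"] by simp
    finally show "(\<integral>\<^sup>+y. ennreal (std_normal_density y *
      (exp ?c * exp (- ((ln (r i) + (y + m $ i)\<^sup>2 / r i - y\<^sup>2) / 4)))) \<partial>lborel) \<le> 1" .
  qed
  finally show ?thesis by simp
qed

end

section \<open>Lipschitz and tail bounds\<close>

lemma g_fun_nonneg: "r > 0 \<Longrightarrow> 0 \<le> g_fun r"
  using ln_le_minus_one[of r] by (simp add: g_fun_def)

lemma h_fun_nonneg:
  assumes "r > 0"
  shows "0 \<le> h_fun r"
proof -
  have "0 \<le> (sqrt r - 1)\<^sup>2" by simp
  then have "2 * sqrt r \<le> 1 + r" using assms by (simp add: power2_diff)
  then have "1 \<le> (1 + r) / (2 * sqrt r)" using assms by simp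
  then show ?thesis unfolding h_fun_def by simp
qed

lemma h_fun_inverse: "r > 0 \<Longrightarrow> h_fun (1 / r) = h_fun r"
proof -
  assume r: "r > 0"
  have "(1 + 1 / r) / (2 * sqrt (1 / r)) = (1 + r) / r * sqrt r / 2"
    using r by (simp add: real_sqrt_divide field_simps)
  also have "\<dots> = (1 + r) / (2 * sqrt r)"
    using r by (simp add: field_simps) (metis less_imp_le mult.assoc real_sqrt_mult_self abs_of_pos)
  finally show ?thesis by (simp add: h_fun_def)
qed

lemma hg_ratio_nonneg: "r > 0 \<Longrightarrow> 0 \<le> hg_ratio r"
  by (simp add: hg_ratio_def g_fun_nonneg h_fun_nonneg)

context
  fixes p :: nat and b :: bounds
  assumes lo: "0 < v_minus p b" and lohi: "v_minus p b < v_plus p b"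
begin

lemma kappa_V_gt_1: "1 < kappa_V p b"
  using lo lohi by (simp add: kappa_V_def)

lemma kappa_interval_pos: "r \<in> {1 / kappa_V p b..kappa_V p b} \<Longrightarrow> 0 < r"
  using kappa_V_gt_1 by (smt (verit) atLeastAtMost_iff divide_pos_pos)

text \<open>All ratios are nonnegative, so the infimum is over a set bounded below and lies under
  each ratio. At r = 1, where the ratio is not a quotient, both sides of the claim vanish.\<close>

lemma kappa_Sigma_le:
  assumes r: "r \<in> {1 / kappa_V p b..kappa_V p b}"
  shows "kappa_Sigma p b * g_fun r \<le> h_fun r"
proof (cases "r = 1")
  case True
  then show ?thesis by (simp add: g_fun_def h_fun_def)
next
  case False
  have pos: "0 < r" by (rule kappa_interval_pos[OF r])
  have "g_fun r \<noteq> 0" using False ln_eq_minus_one[OF pos] by (auto simp: g_fun_def)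
  then have g: "0 < g_fun r" using g_fun_nonneg[OF pos] by simp
  have "bdd_below (hg_ratio ` {1 / kappa_V p b..kappa_V p b})"
    by (intro bdd_belowI2[where m = 0] hg_ratio_nonneg kappa_interval_pos)
  then have "kappa_Sigma p b \<le> hg_ratio r" unfolding kappa_Sigma_def using r by (rule cINF_lower)
  then have "kappa_Sigma p b * g_fun r \<le> hg_ratio r * g_fun r" using g by (intro mult_right_mono) auto
  then show ?thesis using False g by (simp add: hg_ratio_def)
qed

lemma kappa_B_nonneg: "0 \<le> kappa_B p b"
proof -
  have "0 \<le> kappa_Sigma p b"
    unfolding kappa_Sigma_def
  proof (rule cINF_greatest)
    show "{1 / kappa_V p b..kappa_V p b} \<noteq> {}"
      using kappa_V_gt_1 by (auto simp: divide_le_eq) (smt (verit) mult_less_cancel_left2)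
  qed (intro hg_ratio_nonneg kappa_interval_pos)
  then show ?thesis using lo lohi by (simp add: kappa_B_def kappa_mu_def)
qed

text \<open>
  With \<open>r\<close> and \<open>m\<close> the relative variance and the mean shift in one whitened coordinate, the
  bracket on the left is the divergence and the right-hand side is the Bhattacharyya distance.
\<close>

lemma kappa_B_comparison:
  assumes r: "v_minus p b / v_plus p b \<le> r" "r \<le> v_plus p b / v_minus p b"
  shows "kappa_B p b * ((ln r + (1 + m\<^sup>2) / r - 1) / 2) \<le> h_fun r + m\<^sup>2 / (4 * (1 + r))"
proof -
  have hi: "0 < v_plus p b" using lo lohi by simp
  have pos: "0 < r" using r(1) lo hi by (smt (verit) divide_pos_pos)
  \<comment> \<open>The variance part of the divergence is \<open>g_fun\<close> at 1 / r, while that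
    of the distance is \<open>h_fun r\<close>, which is invariant under inversion. The interval is
    invariant too, so \<open>kappa_Sigma_le\<close> is applied at 1 / r.\<close>
  have I: "1 / r \<in> {1 / kappa_V p b..kappa_V p b}"
  proof -
    have "1 / r \<le> 1 / (v_minus p b / v_plus p b)" using r(1) lo hi pos by (intro divide_left_mono) auto
    moreover have "1 / (v_plus p b / v_minus p b) \<le> 1 / r" using r(2) lo hi pos by (intro divide_left_mono) auto
    ultimately show ?thesis by (simp add: kappa_V_def)
  qed
  have "kappa_B p b * g_fun (1 / r) \<le> kappa_Sigma p b * g_fun (1 / r)"
    using g_fun_nonneg[of "1 / r"] pos by (intro mult_right_mono) (auto simp: kappa_B_def)
  also have "\<dots> \<le> h_fun r" using kappa_Sigma_le[OF I] h_fun_inverse[OF pos] by simp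
  finally have 1: "kappa_B p b * g_fun (1 / r) \<le> h_fun r" .
  have "kappa_B p b * (m\<^sup>2 / (2 * r)) \<le> kappa_mu p b * (m\<^sup>2 / (2 * r))"
    using pos by (intro mult_right_mono) (auto simp: kappa_B_def)
  also have "\<dots> \<le> m\<^sup>2 / (4 * (1 + r))"
  proof -
    \<comment> \<open>Both v_minus and v_minus r are at most v_plus r, the first by the lower bound
      on r. Adding them yields the factor 2, which accounts for the 4 in
      \<open>kappa_mu\<close>.\<close>
    have "v_minus p b \<le> v_plus p b * r" using r(1) hi by (simp add: field_simps)
    moreover have "v_minus p b * r \<le> v_plus p b * r" using lohi pos by (intro mult_right_mono) auto
    ultimately have "v_minus p b * (1 + r) \<le> 2 * v_plus p b * r"
      unfolding distrib_left mult_1_right by linarith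
    then have "v_minus p b / (4 * v_plus p b) / (2 * r) \<le> 1 / (4 * (1 + r))"
      using pos hi by (simp add: field_simps)
    from mult_right_mono[OF this, of "m\<^sup>2"] show ?thesis by (simp add: kappa_mu_def mult_ac)
  qed
  finally have "kappa_B p b * (g_fun (1 / r) + m\<^sup>2 / (2 * r)) \<le> h_fun r + m\<^sup>2 / (4 * (1 + r))"
    using 1 by (simp add: distrib_left)
  moreover have "g_fun (1 / r) + m\<^sup>2 / (2 * r) = (ln r + (1 + m\<^sup>2) / r - 1) / 2"
    using pos by (simp add: g_fun_def ln_div field_simps)
  ultimately show ?thesis by simp
qed

end

section \<open>Lipschitz dependence on mean and covariance, and Gaussian tails\<close>

lemma matrix_diff_ldistrib: "(A :: real^'n^'m) ** (B - C) = A ** B - A ** C"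
  by (simp add: matrix_matrix_mult_def vec_eq_iff right_diff_distrib sum_subtractf)

lemma measurable_norm_dev_vec: "(\<lambda>x. norm (dev_vec R \<mu> x)) \<in> borel_measurable (leb R)"
proof -
  have "(\<lambda>x. dev_vec R \<mu> x $ i) \<in> borel_measurable (leb R)" for i
    by (cases "i \<in> R") (auto simp: dev_vec_def)
  then show ?thesis unfolding norm_vec_def L2_set_def real_norm_def power2_abs by measurable
qed

text \<open>The restriction to the block keeps the padding out of the norm, so that radii of
  covariance sets depend on \<open>card R\<close> alone.\<close>

definition frob :: "'n set \<Rightarrow> real^'n^'n::finite \<Rightarrow> real" where
  "frob R M = L2_set (\<lambda>(i, j). M $ i $ j) (R \<times> R)"

lemma frob_nonneg: "0 \<le> frob R M"
  by (simp add: frob_def L2_set_nonneg)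

lemma frob_commute: "frob R (A - B) = frob R (B - A)"
  by (simp add: frob_def L2_set_def power2_commute case_prod_unfold)

lemma sum_abs_le_L2: "\<bar>\<Sum>i\<in>A. f i * g i\<bar> \<le> L2_set f A * L2_set g A"
proof -
  have "\<bar>\<Sum>i\<in>A. f i * g i\<bar> \<le> (\<Sum>i\<in>A. \<bar>f i\<bar> * \<bar>g i\<bar>)"
    by (rule order_trans[OF sum_abs]) (simp add: abs_mult)
  also have "\<dots> \<le> L2_set f A * L2_set g A" by (rule L2_set_mult_ineq)
  finally show ?thesis .
qed

lemma bilinear_frob:
  fixes u w :: "real^'n::finite"
  assumes u: "on R u = u" and w: "on R w = w"
  shows "\<bar>u \<bullet> (M *v w)\<bar> \<le> norm u * frob R M * norm w"
proof -
  have l: "L2_set (\<lambda>(i, j). u $ i * w $ j) (R \<times> R) \<le> norm u * norm w"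
  proof -
    have "L2_set (\<lambda>(i, j). u $ i * w $ j) (R \<times> R) = L2_set (($) u) R * L2_set (($) w) R"
      unfolding L2_set_def real_sqrt_mult[symmetric]
      by (simp add: sum.cartesian_product power_mult_distrib sum_product case_prod_unfold)
    also have "\<dots> \<le> norm u * norm w"
      unfolding norm_vec_def L2_set_def real_norm_def power2_abs
      by (intro mult_mono real_sqrt_le_mono sum_mono2) (auto intro!: sum_nonneg)
    finally show ?thesis .
  qed
  have "u \<bullet> (M *v w) = (\<Sum>i\<in>UNIV. \<Sum>j\<in>UNIV. u $ i * w $ j * M $ i $ j)"
    by (simp add: inner_vec_def matrix_vector_mult_def sum_distrib_left mult_ac)
  also have "\<dots> = (\<Sum>i\<in>R. \<Sum>j\<in>UNIV. u $ i * w $ j * M $ i $ j)"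
    using u by (intro sum.mono_neutral_right) (auto simp: on_eq_iff)
  also have "\<dots> = (\<Sum>i\<in>R. \<Sum>j\<in>R. u $ i * w $ j * M $ i $ j)"
    using w by (intro sum.cong refl sum.mono_neutral_right) (auto simp: on_eq_iff)
  also have "\<dots> = (\<Sum>x\<in>R \<times> R. (case x of (i, j) \<Rightarrow> u $ i * w $ j) * (case x of (i, j) \<Rightarrow> M $ i $ j))"
    by (simp add: sum.cartesian_product case_prod_unfold)
  finally have "\<bar>u \<bullet> (M *v w)\<bar> \<le> L2_set (\<lambda>(i, j). u $ i * w $ j) (R \<times> R) * frob R M"
    unfolding frob_def by (simp only: sum_abs_le_L2)
  also have "\<dots> \<le> (norm u * norm w) * frob R M"
    by (intro mult_right_mono l frob_nonneg)
  finally show ?thesis by (simp add: mult_ac)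
qed

lemma trace_frob:
  fixes M D :: "real^'n^'n"
  assumes D: "\<And>i j. i \<notin> R \<or> j \<notin> R \<Longrightarrow> D $ i $ j = 0" and sym: "transpose D = D"
  shows "\<bar>trace (M ** D)\<bar> \<le> frob R M * frob R D"
proof -
  have sw: "D $ j $ i = D $ i $ j" for i j
    using arg_cong[OF sym, of "\<lambda>M. M $ i $ j"] by (simp add: transpose_def)
  have "trace (M ** D) = (\<Sum>i\<in>UNIV. \<Sum>j\<in>UNIV. M $ i $ j * D $ i $ j)"
    by (simp add: trace_def matrix_matrix_mult_def sw)
  also have "\<dots> = (\<Sum>i\<in>R. \<Sum>j\<in>UNIV. M $ i $ j * D $ i $ j)"
    using D by (intro sum.mono_neutral_right) auto
  also have "\<dots> = (\<Sum>i\<in>R. \<Sum>j\<in>R. M $ i $ j * D $ i $ j)"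
    using D by (intro sum.cong refl sum.mono_neutral_right) auto
  also have "\<dots> = (\<Sum>x\<in>R \<times> R. (case x of (i, j) \<Rightarrow> M $ i $ j) * (case x of (i, j) \<Rightarrow> D $ i $ j))"
    by (simp add: sum.cartesian_product case_prod_unfold)
  finally show ?thesis unfolding frob_def by (simp only: sum_abs_le_L2)
qed

text \<open>Each column is the image of a unit vector supported on \<open>R\<close>, so its square
  norm is at most c squared; there are \<open>card R\<close> such columns.\<close>

lemma frob_le:
  fixes Q :: "real^'n^'n"
  assumes Q: "\<And>u. on R u = u \<Longrightarrow> norm (Q *v u) \<le> c * norm u" and c: "c \<ge> 0"
  shows "frob R Q \<le> sqrt (real (card R)) * c"
proof -
  have col: "(\<Sum>i\<in>R. (Q $ i $ j)\<^sup>2) \<le> c\<^sup>2" if "j \<in> R" for j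
  proof -
    have "norm (Q *v axis j 1) \<le> c * norm (axis j 1 :: real^'n)"
      using that by (intro Q) (auto simp: on_eq_iff axis_def)
    then have "(norm (column j Q))\<^sup>2 \<le> c\<^sup>2" using c by (simp add: matrix_vector_mult_basis norm_axis_1)
    moreover have "(norm (column j Q))\<^sup>2 = (\<Sum>i\<in>UNIV. (Q $ i $ j)\<^sup>2)"
      unfolding power2_norm_eq_inner by (simp add: inner_vec_def column_def power2_eq_square)
    moreover have "(\<Sum>i\<in>R. (Q $ i $ j)\<^sup>2) \<le> (\<Sum>i\<in>UNIV. (Q $ i $ j)\<^sup>2)"
      by (intro sum_mono2) auto
    ultimately show ?thesis by simp
  qed
  have "(\<Sum>x\<in>R \<times> R. (case x of (i, j) \<Rightarrow> Q $ i $ j)\<^sup>2) = (\<Sum>j\<in>R. \<Sum>i\<in>R. (Q $ i $ j)\<^sup>2)"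
    by (subst sum.swap) (simp add: sum.cartesian_product case_prod_unfold)
  also have "\<dots> \<le> (\<Sum>j\<in>R. c\<^sup>2)" by (intro sum_mono col)
  finally have "frob R Q \<le> sqrt (real (card R) * c\<^sup>2)"
    unfolding frob_def L2_set_def by (intro real_sqrt_le_mono) simp
  then show ?thesis using c by (simp add: real_sqrt_mult)
qed

lemma cov_class_diff:
  assumes "V \<in> cov_class R lo hi" "W \<in> cov_class R lo hi"
  shows "i \<notin> R \<or> j \<notin> R \<Longrightarrow> (V - W) $ i $ j = 0" "transpose (V - W) = V - W"
proof -
  show "(V - W) $ i $ j = 0" if "i \<notin> R \<or> j \<notin> R"
    using principal_entry[of R V i j] principal_entry[of R W i j] assms that by (simp add: cov_class_def)
  have "transpose (V - W) = transpose V - transpose W" by (simp add: transpose_def vec_eq_iff)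
  then show "transpose (V - W) = V - W" using assms by (simp add: cov_class_def)
qed

context
  fixes R :: "'n::finite set" and lo hi :: real
  assumes lo: "0 < lo" and lohi: "lo \<le> hi"
begin

lemma frob_inverse_le:
  assumes V: "V \<in> cov_class R lo hi"
  shows "frob R (matrix_inv V) \<le> sqrt (real CARD('n)) / lo"
proof -
  have "frob R (matrix_inv V) \<le> sqrt (real (card R)) * (1 / lo)"
    using cov_class_inverse_on(2)[OF lo lohi V] lo by (intro frob_le) auto
  also have "\<dots> \<le> sqrt (real CARD('n)) * (1 / lo)"
    using lo card_mono[of UNIV R] by (intro mult_right_mono real_sqrt_le_mono) auto
  finally show ?thesis by simp
qed

text \<open>The logarithm of the determinant is concave and lies below its tangent at V, which is
  the trace of the inverse of V times W - V. In relative eigenvalues this is ln r \<le> r - 1.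
  Exchanging V and W gives the two-sided bound.\<close>

lemma ln_det_diff_le:
  assumes V: "V \<in> cov_class R lo hi" and W: "W \<in> cov_class R lo hi"
  shows "ln (det W) - ln (det V) \<le> sqrt (real CARD('n)) / lo * frob R (W - V)"
proof -
  obtain T :: "real^'n^'n" and r where T: "transpose T ** V ** T = mat 1"
    and D: "transpose T ** W ** T = diag_mat r" and r': "\<forall>i. lo / hi \<le> r i \<and> r i \<le> hi / lo"
    using whitening[OF lo lohi V W] by blast
  have r: "0 < r i" for i using r' lo lohi by (smt (verit) divide_pos_pos)
  note sf = simultaneous_whitening_facts[OF lo lohi V T D r]
  have "ln (det W) - ln (det V) = (\<Sum>i\<in>UNIV. ln (r i))" unfolding sf(5) by simp
  also have "\<dots> \<le> (\<Sum>i\<in>UNIV. r i - 1)" by (intro sum_mono ln_le_minus_one r)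
  also have "\<dots> = trace (transpose T ** W ** T) - trace (transpose T ** V ** T)"
    unfolding D T by (simp add: trace_diag_mat sum_subtractf trace_I)
  also have "\<dots> = trace (matrix_inv V ** (W - V))"
  proof -
    have "trace (transpose T ** Q ** T) = trace (matrix_inv V ** Q)" for Q :: "real^'n^'n"
      unfolding whitening_facts(1)[OF lo lohi V T]
      using trace_mul_sym[of "transpose T ** Q" T] by (simp add: matrix_mul_assoc)
    then show ?thesis by (simp add: matrix_diff_ldistrib trace_sub)
  qed
  also have "\<dots> \<le> frob R (matrix_inv V) * frob R (W - V)"
    using trace_frob[OF cov_class_diff[OF W V], where R = R and M = "matrix_inv V"] by linarith
  also have "\<dots> \<le> sqrt (real CARD('n)) / lo * frob R (W - V)"
    by (intro mult_right_mono frob_inverse_le[OF V] frob_nonneg)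
  finally show ?thesis .
qed

lemma ln_det_lipschitz:
  assumes V: "V \<in> cov_class R lo hi" and W: "W \<in> cov_class R lo hi"
  shows "\<bar>ln (det V) - ln (det W)\<bar> \<le> sqrt (real CARD('n)) / lo * frob R (V - W)"
  using ln_det_diff_le[OF V W] ln_det_diff_le[OF W V] by (simp add: frob_commute[of R W V])

lemma quadratic_inverse_lipschitz:
  assumes V: "V \<in> cov_class R lo hi" and u: "on R u = u" and u': "on R u' = u'"
  shows "\<bar>u \<bullet> (matrix_inv V *v u) - u' \<bullet> (matrix_inv V *v u')\<bar> \<le> norm (u - u') * norm (u + u') / lo"
proof -
  have "u \<bullet> (matrix_inv V *v u) - u' \<bullet> (matrix_inv V *v u') = (u - u') \<bullet> (matrix_inv V *v (u + u'))"
    using inner_symmetric_matrix[OF cov_class_inverse(3)[OF lo lohi V], of u u']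
    by (simp add: matrix_vector_right_distrib inner_diff_left inner_add_right)
  also have "\<bar>\<dots>\<bar> \<le> norm (u - u') * norm (matrix_inv V *v (u + u'))"
    by (rule Cauchy_Schwarz_ineq2)
  also have "\<dots> \<le> norm (u - u') * (norm (u + u') / lo)"
    using u u' by (intro mult_left_mono cov_class_inverse_on(2)[OF lo lohi V]) (auto simp: on_eq_iff)
  finally show ?thesis by simp
qed

text \<open>The resolvent identity: the difference of the two inverses is the inverse of V times W -
  V times the inverse of W. Each inverse costs one factor 1 / lo.\<close>

lemma inverse_lipschitz:
  assumes V: "V \<in> cov_class R lo hi" and W: "W \<in> cov_class R lo hi" and u: "on R u = u"
  shows "\<bar>u \<bullet> (matrix_inv V *v u) - u \<bullet> (matrix_inv W *v u)\<bar> \<le> (norm u)\<^sup>2 / lo\<^sup>2 * frob R (V - W)"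
proof -
  let ?v = "matrix_inv V *v u" and ?w = "matrix_inv W *v u"
  have "V *v ?v = u" "W *v ?w = u"
    by (simp_all add: matrix_vector_mul_assoc cov_class_inverse[OF lo lohi V] cov_class_inverse[OF lo lohi W])
  then have "?v \<bullet> (W *v ?w) = u \<bullet> ?v" "?v \<bullet> (V *v ?w) = u \<bullet> ?w"
    using inner_symmetric_matrix[of V ?v ?w] V by (simp_all add: cov_class_def inner_commute)
  then have "u \<bullet> ?v - u \<bullet> ?w = ?v \<bullet> ((W - V) *v ?w)"
    by (simp add: matrix_vector_mult_diff_rdistrib inner_diff_right)
  also have "\<bar>\<dots>\<bar> \<le> norm ?v * frob R (W - V) * norm ?w"
    by (rule bilinear_frob[OF cov_class_inverse_on(1)[OF lo lohi V u] cov_class_inverse_on(1)[OF lo lohi W u]])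
  also have "\<dots> \<le> (norm u / lo) * frob R (W - V) * (norm u / lo)"
    by (intro mult_mono cov_class_inverse_on(2)[OF lo lohi V u] cov_class_inverse_on(2)[OF lo lohi W u]
        mult_nonneg_nonneg frob_nonneg order_refl) (use lo in auto)
  finally show ?thesis by (simp add: power2_eq_square frob_commute[of R W V] mult_ac)
qed

text \<open>The three terms of the constant come from moving the mean, the normalising determinant
  and the inverse covariance. With \<rho> = R + B_mu the constant is \<open>L_ell\<close>.\<close>

theorem ln_mvn_density_lipschitz:
  assumes V: "V \<in> cov_class R lo hi" and W: "W \<in> cov_class R lo hi"
    and \<rho>: "norm (dev_vec R \<mu> x) \<le> \<rho>" "norm (dev_vec R \<nu> x) \<le> \<rho>"
    and \<zeta>: "norm (on R \<mu> - on R \<nu>) \<le> \<zeta>" "frob R (V - W) \<le> \<zeta>"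
  shows "\<bar>ln (mvn_density R \<mu> V x) - ln (mvn_density R \<nu> W x)\<bar>
    \<le> (\<rho> / lo + (sqrt (real CARD('n)) / lo + \<rho>\<^sup>2 / lo\<^sup>2) / 2) * \<zeta>"
proof -
  let ?u = "dev_vec R \<mu> x" and ?w = "dev_vec R \<nu> x"
  have \<rho>0: "0 \<le> \<rho>" and \<zeta>0: "0 \<le> \<zeta>" using \<rho>(1) \<zeta>(1) norm_ge_zero order_trans by blast+
  have "norm (?u - ?w) = norm (on R \<nu> - on R \<mu>)"
    by (rule arg_cong[of _ _ norm]) (simp add: dev_vec_def vec_eq_iff)
  then have d: "norm (?u - ?w) \<le> \<zeta>" using \<zeta>(1) by (simp add: norm_minus_commute)
  have "\<bar>?u \<bullet> (matrix_inv V *v ?u) - ?w \<bullet> (matrix_inv V *v ?w)\<bar> \<le> norm (?u - ?w) * norm (?u + ?w) / lo"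
    by (rule quadratic_inverse_lipschitz[OF V]) auto
  also have "\<dots> \<le> \<zeta> * (2 * \<rho>) / lo"
    using d \<rho> lo \<zeta>0 norm_triangle_ineq[of ?u ?w] by (intro divide_right_mono mult_mono) auto
  finally have 1: "\<bar>?u \<bullet> (matrix_inv V *v ?u) - ?w \<bullet> (matrix_inv V *v ?w)\<bar> \<le> 2 * (\<rho> / lo * \<zeta>)" by (simp add: mult_ac)
  have "\<bar>?w \<bullet> (matrix_inv V *v ?w) - ?w \<bullet> (matrix_inv W *v ?w)\<bar> \<le> (norm ?w)\<^sup>2 / lo\<^sup>2 * frob R (V - W)"
    by (rule inverse_lipschitz[OF V W]) simp
  also have "\<dots> \<le> \<rho>\<^sup>2 / lo\<^sup>2 * \<zeta>"
    using \<rho> \<zeta> \<rho>0 lo by (intro mult_mono divide_right_mono power_mono frob_nonneg) auto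
  finally have 2: "\<bar>?w \<bullet> (matrix_inv V *v ?w) - ?w \<bullet> (matrix_inv W *v ?w)\<bar> \<le> \<rho>\<^sup>2 / lo\<^sup>2 * \<zeta>" .
  have "\<bar>ln (det V) - ln (det W)\<bar> \<le> sqrt (real CARD('n)) / lo * frob R (V - W)"
    by (rule ln_det_lipschitz[OF V W])
  also have "\<dots> \<le> sqrt (real CARD('n)) / lo * \<zeta>"
    using \<zeta>(2) lo by (intro mult_left_mono) auto
  finally have 3: "\<bar>ln (det V) - ln (det W)\<bar> \<le> sqrt (real CARD('n)) / lo * \<zeta>" .
  have eq: "(\<rho> / lo + (sqrt (real CARD('n)) / lo + \<rho>\<^sup>2 / lo\<^sup>2) / 2) * \<zeta>
    = \<rho> / lo * \<zeta> + (sqrt (real CARD('n)) / lo * \<zeta> + \<rho>\<^sup>2 / lo\<^sup>2 * \<zeta>) / 2"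
    by (simp add: algebra_simps add_divide_distrib)
  have lin: "\<bar>- q / 2 - (k + d) / 2 - (- q'' / 2 - (k + d') / 2)\<bar> \<le> X + (Y + Z) / 2"
    if "\<bar>q - q'\<bar> \<le> 2 * X" "\<bar>q' - q''\<bar> \<le> Z" "\<bar>d - d'\<bar> \<le> Y" for q q' q'' k d d' X Y Z :: real
    using that unfolding abs_le_iff by (auto simp: field_simps)
  show ?thesis
    unfolding eq ln_mvn_density[OF lo lohi V] ln_mvn_density[OF lo lohi W] by (rule lin[OF 1 2 3])
qed

text \<open>Only the first law moves, the second being the true one. Trace and log-determinant each
  cost sqrt p / lo, and the shift term costs 4 B / lo as a difference of squares; the outer factor
  1/2 leaves \<open>L_KL\<close>.\<close>

theorem gauss_kl_lipschitz:
  assumes V: "V \<in> cov_class R lo hi" and V': "V' \<in> cov_class R lo hi" and W: "W \<in> cov_class R lo hi"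
    and on: "on R \<mu> = \<mu>" "on R \<mu>' = \<mu>'" "on R \<nu> = \<nu>"
    and B: "norm \<mu> \<le> B" "norm \<mu>' \<le> B" "norm \<nu> \<le> B"
    and \<zeta>: "norm (\<mu> - \<mu>') \<le> \<zeta>" "frob R (V - V') \<le> \<zeta>"
  shows "\<bar>gauss_kl \<mu> V \<nu> W - gauss_kl \<mu>' V' \<nu> W\<bar> \<le> (2 * B + sqrt (real CARD('n))) / lo * \<zeta>"
proof -
  have \<zeta>0: "0 \<le> \<zeta>" using \<zeta>(1) norm_ge_zero order_trans by blast
  have "trace (matrix_inv W ** V) - trace (matrix_inv W ** V') = trace (matrix_inv W ** (V - V'))"
    by (simp add: matrix_diff_ldistrib trace_sub)
  also have "\<bar>\<dots>\<bar> \<le> frob R (matrix_inv W) * frob R (V - V')"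
    by (rule trace_frob[OF cov_class_diff[OF V V']])
  also have "\<dots> \<le> sqrt (real CARD('n)) / lo * \<zeta>"
    using frob_inverse_le[OF W] \<zeta>(2) lo by (intro mult_mono frob_nonneg) auto
  finally have 1: "\<bar>trace (matrix_inv W ** V) - trace (matrix_inv W ** V')\<bar> \<le> sqrt (real CARD('n)) / lo * \<zeta>" .
  have "\<bar>ln (det V) - ln (det V')\<bar> \<le> sqrt (real CARD('n)) / lo * frob R (V - V')"
    by (rule ln_det_lipschitz[OF V V'])
  also have "\<dots> \<le> sqrt (real CARD('n)) / lo * \<zeta>"
    using \<zeta>(2) lo by (intro mult_left_mono) auto
  finally have 2: "\<bar>ln (det V) - ln (det V')\<bar> \<le> sqrt (real CARD('n)) / lo * \<zeta>" .
  let ?u = "\<mu> - \<nu>" and ?w = "\<mu>' - \<nu>"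
  have "\<bar>?u \<bullet> (matrix_inv W *v ?u) - ?w \<bullet> (matrix_inv W *v ?w)\<bar> \<le> norm (?u - ?w) * norm (?u + ?w) / lo"
    using on by (intro quadratic_inverse_lipschitz[OF W]) (simp_all add: on_diff)
  also have "\<dots> \<le> \<zeta> * (4 * B) / lo"
  proof -
    have "norm (?u + ?w) \<le> norm ?u + norm ?w" by (rule norm_triangle_ineq)
    also have "\<dots> \<le> (norm \<mu> + norm \<nu>) + (norm \<mu>' + norm \<nu>)" by (intro add_mono norm_triangle_ineq4)
    finally have "norm (?u + ?w) \<le> 4 * B" using B by linarith
    then show ?thesis using \<zeta>(1) lo \<zeta>0 by (intro divide_right_mono mult_mono) auto
  qed
  finally have 3: "\<bar>?u \<bullet> (matrix_inv W *v ?u) - ?w \<bullet> (matrix_inv W *v ?w)\<bar> \<le> 4 * (B / lo * \<zeta>)"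
    by (simp add: mult_ac)
  have eq: "(2 * B + sqrt (real CARD('n))) / lo * \<zeta> = 2 * (B / lo * \<zeta>) + sqrt (real CARD('n)) / lo * \<zeta>"
    by (simp add: algebra_simps add_divide_distrib)
  have lin: "\<bar>(t - n + k - d + q) / 2 - (t' - n + k - d' + q') / 2\<bar> \<le> 2 * X + Y"
    if "\<bar>t - t'\<bar> \<le> Y" "\<bar>d - d'\<bar> \<le> Y" "\<bar>q - q'\<bar> \<le> 4 * X" for t t' n k d d' q q' X Y :: real
    using that unfolding abs_le_iff by (auto simp: field_simps)
  show ?thesis unfolding eq gauss_kl_def by (rule lin[OF 1 2 3])
qed

text \<open>Discarding the coordinates off \<open>R\<close> can only lower the inverse form, which
  equals the sum of squares of y before. Then V V \<le> hi V, applied at the preimage under V of the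
  deviation, converts that form into the norm.\<close>

lemma gauss_map_dev_bound:
  fixes y :: "'n \<Rightarrow> real"
  assumes V: "V \<in> cov_class R lo hi" and T: "transpose T ** V ** T = mat 1"
  shows "(norm (dev_vec R \<mu> (gauss_map R \<mu> (V ** T) y)))\<^sup>2 \<le> hi * (\<Sum>i\<in>UNIV. (y i)\<^sup>2)"
proof -
  define z where "z = (V ** T) *v (\<chi> i. y i)"
  have d: "dev_vec R \<mu> (gauss_map R \<mu> (V ** T) y) = on R z"
    by (auto simp: dev_vec_def gauss_map_def vec_eq_iff z_def mat_app_vec)
  let ?w = "matrix_inv V *v on R z"
  have w: "on R ?w = ?w" "V *v ?w = on R z"
    using cov_class_inverse_on(1)[OF lo lohi V, of "on R z"]
    by (simp_all add: matrix_vector_mul_assoc cov_class_inverse[OF lo lohi V])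
  have "on R z \<bullet> ?w \<le> (\<Sum>i\<in>UNIV. (y i)\<^sup>2)"
    using block_form[OF cov_class_inverse_principal[OF lo lohi V], of z] sum_nonneg[of "-R" "\<lambda>i. (z $ i)\<^sup>2"]
      whitening_quadratic[OF lo lohi V T, of y, folded z_def] by simp
  then have "hi * (?w \<bullet> on R z) \<le> hi * (\<Sum>i\<in>UNIV. (y i)\<^sup>2)"
    using lo lohi by (intro mult_left_mono) (auto simp: inner_commute)
  then show ?thesis
    unfolding d power2_norm_eq_inner using cov_class_norm_square[OF lo lohi V w(1)] w(2) by simp
qed

text \<open>
  Chernoff's method; the rate \<open>l\<close> is the optimal one for the threshold \<open>p (1 + u)\<^sup>2\<close>.
\<close>

theorem mvn_tail:
  assumes V: "V \<in> cov_class R lo hi" and \<mu>: "on R \<mu> = \<mu>" and z: "0 \<le> z"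
  shows "emeasure (mvn R \<mu> V) {x \<in> space (leb R).
    sqrt hi * (sqrt (real CARD('n)) + sqrt (2 * z)) < norm (dev_vec R \<mu> x)} \<le> ennreal (exp (- z))"
proof -
  obtain T :: "real^'n^'n" where T: "transpose T ** V ** T = mat 1" using whitening_self[OF lo lohi V] .
  let ?p = "real CARD('n)"
  have p: "?p > 0" by simp
  define u where "u = sqrt (2 * z / ?p)"
  have u: "0 \<le> u" "u\<^sup>2 = 2 * z / ?p" using z by (auto simp: u_def)
  define l where "l = (1 - 1 / (1 + u)\<^sup>2) / 2"
  have l: "0 \<le> l" "l < 1 / 2" "1 - 2 * l = 1 / (1 + u)\<^sup>2"
    using u(1) by (auto simp: l_def divide_le_eq diff_divide_distrib)
  have e: "1 / sqrt (1 - 2 * l) = 1 + u"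
    unfolding l(3) using u(1) by (simp add: real_sqrt_divide)
  have s: "sqrt ?p + sqrt (2 * z) = sqrt ?p * (1 + u)"
    by (simp add: u_def real_sqrt_divide distrib_left)
  let ?A = "{x \<in> space (leb R). sqrt hi * (sqrt ?p + sqrt (2 * z)) < norm (dev_vec R \<mu> x)}"
  note [measurable] = measurable_norm_dev_vec
  have A: "?A \<in> sets (leb R)" by measurable
  have "emeasure (mvn R \<mu> V) ?A = (\<integral>\<^sup>+x. ennreal (mvn_density R \<mu> V x) * indicator ?A x \<partial>leb R)"
    unfolding mvn_def using A by (subst emeasure_density) auto
  also have "\<dots> = (\<integral>\<^sup>+y. indicator ?A (gauss_map R \<mu> (V ** T) y) \<partial>std_gauss)"
    by (rule nn_integral_gauss[OF lo lohi V T \<mu>]) (use A in auto)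
  also have "\<dots> \<le> (\<integral>\<^sup>+y. ennreal (\<Prod>i\<in>(UNIV::'n set). exp (- l * (1 + u)\<^sup>2) * exp (l * (y i)\<^sup>2)) \<partial>std_gauss)"
  proof (rule nn_integral_mono)
    fix y :: "'n \<Rightarrow> real"
    have pr: "(\<Prod>i\<in>(UNIV::'n set). exp (- l * (1 + u)\<^sup>2) * exp (l * (y i)\<^sup>2))
        = exp (l * ((\<Sum>i\<in>UNIV. (y i)\<^sup>2) - ?p * (1 + u)\<^sup>2))"
      by (simp add: mult_exp_exp exp_sum[symmetric] sum.distrib sum_subtractf sum_distrib_left algebra_simps)
    show "indicator ?A (gauss_map R \<mu> (V ** T) y)
      \<le> ennreal (\<Prod>i\<in>(UNIV::'n set). exp (- l * (1 + u)\<^sup>2) * exp (l * (y i)\<^sup>2))"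
    proof (cases "gauss_map R \<mu> (V ** T) y \<in> ?A")
      case True
      then have "sqrt hi * (sqrt ?p * (1 + u)) < norm (dev_vec R \<mu> (gauss_map R \<mu> (V ** T) y))"
        unfolding s by simp
      then have "(sqrt hi * (sqrt ?p * (1 + u)))\<^sup>2 \<le> (norm (dev_vec R \<mu> (gauss_map R \<mu> (V ** T) y)))\<^sup>2"
        using u lo lohi by (intro power_mono) auto
      also have "\<dots> \<le> hi * (\<Sum>i\<in>UNIV. (y i)\<^sup>2)" by (rule gauss_map_dev_bound[OF V T])
      finally have "hi * (?p * (1 + u)\<^sup>2) \<le> hi * (\<Sum>i\<in>UNIV. (y i)\<^sup>2)"
        using lo lohi by (simp add: power_mult_distrib)
      then have "?p * (1 + u)\<^sup>2 \<le> (\<Sum>i\<in>UNIV. (y i)\<^sup>2)" using lo lohi by simp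
      then show ?thesis unfolding pr using l(1) True by (simp add: indicator_def)
    next
      case False
      then have "indicator ?A (gauss_map R \<mu> (V ** T) y) = (0 :: ennreal)" by (rule indicator_simps(2))
      then show ?thesis by (simp only: zero_le)
    qed
  qed
  also have "\<dots> = (\<Prod>i\<in>(UNIV::'n set). \<integral>\<^sup>+y. ennreal (std_normal_density y * (exp (- l * (1 + u)\<^sup>2) * exp (l * y\<^sup>2))) \<partial>lborel)"
    by (rule nn_integral_std_gauss_prod) auto
  also have "(\<integral>\<^sup>+y. ennreal (std_normal_density y * (exp (- l * (1 + u)\<^sup>2) * exp (l * y\<^sup>2))) \<partial>lborel)
      = (\<integral>\<^sup>+y. ennreal (exp (- l * (1 + u)\<^sup>2)) * ennreal (std_normal_density y * exp (l * y\<^sup>2)) \<partial>lborel)"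
    by (simp add: ennreal_mult[symmetric] mult_ac)
  also have "\<dots> = ennreal (exp (- l * (1 + u)\<^sup>2)) * ennreal (1 / sqrt (1 - 2 * l))"
    by (subst nn_integral_cmult) (auto simp: normal_square_mgf[OF l(2)])
  also have "\<dots> = ennreal (exp (- l * (1 + u)\<^sup>2) * (1 + u))"
    unfolding e using u(1) by (intro ennreal_mult[symmetric]) auto
  also have "(\<Prod>i\<in>(UNIV::'n set). ennreal (exp (- l * (1 + u)\<^sup>2) * (1 + u)))
      = ennreal ((exp (- l * (1 + u)\<^sup>2) * (1 + u)) ^ CARD('n))"
    using u(1) by (simp add: ennreal_power)
  also have "\<dots> \<le> ennreal (exp (- (z / ?p)) ^ CARD('n))"
  proof (intro ennreal_leI power_mono)
    have lq: "l * (1 + u)\<^sup>2 = ((1 + u)\<^sup>2 - 1) / 2"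
      using u(1) by (simp add: l_def field_simps)
    \<comment> \<open>The exponent splits as u + z / p. The part u absorbs the factor 1 + u \<le>
      exp u from the moment generating function, and z / p per coordinate remains.\<close>
    have lu: "l * (1 + u)\<^sup>2 = u + z / ?p" unfolding lq by (simp add: power2_sum u(2) add_divide_distrib)
    have "exp (- l * (1 + u)\<^sup>2) * (1 + u) \<le> exp (- l * (1 + u)\<^sup>2) * exp u"
      by (intro mult_left_mono exp_ge_add_one_self) auto
    also have "\<dots> = exp (- (z / ?p))" using lu by (simp add: mult_exp_exp)
    finally show "exp (- l * (1 + u)\<^sup>2) * (1 + u) \<le> exp (- (z / ?p))" .
  qed (use u in auto)
  also have "exp (- (z / ?p)) ^ CARD('n) = exp (- z)"
    using p by (simp add: exp_of_nat_mult[symmetric])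
  finally show ?thesis .
qed

end

section \<open>Covering the parameter space\<close>

lemma emeasure_ball_PiM:
  fixes c :: "'i \<Rightarrow> real"
  assumes I: "finite I" and r: "r > 0"
  shows "emeasure (leb I) {f \<in> space (leb I). L2_set (\<lambda>i. f i - c i) I \<le> r}
    = ennreal (unit_ball_vol (real (card I)) * r ^ card I)"
proof -
  let ?t = "\<lambda>f. \<lambda>i\<in>I. f i - c i"
  have t [measurable]: "?t \<in> measurable (leb I) (leb I)"
    by (rule measurable_restrict) simp
  have "distr (leb I) (leb I) ?t = leb I"
  proof (rule leb.PiM_eqI[OF I])
    fix A :: "'i \<Rightarrow> real set" assume A: "\<And>i. i \<in> I \<Longrightarrow> A i \<in> sets lborel"
    have "?t -` Pi\<^sub>E I A \<inter> space (leb I) = Pi\<^sub>E I (\<lambda>i. (+) (- c i) -` A i)"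
      by (auto simp: space_PiM PiE_iff)
    moreover have m: "(+) (- c i) -` A i \<in> sets lborel" if "i \<in> I" for i
      using A[OF that] measurable_sets[of "(+) (- c i)" borel borel "A i"] by simp
    ultimately have "emeasure (distr (leb I) (leb I) ?t) (Pi\<^sub>E I A)
        = (\<Prod>i\<in>I. emeasure lborel ((+) (- c i) -` A i))"
      using A I by (subst emeasure_distr[OF t]) (auto intro!: sets_PiM_I_finite leb.emeasure_PiM)
    also have "\<dots> = (\<Prod>i\<in>I. emeasure lborel (A i))"
    proof (intro prod.cong refl)
      fix i assume "i \<in> I"
      then have "emeasure (distr lborel borel ((+) (- c i))) (A i) = emeasure lborel ((+) (- c i) -` A i)"
        using A by (subst emeasure_distr) auto
      then show "emeasure lborel ((+) (- c i) -` A i) = emeasure lborel (A i)"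
        by (simp add: lborel_distr_plus)
    qed
    finally show "emeasure (distr (leb I) (leb I) ?t) (Pi\<^sub>E I A) = (\<Prod>i\<in>I. emeasure lborel (A i))" .
  qed simp
  then have "emeasure (leb I) ({f. sqrt (\<Sum>i\<in>I. (f i)\<^sup>2) \<le> r} \<inter> space (leb I))
    = emeasure (distr (leb I) (leb I) ?t) ({f. sqrt (\<Sum>i\<in>I. (f i)\<^sup>2) \<le> r} \<inter> space (leb I))" by simp
  also have "\<dots> = emeasure (leb I) (?t -` ({f. sqrt (\<Sum>i\<in>I. (f i)\<^sup>2) \<le> r} \<inter> space (leb I)) \<inter> space (leb I))"
    by (rule emeasure_distr[OF t]) measurable
  also have "?t -` ({f. sqrt (\<Sum>i\<in>I. (f i)\<^sup>2) \<le> r} \<inter> space (leb I)) \<inter> space (leb I)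
      = {f \<in> space (leb I). L2_set (\<lambda>i. f i - c i) I \<le> r}"
    by (auto simp: L2_set_def space_PiM)
  finally show ?thesis using emeasure_cball_aux[OF I r] by simp
qed

lemma L2_set_diff_triangle:
  "L2_set (\<lambda>i. f i - h i) I \<le> L2_set (\<lambda>i. f i - g i) I + L2_set (\<lambda>i. g i - h i) I"
  using L2_set_triangle_ineq[of "\<lambda>i. f i - g i" "\<lambda>i. g i - h i" I] by simp

lemma L2_set_diff_commute: "L2_set (\<lambda>i. f i - g i) I = L2_set (\<lambda>i. g i - f i) I"
  by (simp add: L2_set_def power2_commute)

text \<open>Volume packing: the balls of radius \<delta> / 2 about the separated points are disjoint
  and lie in the ball of radius r + \<delta> / 2, so the ratio of volumes bounds their
  number.\<close>

lemma separated_card_le: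
  fixes v :: "'x \<Rightarrow> 'i \<Rightarrow> real"
  assumes I: "finite I" and S: "finite S" and \<delta>: "\<delta> > 0" and r: "r \<ge> 0"
    and bd: "\<And>x. x \<in> S \<Longrightarrow> L2_set (v x) I \<le> r"
    and sep: "\<And>x y. x \<in> S \<Longrightarrow> y \<in> S \<Longrightarrow> x \<noteq> y \<Longrightarrow> \<delta> < L2_set (\<lambda>i. v x i - v y i) I"
  shows "real (card S) \<le> (1 + 2 * r / \<delta>) ^ card I"
proof -
  let ?B = "\<lambda>c r. {f \<in> space (leb I). L2_set (\<lambda>i. f i - c i) I \<le> r}"
  let ?u = "unit_ball_vol (real (card I))" and ?n = "card I"
  have meas: "?B c r \<in> sets (leb I)" for c r unfolding L2_set_def by measurable
  have disj: "disjoint_family_on (\<lambda>x. ?B (v x) (\<delta> / 2)) S"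
    unfolding disjoint_family_on_def
  proof (intro ballI impI)
    fix x y assume xy: "x \<in> S" "y \<in> S" "x \<noteq> y"
    have False if "f \<in> ?B (v x) (\<delta> / 2)" "f \<in> ?B (v y) (\<delta> / 2)" for f
      using that sep[OF xy] L2_set_diff_triangle[of "v x" "v y" I f] L2_set_diff_commute[of "v x" f I] by simp
    then show "?B (v x) (\<delta> / 2) \<inter> ?B (v y) (\<delta> / 2) = {}" by blast
  qed
  have sub: "(\<Union>x\<in>S. ?B (v x) (\<delta> / 2)) \<subseteq> ?B (\<lambda>_. 0) (r + \<delta> / 2)"
  proof
    fix f assume "f \<in> (\<Union>x\<in>S. ?B (v x) (\<delta> / 2))"
    then obtain x where x: "x \<in> S" "f \<in> ?B (v x) (\<delta> / 2)" by blast
    then show "f \<in> ?B (\<lambda>_. 0) (r + \<delta> / 2)"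
      using L2_set_diff_triangle[of f "\<lambda>_. 0" I "v x"] bd[OF x(1)] by simp
  qed
  have ball: "emeasure (leb I) (?B (v x) (\<delta> / 2)) = ennreal (?u * (\<delta> / 2) ^ ?n)" for x
    by (rule emeasure_ball_PiM[OF I]) (use \<delta> in simp)
  have "ennreal (real (card S) * (?u * (\<delta> / 2) ^ ?n)) = (\<Sum>x\<in>S. emeasure (leb I) (?B (v x) (\<delta> / 2)))"
    unfolding ball using \<delta> by (simp add: ennreal_mult ennreal_of_nat_eq_real_of_nat)
  also have "\<dots> = emeasure (leb I) (\<Union>x\<in>S. ?B (v x) (\<delta> / 2))"
    by (rule sum_emeasure[OF _ disj S]) (use meas in blast)
  also have "\<dots> \<le> emeasure (leb I) (?B (\<lambda>_. 0) (r + \<delta> / 2))"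
    by (rule emeasure_mono[OF sub meas])
  also have "\<dots> = ennreal (?u * (r + \<delta> / 2) ^ ?n)"
    using \<delta> r by (intro emeasure_ball_PiM I) auto
  finally have "real (card S) * (?u * (\<delta> / 2) ^ ?n) \<le> ?u * (r + \<delta> / 2) ^ ?n"
    using \<delta> r by (simp add: ennreal_le_iff)
  then have "?u * (real (card S) * (\<delta> / 2) ^ ?n) \<le> ?u * (r + \<delta> / 2) ^ ?n"
    by (simp only: mult_ac)
  then have "real (card S) * (\<delta> / 2) ^ ?n \<le> (r + \<delta> / 2) ^ ?n" by simp
  then have "real (card S) \<le> (r + \<delta> / 2) ^ ?n / (\<delta> / 2) ^ ?n" using \<delta> by (simp add: pos_le_divide_eq)
  also have "\<dots> = (1 + 2 * r / \<delta>) ^ ?n"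
    unfolding power_divide[symmetric] using \<delta> by (simp add: add_divide_distrib mult.commute add.commute)
  finally show ?thesis .
qed

text \<open>The map \<open>c\<close> rounds to a maximal \<open>\<delta>\<close>-separated subset.\<close>

lemma quantizer_exists:
  fixes v :: "'x \<Rightarrow> 'i \<Rightarrow> real"
  assumes I: "finite I" and \<delta>: "\<delta> > 0" and r: "r \<ge> 0"
    and bd: "\<And>x. x \<in> X \<Longrightarrow> L2_set (v x) I \<le> r"
  obtains c where "\<And>x. x \<in> X \<Longrightarrow> L2_set (\<lambda>i. v x i - v (c x) i) I \<le> \<delta>"
    "finite (c ` X)" "real (card (c ` X)) \<le> (1 + 2 * r / \<delta>) ^ card I"
proof -
  define P where "P S \<longleftrightarrow> finite S \<and> S \<subseteq> X \<and>
    (\<forall>x\<in>S. \<forall>y\<in>S. x \<noteq> y \<longrightarrow> \<delta> < L2_set (\<lambda>i. v x i - v y i) I)" for S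
  have le: "real (card S) \<le> (1 + 2 * r / \<delta>) ^ card I" if "P S" for S
    using that bd unfolding P_def by (intro separated_card_le[OF I _ \<delta> r]) auto
  have "P {}" by (simp add: P_def)
  \<comment> \<open>The packing bound caps the cardinality, so a separated set of greatest
    cardinality exists; a point far from all its members could be added to it.\<close>
  moreover have "\<forall>S. P S \<longrightarrow> card S < Suc (nat \<lfloor>(1 + 2 * r / \<delta>) ^ card I\<rfloor>)"
    using le by (auto simp: less_Suc_eq_le le_nat_floor)
  ultimately obtain S where S: "P S" "\<And>S'. P S' \<Longrightarrow> card S' \<le> card S"
    using ex_has_greatest_nat[of P "{}" card] by blast
  have ex: "\<exists>y\<in>S. L2_set (\<lambda>i. v x i - v y i) I \<le> \<delta>" if x: "x \<in> X" for x
  proof (rule ccontr)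
    assume *: "\<not> ?thesis"
    then have far: "\<delta> < L2_set (\<lambda>i. v x i - v y i) I" if "y \<in> S" for y using that by auto
    have "x \<notin> S" using far[of x] \<delta> by (auto simp: L2_set_def)
    moreover have "P (insert x S)"
    proof -
      have "\<delta> < L2_set (\<lambda>i. v y i - v x i) I" if "y \<in> S" for y
        using far[OF that] by (subst L2_set_diff_commute)
      then show ?thesis using S(1) x far unfolding P_def by blast
    qed
    ultimately show False using S(2)[of "insert x S"] S(1) by (simp add: P_def)
  qed
  define c where "c x = (SOME y. y \<in> S \<and> L2_set (\<lambda>i. v x i - v y i) I \<le> \<delta>)" for x
  have c: "c x \<in> S \<and> L2_set (\<lambda>i. v x i - v (c x) i) I \<le> \<delta>" if "x \<in> X" for x
    unfolding c_def by (rule someI_ex) (use ex[OF that] in blast)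
  have sub: "c ` X \<subseteq> S" and fin: "finite S" using c S(1) by (auto simp: P_def)
  show ?thesis
  proof (rule that)
    show "finite (c ` X)" using sub fin by (rule finite_subset)
    show "real (card (c ` X)) \<le> (1 + 2 * r / \<delta>) ^ card I"
      using card_mono[OF fin sub] le[OF S(1)] by linarith
  qed (use c in auto)
qed

text \<open>Each \<open>c a\<close> rounds to its own centres, and a tuple of centres need not come
  from one point of \<open>X\<close>. Hence one point of \<open>X\<close> is kept for every tuple
  that occurs. A point and its representative share all centres, so later distances pass through a
  centre and double.\<close>

lemma joint_quantizer:
  assumes A: "finite A" and c: "\<And>a. a \<in> A \<Longrightarrow> finite (c a ` X)"
  obtains Z where "Z \<subseteq> X" "finite Z" "card Z \<le> (\<Prod>a\<in>A. card (c a ` X))"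
    "\<forall>x\<in>X. \<exists>z\<in>Z. \<forall>a\<in>A. c a x = c a z"
proof -
  define g where "g x = (\<lambda>a\<in>A. c a x)" for x
  have sub: "g ` X \<subseteq> Pi\<^sub>E A (\<lambda>a. c a ` X)" by (auto simp: g_def)
  have fP: "finite (Pi\<^sub>E A (\<lambda>a. c a ` X))" using A c by (rule finite_PiE)
  then have fin: "finite (g ` X)" using sub by (rule rev_finite_subset)
  have "card (g ` X) \<le> card (Pi\<^sub>E A (\<lambda>a. c a ` X))" by (rule card_mono[OF fP sub])
  then have card: "card (g ` X) \<le> (\<Prod>a\<in>A. card (c a ` X))" by (simp add: card_PiE A)
  show ?thesis
  proof (rule that)
    show "inv_into X g ` (g ` X) \<subseteq> X" by (auto intro: inv_into_into)
    show "finite (inv_into X g ` (g ` X))" using fin by simp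
    show "card (inv_into X g ` (g ` X)) \<le> (\<Prod>a\<in>A. card (c a ` X))"
      using card_image_le[OF fin, of "inv_into X g"] card by linarith
    show "\<forall>x\<in>X. \<exists>z\<in>inv_into X g ` (g ` X). \<forall>a\<in>A. c a x = c a z"
    proof
      fix x assume x: "x \<in> X"
      have "g (inv_into X g (g x)) = g x" using x by (intro f_inv_into_f) auto
      then have "c a x = c a (inv_into X g (g x))" if "a \<in> A" for a
        using that by (metis g_def restrict_apply')
      then show "\<exists>z\<in>inv_into X g ` (g ` X). \<forall>a\<in>A. c a x = c a z" using x by blast
    qed
  qed
qed

section \<open>Symmetric matrices by their upper triangle, and the net of parameters\<close>

lemma finite_actions: "finite (actions :: 'p::finite action set)"
proof -
  have eq: "(actions :: 'p action set) = insert Observe ((\<lambda>(j, s). Do j s) ` (UNIV \<times> {1, 2}))"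
    by (auto simp: actions_def)
  show ?thesis by (subst eq) simp
qed

lemma d_act_eq: "a \<in> actions \<Longrightarrow> d_act a = card (coords a)"
  for a :: "'p::finite action"
  by (cases a) (auto simp: card_Diff_singleton)

text \<open>\<open>to_nat_on\<close> merely supplies a linear order on the node type.\<close>

definition upper_pairs :: "('p::finite) set \<Rightarrow> ('p \<times> 'p) set" where
  "upper_pairs R = {(i, j). i \<in> R \<and> j \<in> R \<and> to_nat_on UNIV i \<le> to_nat_on UNIV j}"

lemma to_nat_on_finite_eq: "to_nat_on UNIV (i :: 'p::finite) = to_nat_on UNIV j \<longleftrightarrow> i = j"
  using inj_on_to_nat_on[of "UNIV :: 'p set"] by (auto simp: countable_finite dest: injD)

lemma upper_pairs_converse: "(upper_pairs R)\<inverse> = prod.swap ` upper_pairs R"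
  by force

lemma card_upper_pairs: "card (upper_pairs R) = card R * (card R + 1) div 2"
  for R :: "'p::finite set"
proof -
  let ?U = "upper_pairs R"
  have un: "?U \<union> ?U\<inverse> = R \<times> R" by (auto simp: upper_pairs_def)
  have int: "?U \<inter> ?U\<inverse> = Id_on R"
    by (auto simp: upper_pairs_def intro: to_nat_on_finite_eq[THEN iffD1] antisym)
  have "card (Id_on R) = card R"
  proof -
    have "Id_on R = (\<lambda>x. (x, x)) ` R" by auto
    then show ?thesis by (simp add: card_image inj_on_def)
  qed
  moreover have "card (?U\<inverse>) = card ?U"
    by (simp add: upper_pairs_converse card_image)
  moreover have "card ?U + card (?U\<inverse>) = card (R \<times> R) + card (Id_on R)"
    using card_Un_Int[of ?U "?U\<inverse>"] un int by simp
  ultimately have "2 * card ?U = card R * (card R + 1)" by (simp add: card_cartesian_product)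
  then show ?thesis by simp
qed

text \<open>Passing to the upper triangle lets the cover grow with exponent \<open>s_act\<close>
  instead of the square of the dimension. Off-diagonal entries occur twice in the full norm, hence
  the factor sqrt 2.\<close>

lemma frob_upper:
  fixes D :: "real^'p^'p"
  assumes "transpose D = D"
  shows "L2_set (\<lambda>(i, j). D $ i $ j) (upper_pairs R) \<le> frob R D"
    "frob R D \<le> sqrt 2 * L2_set (\<lambda>(i, j). D $ i $ j) (upper_pairs R)"
proof -
  let ?U = "upper_pairs R" and ?f = "\<lambda>x. (case x of (i, j) \<Rightarrow> D $ i $ j)\<^sup>2"
  have sub: "?U \<subseteq> R \<times> R" by (auto simp: upper_pairs_def)
  have un: "?U \<union> ?U\<inverse> = R \<times> R" by (auto simp: upper_pairs_def)
  show "L2_set (\<lambda>(i, j). D $ i $ j) ?U \<le> frob R D"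
    unfolding frob_def L2_set_def using sub by (intro real_sqrt_le_mono sum_mono2) auto
  have sw: "D $ j $ i = D $ i $ j" for i j
    using arg_cong[OF assms, of "\<lambda>M. M $ i $ j"] by (simp add: transpose_def)
  have "sum ?f (?U\<inverse>) = sum ?f (prod.swap ` ?U)"
    by (simp only: upper_pairs_converse)
  also have "\<dots> = sum ?f ?U"
    by (subst sum.reindex) (auto simp: sw intro!: sum.cong)
  finally have s: "sum ?f (?U\<inverse>) = sum ?f ?U" .
  have "sum ?f (R \<times> R) \<le> sum ?f ?U + sum ?f (?U\<inverse>)"
    unfolding un[symmetric] by (subst sum_Un) (auto intro!: sum_nonneg)
  then have "sqrt (sum ?f (R \<times> R)) \<le> sqrt (2 * sum ?f ?U)" using s by simp
  then show "frob R D \<le> sqrt 2 * L2_set (\<lambda>(i, j). D $ i $ j) ?U"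
    unfolding frob_def L2_set_def by (simp add: real_sqrt_mult)
qed

text \<open>The means are quantised at \<zeta> / 2 and the triangles at \<zeta> / (2 sqrt 2): the 2
  pays for comparing through a common centre, the sqrt 2 for returning to the Frobenius norm. The
  packing bounds then carry the factors 4 and 4 sqrt 2, and both are rounded up to the 8 of
  \<open>cover_num\<close>.\<close>

theorem param_cover:
  fixes \<theta>0 :: "'p::finite param"
  assumes b: "valid_bounds b U" and \<theta>0: "\<theta>0 \<in> param_space b" and \<zeta>: "\<zeta> > 0"
  obtains Z :: "'p param set" where "Z \<subseteq> param_space b" "finite Z" "real (card Z) \<le> cover_num TYPE('p) b \<zeta>"
    "\<forall>\<theta>\<in>param_space b. \<exists>\<theta>'\<in>Z. \<forall>a\<in>actions.
       norm (act_mean U \<theta> a - act_mean U \<theta>' a) \<le> \<zeta> \<and> frob (coords a) (act_cov \<theta> a - act_cov \<theta>' a) \<le> \<zeta>"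
proof -
  let ?X = "param_space b :: 'p param set" and ?p = "CARD('p)"
  let ?B = "B_mu ?p b" and ?lo = "v_minus ?p b" and ?hi = "v_plus ?p b"
  have lo: "0 < ?lo" by (rule v_minus_pos[OF b])
  have lohi: "?lo \<le> ?hi" using v_minus_less_v_plus[OF b \<theta>0] by simp
  note cls = act_cov_in_class[OF b]
  have B0: "0 \<le> ?B"
    using act_mean_bound(2)[OF b \<theta>0, of Observe] by (simp add: actions_def)
  define m where "m a \<theta> i = act_mean U \<theta> a $ i" for a and \<theta> :: "'p param" and i
  define w where "w a \<theta> = (\<lambda>(i, j). act_cov \<theta> a $ i $ j)" for a and \<theta> :: "'p param"
  let ?P = "\<lambda>a c. (\<forall>\<theta>\<in>?X. L2_set (\<lambda>i. m a \<theta> i - m a (c \<theta>) i) (coords a) \<le> \<zeta> / 2) \<and>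
    finite (c ` ?X) \<and> real (card (c ` ?X)) \<le> (1 + 8 * ?B / \<zeta>) ^ d_act a"
  have "\<exists>c. ?P a c" if a: "a \<in> actions" for a :: "'p action"
  proof -
    have "L2_set (m a \<theta>) (coords a) \<le> ?B" if "\<theta> \<in> ?X" for \<theta>
    proof -
      have "L2_set (m a \<theta>) (coords a) \<le> norm (act_mean U \<theta> a)"
        unfolding norm_vec_def L2_set_def m_def real_norm_def power2_abs
        by (intro real_sqrt_le_mono sum_mono2) auto
      also have "\<dots> \<le> ?B" by (rule act_mean_bound(2)[OF b that a])
      finally show ?thesis .
    qed
    then obtain c where c: "\<And>\<theta>. \<theta> \<in> ?X \<Longrightarrow> L2_set (\<lambda>i. m a \<theta> i - m a (c \<theta>) i) (coords a) \<le> \<zeta> / 2"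
      "finite (c ` ?X)" "real (card (c ` ?X)) \<le> (1 + 2 * ?B / (\<zeta> / 2)) ^ card (coords a)"
      using \<zeta> B0 quantizer_exists[of "coords a" "\<zeta> / 2" ?B ?X "m a"] by auto
    have "(1 + 2 * ?B / (\<zeta> / 2)) ^ card (coords a) \<le> (1 + 8 * ?B / \<zeta>) ^ d_act a"
      unfolding d_act_eq[OF a] using \<zeta> B0 by (intro power_mono) (auto intro!: divide_right_mono)
    with c show ?thesis by (intro exI[of _ c]) auto
  qed
  then have "\<forall>a\<in>(actions :: 'p action set). \<exists>c. ?P a c" by blast
  from bchoice[OF this] obtain c1 where "\<forall>a\<in>(actions :: 'p action set). ?P a (c1 a)" by blast
  then have c1: "\<And>a \<theta>. a \<in> actions \<Longrightarrow> \<theta> \<in> ?X \<Longrightarrow>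
      L2_set (\<lambda>i. m a \<theta> i - m a (c1 a \<theta>) i) (coords a) \<le> \<zeta> / 2"
    "\<And>a. a \<in> actions \<Longrightarrow> finite (c1 a ` ?X)"
    "\<And>a. a \<in> actions \<Longrightarrow> real (card (c1 a ` ?X)) \<le> (1 + 8 * ?B / \<zeta>) ^ d_act a" by blast+
  let ?Q = "\<lambda>a c. (\<forall>\<theta>\<in>?X. L2_set (\<lambda>x. w a \<theta> x - w a (c \<theta>) x) (upper_pairs (coords a)) \<le> \<zeta> / (2 * sqrt 2)) \<and>
    finite (c ` ?X) \<and> real (card (c ` ?X)) \<le> (1 + 8 * sqrt (real (d_act a)) * ?hi / \<zeta>) ^ s_act a"
  have "\<exists>c. ?Q a c" if a: "a \<in> actions" for a :: "'p action"
  proof -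
    let ?r = "sqrt (real (d_act a)) * ?hi" and ?U = "upper_pairs (coords a)"
    have r0: "0 \<le> ?r" using lo lohi by simp
    have "L2_set (w a \<theta>) ?U \<le> ?r" if "\<theta> \<in> ?X" for \<theta>
    proof -
      have V: "act_cov \<theta> a \<in> cov_class (coords a) ?lo ?hi" by (rule cls[OF that])
      have "L2_set (w a \<theta>) ?U \<le> frob (coords a) (act_cov \<theta> a)"
        unfolding w_def using V by (intro frob_upper(1)) (simp add: cov_class_def)
      also have "\<dots> \<le> sqrt (real (card (coords a))) * ?hi"
        using lo lohi by (intro frob_le cov_class_norm[OF lo lohi V]) auto
      finally show ?thesis by (simp add: d_act_eq[OF a])
    qed
    then obtain c where c: "\<And>\<theta>. \<theta> \<in> ?X \<Longrightarrow> L2_set (\<lambda>i. w a \<theta> i - w a (c \<theta>) i) ?U \<le> \<zeta> / (2 * sqrt 2)"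
      "finite (c ` ?X)" "real (card (c ` ?X)) \<le> (1 + 2 * ?r / (\<zeta> / (2 * sqrt 2))) ^ card ?U"
      using \<zeta> r0 quantizer_exists[of ?U "\<zeta> / (2 * sqrt 2)" ?r ?X "w a"] by auto
    have "(1 + 2 * ?r / (\<zeta> / (2 * sqrt 2))) ^ card ?U \<le> (1 + 8 * ?r / \<zeta>) ^ s_act a"
    proof -
      have "sqrt 2 \<le> sqrt (2\<^sup>2 :: real)" by (intro real_sqrt_le_mono) simp
      then have "sqrt 2 \<le> 2" by simp
      from mult_right_mono[OF this r0] have "2 * ?r * (2 * sqrt 2) \<le> 8 * ?r" by (simp add: mult_ac)
      then have "2 * ?r / (\<zeta> / (2 * sqrt 2)) \<le> 8 * ?r / \<zeta>"
        using \<zeta> by (simp add: divide_right_mono)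
      moreover have "s_act a = card ?U" by (simp only: s_act_def card_upper_pairs d_act_eq[OF a])
      moreover have "0 \<le> 2 * ?r / (\<zeta> / (2 * sqrt 2))"
        using lo lohi \<zeta> by (intro divide_nonneg_nonneg mult_nonneg_nonneg) auto
      ultimately show ?thesis by (simp only:) (intro power_mono add_mono order_refl; linarith)
    qed
    with c show ?thesis by (intro exI[of _ c]) (auto simp: mult.assoc)
  qed
  then have "\<forall>a\<in>(actions :: 'p action set). \<exists>c. ?Q a c" by blast
  from bchoice[OF this] obtain c2 where "\<forall>a\<in>(actions :: 'p action set). ?Q a (c2 a)" by blast
  then have c2: "\<And>a \<theta>. a \<in> actions \<Longrightarrow> \<theta> \<in> ?X \<Longrightarrow>
      L2_set (\<lambda>x. w a \<theta> x - w a (c2 a \<theta>) x) (upper_pairs (coords a)) \<le> \<zeta> / (2 * sqrt 2)"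
    "\<And>a. a \<in> actions \<Longrightarrow> finite (c2 a ` ?X)"
    "\<And>a. a \<in> actions \<Longrightarrow> real (card (c2 a ` ?X)) \<le> (1 + 8 * sqrt (real (d_act a)) * ?hi / \<zeta>) ^ s_act a" by blast+
  define c where "c = (\<lambda>(a, k). if k then c1 a else c2 a)"
  let ?A = "(actions :: 'p action set) \<times> (UNIV :: bool set)"
  obtain Z where Z: "Z \<subseteq> ?X" "finite Z" "card Z \<le> (\<Prod>x\<in>?A. card (c x ` ?X))"
    "\<forall>\<theta>\<in>?X. \<exists>z\<in>Z. \<forall>x\<in>?A. c x \<theta> = c x z"
  proof (rule joint_quantizer)
    show "finite ?A" by (rule finite_cartesian_product[OF finite_actions finite])
    show "finite (c x ` ?X)" if "x \<in> ?A" for x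
      using that c1(2) c2(2) by (auto simp: c_def)
  qed
  have "real (\<Prod>x\<in>?A. card (c x ` ?X)) = (\<Prod>a\<in>actions. real (card (c1 a ` ?X)) * real (card (c2 a ` ?X)))"
    unfolding of_nat_prod prod.cartesian_product' by (simp add: UNIV_bool c_def mult.commute)
  also have "\<dots> \<le> cover_num TYPE('p) b \<zeta>"
    unfolding cover_num_def by (intro prod_mono conjI mult_mono c1(3) c2(3)) (use \<zeta> B0 in auto)
  finally have "real (\<Prod>x\<in>?A. card (c x ` ?X)) \<le> cover_num TYPE('p) b \<zeta>" .
  then have card: "real (card Z) \<le> cover_num TYPE('p) b \<zeta>" using Z(3) by linarith
  show ?thesis
  proof (rule that[OF Z(1,2) card], rule ballI)
    fix \<theta> assume \<theta>: "\<theta> \<in> ?X"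
    then obtain z where z: "z \<in> Z" and eq: "\<And>x. x \<in> ?A \<Longrightarrow> c x \<theta> = c x z" using Z(4) by blast
    then have zX: "z \<in> ?X" using Z(1) by blast
    have "norm (act_mean U \<theta> a - act_mean U z a) \<le> \<zeta> \<and> frob (coords a) (act_cov \<theta> a - act_cov z a) \<le> \<zeta>"
      if a: "a \<in> actions" for a
    proof
      have e: "c1 a \<theta> = c1 a z" "c2 a \<theta> = c2 a z"
        using eq[of "(a, True)"] eq[of "(a, False)"] a by (auto simp: c_def)
      have "norm (act_mean U \<theta> a - act_mean U z a) = L2_set (\<lambda>i. m a \<theta> i - m a z i) (coords a)"
        unfolding norm_vec_def L2_set_def m_def real_norm_def power2_abs
        using act_mean_bound(1)[OF b \<theta> a] act_mean_bound(1)[OF b zX a]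
        by (auto simp: on_eq_iff intro!: sum.mono_neutral_right)
      also have "\<dots> \<le> \<zeta> / 2 + \<zeta> / 2"
        using L2_set_diff_triangle[of "m a \<theta>" "m a z" "coords a" "m a (c1 a z)"]
          c1(1)[OF a \<theta>] c1(1)[OF a zX] e(1) L2_set_diff_commute[of "m a z" "m a (c1 a z)" "coords a"] by simp
      finally show "norm (act_mean U \<theta> a - act_mean U z a) \<le> \<zeta>" by simp
      let ?U = "upper_pairs (coords a)"
      have "L2_set (\<lambda>x. w a \<theta> x - w a z x) ?U \<le> \<zeta> / (2 * sqrt 2) + \<zeta> / (2 * sqrt 2)"
        using L2_set_diff_triangle[of "w a \<theta>" "w a z" ?U "w a (c2 a z)"]
          c2(1)[OF a \<theta>] c2(1)[OF a zX] e(2) L2_set_diff_commute[of "w a z" "w a (c2 a z)" ?U] by simp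
      then have "sqrt 2 * L2_set (\<lambda>x. w a \<theta> x - w a z x) ?U \<le> sqrt 2 * (\<zeta> / sqrt 2)"
        by (intro mult_left_mono) (auto simp: field_simps)
      moreover have "(\<lambda>x. w a \<theta> x - w a z x) = (\<lambda>(i, j). (act_cov \<theta> a - act_cov z a) $ i $ j)"
        by (auto simp: w_def)
      moreover have "frob (coords a) (act_cov \<theta> a - act_cov z a)
          \<le> sqrt 2 * L2_set (\<lambda>(i, j). (act_cov \<theta> a - act_cov z a) $ i $ j) ?U"
        by (intro frob_upper(2) cov_class_diff(2)[OF cls[OF \<theta>] cls[OF zX]])
      ultimately show "frob (coords a) (act_cov \<theta> a - act_cov z a) \<le> \<zeta>" by simp
    qed
    then show "\<exists>\<theta>'\<in>Z. \<forall>a\<in>actions. norm (act_mean U \<theta> a - act_mean U \<theta>' a) \<le> \<zeta> \<and>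
        frob (coords a) (act_cov \<theta> a - act_cov \<theta>' a) \<le> \<zeta>" using z by blast
  qed
qed

section \<open>Adaptive sampling\<close>

lemma sets_obs_space:
  "sets (obs_space :: ('p::finite action \<times> ('p \<Rightarrow> real)) measure) =
    sigma_sets (SIGMA a:actions. space (PiM (coords a) (\<lambda>_. borel)))
     {{a} \<times> B |a B. a \<in> actions \<and> B \<in> sets (PiM (coords a) (\<lambda>_. borel))}"
  unfolding obs_space_def by (rule sets_measure_of) (auto dest: sets.sets_into_space)

lemma space_obs_space:
  "space (obs_space :: ('p::finite action \<times> ('p \<Rightarrow> real)) measure) =
    (SIGMA a:actions. space (PiM (coords a) (\<lambda>_. borel)))"
  unfolding obs_space_def by (rule space_measure_of) (auto dest: sets.sets_into_space)

lemma obs_space_cylinder: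
  "a \<in> actions \<Longrightarrow> B \<in> sets (PiM (coords a) (\<lambda>_. borel)) \<Longrightarrow> {a} \<times> B \<in> sets obs_space"
  unfolding sets_obs_space by (rule sigma_sets.Basic) blast

lemma measurable_obs_space:
  fixes g :: "'p::finite action \<Rightarrow> ('p \<Rightarrow> real) \<Rightarrow> ennreal"
  assumes "\<And>a. a \<in> actions \<Longrightarrow> g a \<in> borel_measurable (PiM (coords a) (\<lambda>_. borel))"
  shows "(\<lambda>z. g (fst z) (snd z)) \<in> borel_measurable obs_space"
proof (rule measurableI)
  fix B :: "ennreal set" assume B: "B \<in> sets borel"
  have "(\<lambda>z. g (fst z) (snd z)) -` B \<inter> space obs_space
    = (\<Union>a\<in>actions. {a} \<times> (g a -` B \<inter> space (PiM (coords a) (\<lambda>_. borel))))"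
    by (auto simp: space_obs_space)
  also have "\<dots> \<in> sets obs_space"
    using finite_actions assms B by (intro sets.finite_UN obs_space_cylinder measurable_sets) auto
  finally show "(\<lambda>z. g (fst z) (snd z)) -` B \<inter> space obs_space \<in> sets obs_space" .
qed simp

lemma sets_PiM_lborel_borel: "sets (leb R) = sets (PiM R (\<lambda>_. borel))"
  by (intro sets_PiM_cong) auto

lemma sets_act_law: "sets (act_law U \<theta> a) = sets (PiM (coords a) (\<lambda>_. borel))"
  by (simp add: act_law_def mvn_def sets_PiM_lborel_borel)

context
  fixes M :: "'w measure" and U :: "'p::finite \<Rightarrow> nat \<Rightarrow> real" and \<theta> :: "'p param"
    and \<pi> :: "nat \<Rightarrow> (nat \<Rightarrow> 'p action \<times> ('p \<Rightarrow> real)) \<Rightarrow> 'p action pmf"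
    and act :: "nat \<Rightarrow> 'w \<Rightarrow> 'p action" and X :: "nat \<Rightarrow> 'w \<Rightarrow> 'p \<Rightarrow> real"
  assumes proc: "sampling_process M U \<theta> \<pi> act X"
begin

lemma process_prob_space: "prob_space M"
  using proc by (simp add: sampling_process_def)

lemma process_measurable: "t \<ge> 1 \<Longrightarrow> (\<lambda>\<omega>. (act t \<omega>, X t \<omega>)) \<in> measurable M obs_space"
  using proc by (simp add: sampling_process_def)

lemma process_space:
  assumes "t \<ge> 1" "\<omega> \<in> space M"
  shows "act t \<omega> \<in> actions" "X t \<omega> \<in> space (PiM (coords (act t \<omega>)) (\<lambda>_. borel))"
  using measurable_space[OF process_measurable[OF assms(1)] assms(2)] by (auto simp: space_obs_space)

lemma process_cylinder:
  assumes t: "t \<ge> 1" and a: "a \<in> actions" and B: "B \<in> sets (PiM (coords a) (\<lambda>_. borel))"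
  shows "{\<omega> \<in> space M. act t \<omega> = a \<and> X t \<omega> \<in> B} \<in> sets M"
proof -
  have "{\<omega> \<in> space M. act t \<omega> = a \<and> X t \<omega> \<in> B} = (\<lambda>\<omega>. (act t \<omega>, X t \<omega>)) -` ({a} \<times> B) \<inter> space M"
    by auto
  then show ?thesis using measurable_sets[OF process_measurable[OF t] obs_space_cylinder[OF a B]] by simp
qed

lemma process_action_event:
  assumes t: "t \<ge> 1" and a: "a \<in> actions"
  shows "{\<omega> \<in> space M. act t \<omega> = a} \<in> sets M"
proof -
  have "{\<omega> \<in> space M. act t \<omega> = a} = {\<omega> \<in> space M. act t \<omega> = a \<and> X t \<omega> \<in> space (PiM (coords a) (\<lambda>_. borel))}"
    using process_space[OF t] by auto
  then show ?thesis using process_cylinder[OF t a, of "space (PiM (coords a) (\<lambda>_. borel))"] by simp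
qed

lemma measurable_history: "history act X t \<in> measurable M (hist_space t)"
  unfolding history_def hist_space_def
  by (intro measurable_restrict process_measurable) auto

text \<open>\<open>sampling_process\<close> gives the factorisation on rectangles. On the event that
  action a is chosen, uniqueness of product measures makes the joint law of history and observation
  a product of a finite measure and the action law, and Tonelli carries this to functions.\<close>

lemma conditional_law:
  assumes law: "prob_space (act_law U \<theta> a)" and t: "t \<ge> 1" and a: "a \<in> actions"
    and f: "f \<in> borel_measurable (hist_space t)"
    and g: "g \<in> borel_measurable (PiM (coords a) (\<lambda>_. borel))"
  shows "(\<integral>\<^sup>+\<omega>. f (history act X t \<omega>) * g (X t \<omega>) * indicator {\<omega> \<in> space M. act t \<omega> = a} \<omega> \<partial>M)
    = (\<integral>\<^sup>+\<omega>. f (history act X t \<omega>) * indicator {\<omega> \<in> space M. act t \<omega> = a} \<omega> \<partial>M)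
      * (\<integral>\<^sup>+x. g x \<partial>act_law U \<theta> a)"
proof -
  let ?E = "{\<omega> \<in> space M. act t \<omega> = a}" and ?P = "PiM (coords a) (\<lambda>_. borel :: real measure)"
  let ?h = "history act X t" and ?H = "hist_space t :: (nat \<Rightarrow> 'p action \<times> ('p \<Rightarrow> real)) measure"
  interpret M: prob_space M by (rule process_prob_space)
  interpret L: prob_space "act_law U \<theta> a" by (rule law)
  have E: "?E \<in> sets M" by (rule process_action_event[OF t a])
  define Ma where "Ma = restrict_space M ?E"
  have spMa: "space Ma = ?E" using sets.sets_into_space[OF E] by (auto simp: Ma_def space_restrict_space)
  have hm [measurable]: "?h \<in> measurable Ma ?H"
    unfolding Ma_def by (intro measurable_restrict_space1 measurable_history)
  have Xm [measurable]: "X t \<in> measurable Ma ?P"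
  proof (rule measurableI)
    fix B assume B: "B \<in> sets ?P"
    have "X t -` B \<inter> space Ma = {\<omega> \<in> space M. act t \<omega> = a \<and> X t \<omega> \<in> B}" by (auto simp: spMa)
    then show "X t -` B \<inter> space Ma \<in> sets Ma"
      using process_cylinder[OF t a B] E by (auto simp: Ma_def sets_restrict_space_iff)
  qed (use process_space[OF t] in \<open>auto simp: spMa\<close>)
  have fin: "finite_measure Ma"
    unfolding Ma_def using E by (intro finite_measure_restrict_space M.finite_measure_axioms) auto
  define N where "N = distr Ma ?H ?h"
  interpret N: finite_measure N unfolding N_def by (rule finite_measure.finite_measure_distr[OF fin hm])
  have pm: "(\<lambda>\<omega>. (?h \<omega>, X t \<omega>)) \<in> measurable Ma (?H \<Otimes>\<^sub>M ?P)" by measurable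
  let ?D = "distr Ma (?H \<Otimes>\<^sub>M ?P) (\<lambda>\<omega>. (?h \<omega>, X t \<omega>))"
  have pair: "N \<Otimes>\<^sub>M act_law U \<theta> a = ?D"
  proof (rule pair_measure_eqI)
    show "sigma_finite_measure N" "sigma_finite_measure (act_law U \<theta> a)" by unfold_locales
    show "sets (N \<Otimes>\<^sub>M act_law U \<theta> a) = sets (?D)"
      by (simp add: N_def sets_act_law cong: sets_pair_measure_cong)
    fix A B assume "A \<in> sets N" "B \<in> sets (act_law U \<theta> a)"
    then have A: "A \<in> sets ?H" and B: "B \<in> sets ?P" by (simp_all add: N_def sets_act_law)
    have c: "measure M {\<omega>\<in>space M. ?h \<omega> \<in> A \<and> act t \<omega> = a \<and> X t \<omega> \<in> B} =
          measure M {\<omega>\<in>space M. ?h \<omega> \<in> A \<and> act t \<omega> = a} * measure (act_law U \<theta> a) B"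
      using proc t a A B unfolding sampling_process_def by blast
    have "emeasure N A = emeasure M {\<omega>\<in>space M. ?h \<omega> \<in> A \<and> act t \<omega> = a}"
    proof -
      have "emeasure N A = emeasure Ma (?h -` A \<inter> space Ma)" unfolding N_def by (rule emeasure_distr[OF hm A])
      also have "\<dots> = emeasure M (?h -` A \<inter> space Ma)"
        unfolding Ma_def using E by (intro emeasure_restrict_space) (auto simp: space_restrict_space)
      also have "?h -` A \<inter> space Ma = {\<omega>\<in>space M. ?h \<omega> \<in> A \<and> act t \<omega> = a}" by (auto simp: spMa)
      finally show ?thesis .
    qed
    moreover have "emeasure (?D) (A \<times> B)
        = emeasure M {\<omega>\<in>space M. ?h \<omega> \<in> A \<and> act t \<omega> = a \<and> X t \<omega> \<in> B}"
    proof -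
      have "emeasure (?D) (A \<times> B)
          = emeasure Ma ((\<lambda>\<omega>. (?h \<omega>, X t \<omega>)) -` (A \<times> B) \<inter> space Ma)"
        using A B by (intro emeasure_distr[OF pm]) auto
      also have "\<dots> = emeasure M ((\<lambda>\<omega>. (?h \<omega>, X t \<omega>)) -` (A \<times> B) \<inter> space Ma)"
        unfolding Ma_def using E by (intro emeasure_restrict_space) (auto simp: space_restrict_space)
      also have "(\<lambda>\<omega>. (?h \<omega>, X t \<omega>)) -` (A \<times> B) \<inter> space Ma
          = {\<omega>\<in>space M. ?h \<omega> \<in> A \<and> act t \<omega> = a \<and> X t \<omega> \<in> B}" by (auto simp: spMa)
      finally show ?thesis .
    qed
    ultimately show "emeasure N A * emeasure (act_law U \<theta> a) B
        = emeasure (?D) (A \<times> B)"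
      by (simp add: M.emeasure_eq_measure L.emeasure_eq_measure c ennreal_mult)
  qed
  have g': "g \<in> borel_measurable (act_law U \<theta> a)"
    using g by (simp add: measurable_cong_sets[OF sets_act_law refl])
  have f': "f \<in> borel_measurable N" using f by (simp add: N_def)
  have fg: "(\<lambda>z. f (fst z) * g (snd z)) \<in> borel_measurable (?H \<Otimes>\<^sub>M ?P)" using f g by measurable
  have fg': "(\<lambda>z. f (fst z) * g (snd z)) \<in> borel_measurable (N \<Otimes>\<^sub>M act_law U \<theta> a)"
    using f' g' by measurable
  have "(\<integral>\<^sup>+\<omega>. f (?h \<omega>) * g (X t \<omega>) * indicator ?E \<omega> \<partial>M) = (\<integral>\<^sup>+\<omega>. f (?h \<omega>) * g (X t \<omega>) \<partial>Ma)"
    unfolding Ma_def using E by (subst nn_integral_restrict_space) auto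
  also have "\<dots> = (\<integral>\<^sup>+z. f (fst z) * g (snd z) \<partial>?D)"
    using fg by (subst nn_integral_distr[OF pm]) auto
  also have "\<dots> = (\<integral>\<^sup>+h. \<integral>\<^sup>+x. f h * g x \<partial>act_law U \<theta> a \<partial>N)"
    unfolding pair[symmetric] using L.nn_integral_fst[OF fg'] by simp
  also have "\<dots> = (\<integral>\<^sup>+h. f h * (\<integral>\<^sup>+x. g x \<partial>act_law U \<theta> a) \<partial>N)"
    using g' by (simp add: nn_integral_cmult)
  also have "\<dots> = (\<integral>\<^sup>+h. f h \<partial>N) * (\<integral>\<^sup>+x. g x \<partial>act_law U \<theta> a)"
    using f' by (rule nn_integral_multc)
  also have "(\<integral>\<^sup>+h. f h \<partial>N) = (\<integral>\<^sup>+\<omega>. f (?h \<omega>) \<partial>Ma)"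
    unfolding N_def using f by (subst nn_integral_distr[OF hm]) auto
  also have "\<dots> = (\<integral>\<^sup>+\<omega>. f (?h \<omega>) * indicator ?E \<omega> \<partial>M)"
    unfolding Ma_def using E by (subst nn_integral_restrict_space) auto
  finally show ?thesis .
qed

lemma measurable_process_fun:
  fixes g :: "'p action \<Rightarrow> ('p \<Rightarrow> real) \<Rightarrow> ennreal"
  assumes "t \<ge> 1" "\<And>a. a \<in> actions \<Longrightarrow> g a \<in> borel_measurable (PiM (coords a) (\<lambda>_. borel))"
  shows "(\<lambda>\<omega>. g (act t \<omega>) (X t \<omega>)) \<in> borel_measurable M"
  using measurable_compose[OF process_measurable[OF assms(1)] measurable_obs_space[of g, OF assms(2)]] by simp

text \<open>Split by the action of the last round and integrate its factor given the history. The
  conditional mean is at most one for every action alike, so an adaptive choice cannot raise the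
  product above its previous mean.\<close>

theorem supermartingale_bound:
  fixes g :: "'p action \<Rightarrow> ('p \<Rightarrow> real) \<Rightarrow> ennreal"
  assumes law: "\<And>a. a \<in> actions \<Longrightarrow> prob_space (act_law U \<theta> a)"
    and g: "\<And>a. a \<in> actions \<Longrightarrow> g a \<in> borel_measurable (PiM (coords a) (\<lambda>_. borel))"
    and le: "\<And>a. a \<in> actions \<Longrightarrow> (\<integral>\<^sup>+x. g a x \<partial>act_law U \<theta> a) \<le> 1"
  shows "(\<integral>\<^sup>+\<omega>. (\<Prod>s=1..t. g (act s \<omega>) (X s \<omega>)) \<partial>M) \<le> 1"
proof (induction t)
  case 0
  interpret M: prob_space M by (rule process_prob_space)
  show ?case by (simp add: M.emeasure_space_1)
next
  case (Suc n)
  define t where "t = Suc n"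
  have t: "t \<ge> 1" by (simp add: t_def)
  define f where "f h = (\<Prod>s\<in>{1..<t}. g (fst (h s)) (snd (h s)))" for h :: "nat \<Rightarrow> 'p action \<times> ('p \<Rightarrow> real)"
  have f: "f \<in> borel_measurable (hist_space t)"
    unfolding f_def hist_space_def
  proof (rule borel_measurable_prod_ennreal)
    fix s assume "s \<in> {1..<t}"
    then have "(\<lambda>h. h s) \<in> measurable (PiM {1..<t} (\<lambda>_. obs_space)) obs_space"
      by (rule measurable_component_singleton)
    moreover have "(\<lambda>z. g (fst z) (snd z)) \<in> borel_measurable obs_space"
      by (rule measurable_obs_space) (rule g)
    ultimately show "(\<lambda>h. g (fst (h s)) (snd (h s))) \<in> borel_measurable (PiM {1..<t} (\<lambda>_. obs_space))"
      by (rule measurable_compose)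
  qed
  have fh: "f (history act X t \<omega>) = (\<Prod>s=1..n. g (act s \<omega>) (X s \<omega>))" for \<omega>
    unfolding f_def history_def t_def by (intro prod.cong) auto
  let ?E = "\<lambda>a. {\<omega> \<in> space M. act t \<omega> = a}"
  have E: "?E a \<in> sets M" if "a \<in> actions" for a by (rule process_action_event[OF t that])
  have fm: "(\<lambda>\<omega>. f (history act X t \<omega>)) \<in> borel_measurable M"
    by (rule measurable_compose[OF measurable_history f])
  have gm: "(\<lambda>\<omega>. g (act t \<omega>) (X t \<omega>)) \<in> borel_measurable M"
    by (rule measurable_process_fun[OF t g])
  have part: "(\<integral>\<^sup>+\<omega>. F \<omega> \<partial>M) = (\<Sum>a\<in>actions. \<integral>\<^sup>+\<omega>. F \<omega> * indicator (?E a) \<omega> \<partial>M)"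
    if F: "F \<in> borel_measurable M" for F :: "'w \<Rightarrow> ennreal"
  proof -
    have "(\<integral>\<^sup>+\<omega>. F \<omega> \<partial>M) = (\<integral>\<^sup>+\<omega>. (\<Sum>a\<in>actions. F \<omega> * indicator (?E a) \<omega>) \<partial>M)"
    proof (rule nn_integral_cong)
      fix \<omega> assume \<omega>: "\<omega> \<in> space M"
      have "(\<Sum>a\<in>actions. F \<omega> * indicator (?E a) \<omega>) = (\<Sum>a\<in>actions. if a = act t \<omega> then F \<omega> else 0)"
        using \<omega> by (intro sum.cong) (auto simp: indicator_def)
      then show "F \<omega> = (\<Sum>a\<in>actions. F \<omega> * indicator (?E a) \<omega>)"
        using process_space(1)[OF t \<omega>] by (simp add: sum.delta[OF finite_actions])
    qed
    also have "\<dots> = (\<Sum>a\<in>actions. \<integral>\<^sup>+\<omega>. F \<omega> * indicator (?E a) \<omega> \<partial>M)"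
      using F E by (intro nn_integral_sum borel_measurable_times_ennreal borel_measurable_indicator) auto
    finally show ?thesis .
  qed
  have "(\<integral>\<^sup>+\<omega>. (\<Prod>s=1..Suc n. g (act s \<omega>) (X s \<omega>)) \<partial>M)
      = (\<integral>\<^sup>+\<omega>. f (history act X t \<omega>) * g (act t \<omega>) (X t \<omega>) \<partial>M)"
    unfolding fh by (simp add: t_def)
  also have "\<dots> = (\<Sum>a\<in>actions. \<integral>\<^sup>+\<omega>. f (history act X t \<omega>) * g (act t \<omega>) (X t \<omega>) * indicator (?E a) \<omega> \<partial>M)"
    using fm gm by (intro part) measurable
  also have "\<dots> \<le> (\<Sum>a\<in>actions. \<integral>\<^sup>+\<omega>. f (history act X t \<omega>) * indicator (?E a) \<omega> \<partial>M)"
  proof (rule sum_mono)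
    fix a :: "'p action" assume a: "a \<in> actions"
    have "(\<integral>\<^sup>+\<omega>. f (history act X t \<omega>) * g (act t \<omega>) (X t \<omega>) * indicator (?E a) \<omega> \<partial>M)
        = (\<integral>\<^sup>+\<omega>. f (history act X t \<omega>) * g a (X t \<omega>) * indicator (?E a) \<omega> \<partial>M)"
      by (intro nn_integral_cong) (auto simp: indicator_def)
    also have "\<dots> = (\<integral>\<^sup>+\<omega>. f (history act X t \<omega>) * indicator (?E a) \<omega> \<partial>M) * (\<integral>\<^sup>+x. g a x \<partial>act_law U \<theta> a)"
      by (rule conditional_law[OF law[OF a] t a f g[OF a]])
    also have "\<dots> \<le> (\<integral>\<^sup>+\<omega>. f (history act X t \<omega>) * indicator (?E a) \<omega> \<partial>M) * 1"
      by (intro mult_left_mono le a) auto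
    finally show "(\<integral>\<^sup>+\<omega>. f (history act X t \<omega>) * g (act t \<omega>) (X t \<omega>) * indicator (?E a) \<omega> \<partial>M)
        \<le> (\<integral>\<^sup>+\<omega>. f (history act X t \<omega>) * indicator (?E a) \<omega> \<partial>M)" by simp
  qed
  also have "\<dots> = (\<integral>\<^sup>+\<omega>. f (history act X t \<omega>) \<partial>M)" by (rule part[OF fm, symmetric])
  also have "\<dots> \<le> 1" using Suc by (simp add: fh)
  finally show ?case .
qed

text \<open>The bound \<epsilon> holds for every action law, and the events of choosing the
  different actions are disjoint, so weighting by their probabilities cannot exceed
  \<epsilon>.\<close>

lemma round_tail:
  assumes law: "\<And>a. a \<in> actions \<Longrightarrow> prob_space (act_law U \<theta> a)" and t: "t \<ge> 1"
    and B: "\<And>a. a \<in> actions \<Longrightarrow> B a \<in> sets (PiM (coords a) (\<lambda>_. borel))"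
    and le: "\<And>a. a \<in> actions \<Longrightarrow> emeasure (act_law U \<theta> a) (B a) \<le> \<epsilon>"
  shows "{\<omega> \<in> space M. X t \<omega> \<in> B (act t \<omega>)} \<in> sets M"
    "emeasure M {\<omega> \<in> space M. X t \<omega> \<in> B (act t \<omega>)} \<le> \<epsilon>"
proof -
  interpret M: prob_space M by (rule process_prob_space)
  let ?E = "\<lambda>a. {\<omega> \<in> space M. act t \<omega> = a}" and ?F = "\<lambda>a. {\<omega> \<in> space M. act t \<omega> = a \<and> X t \<omega> \<in> B a}"
  have eq: "{\<omega> \<in> space M. X t \<omega> \<in> B (act t \<omega>)} = (\<Union>a\<in>actions. ?F a)"
    using process_space(1)[OF t] by auto
  have F: "?F a \<in> sets M" if "a \<in> actions" for a by (rule process_cylinder[OF t that B[OF that]])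
  then show "{\<omega> \<in> space M. X t \<omega> \<in> B (act t \<omega>)} \<in> sets M"
    unfolding eq using finite_actions by (intro sets.finite_UN) auto
  have "emeasure M (\<Union>a\<in>actions. ?F a) \<le> (\<Sum>a\<in>actions. emeasure M (?F a))"
    using finite_actions F by (intro emeasure_subadditive_finite) auto
  also have "\<dots> \<le> (\<Sum>a\<in>actions. emeasure M (?E a) * \<epsilon>)"
  proof (rule sum_mono)
    fix a :: "'p action" assume a: "a \<in> actions"
    have Bm: "indicator (B a) \<in> borel_measurable (PiM (coords a) (\<lambda>_. borel :: real measure))"
      using B[OF a] by simp
    have "emeasure M (?F a) = (\<integral>\<^sup>+\<omega>. 1 * indicator (B a) (X t \<omega>) * indicator (?E a) \<omega> \<partial>M)"
    proof -
      have "emeasure M (?F a) = (\<integral>\<^sup>+\<omega>. indicator (?F a) \<omega> \<partial>M)" using F[OF a] by simp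
      also have "\<dots> = (\<integral>\<^sup>+\<omega>. 1 * indicator (B a) (X t \<omega>) * indicator (?E a) \<omega> \<partial>M)"
        by (intro nn_integral_cong) (auto simp: indicator_def)
      finally show ?thesis .
    qed
    also have "\<dots> = (\<integral>\<^sup>+\<omega>. 1 * indicator (?E a) \<omega> \<partial>M) * (\<integral>\<^sup>+x. indicator (B a) x \<partial>act_law U \<theta> a)"
      by (rule conditional_law[OF law[OF a] t a _ Bm, of "\<lambda>_. 1"]) simp
    also have "\<dots> = emeasure M (?E a) * emeasure (act_law U \<theta> a) (B a)"
      using process_action_event[OF t a] B[OF a] by (simp add: sets_act_law)
    also have "\<dots> \<le> emeasure M (?E a) * \<epsilon>" by (intro mult_left_mono le[OF a]) simp
    finally show "emeasure M (?F a) \<le> emeasure M (?E a) * \<epsilon>" .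
  qed
  also have "\<dots> = emeasure M (\<Union>a\<in>actions. ?E a) * \<epsilon>"
    unfolding sum_distrib_right[symmetric]
    by (subst sum_emeasure) (auto simp: disjoint_family_on_def finite_actions intro!: process_action_event[OF t])
  also have "\<dots> \<le> 1 * \<epsilon>" by (intro mult_right_mono M.emeasure_le_1) simp
  finally show "emeasure M {\<omega> \<in> space M. X t \<omega> \<in> B (act t \<omega>)} \<le> \<epsilon>" unfolding eq by simp
qed

end

section \<open>The tail bound\<close>

text \<open>Turns the weighted sum over actions into a sum over rounds, the form in which it
  combines with the log-likelihood.\<close>

lemma sum_act_count:
  assumes "\<And>s. s \<in> {1..t} \<Longrightarrow> act s \<omega> \<in> (actions :: 'p::finite action set)"
  shows "(\<Sum>a\<in>actions. real (act_count act t a \<omega>) * K a) = (\<Sum>s=1..t. K (act s \<omega>))"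
proof -
  have eq: "real (act_count act t a \<omega>) * K a = (\<Sum>s\<in>{s\<in>{1..t}. act s \<omega> = a}. K (act s \<omega>))" for a
    by (simp add: act_count_def)
  have "(\<Sum>a\<in>actions. real (act_count act t a \<omega>) * K a)
      = (\<Sum>a\<in>actions. \<Sum>s\<in>{s\<in>{1..t}. act s \<omega> = a}. K (act s \<omega>))" by (simp only: eq)
  also have "\<dots> = (\<Sum>s=1..t. K (act s \<omega>))"
    by (rule sum.group[OF _ finite_actions]) (use assms in auto)
  finally show ?thesis .
qed

lemma dev_vec_shift: "dev_vec R \<mu> x = dev_vec R \<nu> x + on R (\<nu> - \<mu>)"
  by (simp add: dev_vec_def vec_eq_iff)

lemma q_dim_pos: "0 < q_dim TYPE('p::finite)"
proof -
  have "d_act (Observe :: 'p action) + s_act (Observe :: 'p action) \<le> q_dim TYPE('p)"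
    unfolding q_dim_def
    by (rule member_le_sum[OF _ _ finite_actions, of "Observe :: 'p action" "\<lambda>a. d_act a + s_act a"])
       (auto simp: actions_def)
  then have "CARD('p) \<le> q_dim TYPE('p)" by simp
  moreover have "0 < CARD('p)" by simp
  ultimately show ?thesis by linarith
qed

section \<open>Scores of single rounds, and the union bound\<close>

context
  fixes b :: bounds and U :: "'p::finite \<Rightarrow> nat \<Rightarrow> real" and \<theta>s :: "'p param"
  assumes b: "valid_bounds b U" and \<theta>s: "\<theta>s \<in> param_space b"
begin

lemma lo_pos: "0 < v_minus CARD('p) b" by (rule v_minus_pos[OF b])
lemma lo_less_hi: "v_minus CARD('p) b < v_plus CARD('p) b" by (rule v_minus_less_v_plus[OF b \<theta>s])
lemma lo_le_hi: "v_minus CARD('p) b \<le> v_plus CARD('p) b" using lo_less_hi by simp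
lemma kappa_nonneg: "0 \<le> kappa_B CARD('p) b" by (rule kappa_B_nonneg[OF lo_pos lo_less_hi])

lemma B_mu_nonneg: "0 \<le> B_mu CARD('p) b"
  using b G_p_nonneg[of b "CARD('p)"] by (simp add: B_mu_def valid_bounds_def)

lemma L_ell_pos: "R \<ge> 0 \<Longrightarrow> 0 < L_ell CARD('p) b R"
  using lo_pos B_mu_nonneg unfolding L_ell_def
  by (intro add_nonneg_pos) (auto intro!: add_pos_nonneg)

lemma L_KL_nonneg: "0 \<le> L_KL CARD('p) b"
  using lo_pos B_mu_nonneg by (simp add: L_KL_def)

lemma z_lev_nonneg: "x \<ge> 0 \<Longrightarrow> 0 \<le> z_lev CARD('p) b t x"
  using kappa_nonneg by (simp add: z_lev_def)

lemma R_rad_nonneg: "z \<ge> 0 \<Longrightarrow> 0 \<le> R_rad CARD('p) b z"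
  using lo_pos lo_less_hi B_mu_nonneg by (simp add: R_rad_def)

lemma H_lip_pos: "x \<ge> 0 \<Longrightarrow> 0 < H_lip CARD('p) b t x"
  using L_ell_pos[OF R_rad_nonneg[OF z_lev_nonneg]] L_KL_nonneg kappa_nonneg
  unfolding H_lip_def by (intro add_pos_nonneg) auto

lemma zeta_pos: "t \<ge> 1 \<Longrightarrow> x \<ge> 0 \<Longrightarrow> 0 < zeta TYPE('p) b t x"
  using H_lip_pos q_dim_pos[where 'p = 'p] by (simp add: zeta_def)

text \<open>Rounding loses at most H \<zeta> in each of t rounds; this budget is the reason for the
  quotient q / (t H) in \<open>zeta\<close>.\<close>

lemma zeta_H_le:
  assumes "t \<ge> 1" "x \<ge> 0"
  shows "real t * (H_lip CARD('p) b t x * zeta TYPE('p) b t x) \<le> real (q_dim TYPE('p))"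
proof -
  define h where "h = real t * H_lip CARD('p) b t x"
  have h: "0 < h" unfolding h_def using assms H_lip_pos by simp
  have "h * zeta TYPE('p) b t x \<le> h * (real (q_dim TYPE('p)) / h)"
    using h by (intro mult_left_mono) (auto simp: zeta_def h_def)
  also have "\<dots> = real (q_dim TYPE('p))" using h by simp
  finally show ?thesis by (simp only: mult.assoc h_def)
qed

abbreviation kl_act :: "'p param \<Rightarrow> 'p action \<Rightarrow> real" where
  "kl_act \<theta> a \<equiv> gauss_kl (act_mean U \<theta> a) (act_cov \<theta> a) (act_mean U \<theta>s a) (act_cov \<theta>s a)"

lemma KL_act_law:
  assumes "\<theta> \<in> param_space b" "a \<in> actions"
  shows "KL (act_law U \<theta> a) (act_law U \<theta>s a) = kl_act \<theta> a"
  unfolding act_law_def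
  by (intro KL_mvn[OF lo_pos lo_le_hi] act_cov_in_class[OF b] act_mean_bound(1)[OF b] assms \<theta>s)

lemma prob_space_act_law: "a \<in> actions \<Longrightarrow> prob_space (act_law U \<theta>s a)"
  unfolding act_law_def
  by (intro prob_space_mvn[OF lo_pos lo_le_hi] act_cov_in_class[OF b] act_mean_bound(1)[OF b] \<theta>s)

text \<open>One round's increment of the logarithm of the compensated square-root likelihood ratio,
  with \<open>kappa_B\<close> times the divergence in place of the Bhattacharyya distance.\<close>

definition score :: "'p param \<Rightarrow> 'p action \<Rightarrow> ('p \<Rightarrow> real) \<Rightarrow> real" where
  "score \<theta> a x = (ln (act_density U \<theta> a x) - ln (act_density U \<theta>s a x)) / 2 + kappa_B CARD('p) b * kl_act \<theta> a"

lemma measurable_score: "score \<theta> a \<in> borel_measurable (PiM (coords a) (\<lambda>_. borel))"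
proof -
  have [measurable]: "mvn_density (coords a) \<mu> V \<in> borel_measurable (PiM (coords a) (\<lambda>_. borel))" for \<mu> V
    by (rule measurable_mvn_density) simp
  show ?thesis unfolding score_def act_density_def by measurable
qed

lemma score_expectation:
  assumes \<theta>: "\<theta> \<in> param_space b" and a: "a \<in> actions"
  shows "(\<integral>\<^sup>+x. ennreal (exp (score \<theta> a x)) \<partial>act_law U \<theta>s a) \<le> 1"
  unfolding score_def act_density_def act_law_def
  by (intro half_likelihood_ratio_bound[OF lo_pos lo_le_hi] act_cov_in_class[OF b]
      act_mean_bound(1)[OF b] kappa_B_comparison[OF lo_pos lo_less_hi] \<theta> \<theta>s a)

text \<open>All means have norm at most \<open>B_mu\<close>, so an observation near its true mean
  lies within R + B_mu of the mean under every parameter. The factor in front of \<zeta> is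
  \<open>H_lip\<close>: the log-density enters the score halved and the divergence enters it times
  \<open>kappa_B\<close>.\<close>

lemma score_lipschitz:
  assumes \<theta>: "\<theta> \<in> param_space b" and \<theta>': "\<theta>' \<in> param_space b" and a: "a \<in> actions"
    and z: "z \<ge> 0"
    and x: "norm (dev_vec (coords a) (act_mean U \<theta>s a) x) \<le> sqrt (v_plus CARD('p) b) * (sqrt (real CARD('p)) + sqrt (2 * z))"
    and \<zeta>: "norm (act_mean U \<theta> a - act_mean U \<theta>' a) \<le> \<zeta>" "frob (coords a) (act_cov \<theta> a - act_cov \<theta>' a) \<le> \<zeta>"
  shows "score \<theta> a x - (L_ell CARD('p) b (R_rad CARD('p) b z) / 2 + kappa_B CARD('p) b * L_KL CARD('p) b) * \<zeta> \<le> score \<theta>' a x"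
proof -
  let ?B = "B_mu CARD('p) b" and ?R = "R_rad CARD('p) b z"
  note on = act_mean_bound(1)[OF b] and nb = act_mean_bound(2)[OF b]
  have dev: "norm (dev_vec (coords a) (act_mean U \<eta> a) x) \<le> ?R + ?B" if \<eta>: "\<eta> \<in> param_space b" for \<eta>
  proof -
    have "norm (dev_vec (coords a) (act_mean U \<eta> a) x)
        \<le> norm (dev_vec (coords a) (act_mean U \<theta>s a) x) + norm (on (coords a) (act_mean U \<theta>s a - act_mean U \<eta> a))"
      by (subst dev_vec_shift[of _ _ _ "act_mean U \<theta>s a"]) (rule norm_triangle_ineq)
    also have "norm (on (coords a) (act_mean U \<theta>s a - act_mean U \<eta> a)) \<le> norm (act_mean U \<theta>s a) + norm (act_mean U \<eta> a)"
      using norm_on_le norm_triangle_ineq4 order_trans by blast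
    finally show ?thesis using x nb[OF \<theta>s a] nb[OF \<eta> a] by (simp add: R_rad_def)
  qed
  have "\<bar>ln (act_density U \<theta> a x) - ln (act_density U \<theta>' a x)\<bar> \<le> L_ell CARD('p) b ?R * \<zeta>"
    unfolding act_density_def L_ell_def
    by (rule ln_mvn_density_lipschitz[OF lo_pos lo_le_hi act_cov_in_class[OF b \<theta>] act_cov_in_class[OF b \<theta>']
          dev[OF \<theta>] dev[OF \<theta>']])
       (use \<zeta> in \<open>simp_all add: on[OF \<theta> a] on[OF \<theta>' a]\<close>)
  moreover have "\<bar>kl_act \<theta> a - kl_act \<theta>' a\<bar> \<le> L_KL CARD('p) b * \<zeta>"
    unfolding L_KL_def
    by (rule gauss_kl_lipschitz[OF lo_pos lo_le_hi act_cov_in_class[OF b \<theta>] act_cov_in_class[OF b \<theta>']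
          act_cov_in_class[OF b \<theta>s] on[OF \<theta> a] on[OF \<theta>' a] on[OF \<theta>s a] nb[OF \<theta> a] nb[OF \<theta>' a] nb[OF \<theta>s a] \<zeta>])
  then have "kappa_B CARD('p) b * (kl_act \<theta> a - kl_act \<theta>' a) \<le> kappa_B CARD('p) b * (L_KL CARD('p) b * \<zeta>)"
    using kappa_nonneg by (intro mult_left_mono) auto
  moreover have "(L_ell CARD('p) b ?R / 2 + kappa_B CARD('p) b * L_KL CARD('p) b) * \<zeta>
      = L_ell CARD('p) b ?R * \<zeta> / 2 + kappa_B CARD('p) b * (L_KL CARD('p) b * \<zeta>)" by (simp add: algebra_simps)
  ultimately show ?thesis by (simp add: score_def right_diff_distrib abs_le_iff) argo
qed

theorem mle_divergence_tail:
  fixes M :: "'w measure"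
    and \<pi> :: "nat \<Rightarrow> (nat \<Rightarrow> 'p action \<times> ('p \<Rightarrow> real)) \<Rightarrow> 'p action pmf"
  assumes proc: "sampling_process M U \<theta>s \<pi> act X"
    and mle: "mle_process M b U act X est"
    and t: "t \<ge> 1" and x: "x \<ge> 0"
  shows "measure M {\<omega> \<in> space M. x \<le> (\<Sum>a\<in>actions. real (act_count act t a \<omega>)
      * KL (act_law U (est t \<omega>) a) (act_law U \<theta>s a))} \<le> tail_bound TYPE('p) b t x"
proof -
  let ?q = "real (q_dim TYPE('p))" and ?\<zeta> = "zeta TYPE('p) b t x" and ?z = "z_lev CARD('p) b t x"
  let ?E = "{\<omega> \<in> space M. x \<le> (\<Sum>a\<in>actions. real (act_count act t a \<omega>)
      * KL (act_law U (est t \<omega>) a) (act_law U \<theta>s a))}"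
  let ?H = "H_lip CARD('p) b t x"
  interpret M: prob_space M using proc by (simp add: sampling_process_def)
  have z: "0 \<le> ?z" by (rule z_lev_nonneg[OF x])
  obtain Z where Z: "Z \<subseteq> param_space b" "finite Z" "real (card Z) \<le> cover_num TYPE('p) b ?\<zeta>"
    and near: "\<forall>\<theta>\<in>param_space b. \<exists>\<theta>'\<in>Z. \<forall>a\<in>actions.
       norm (act_mean U \<theta> a - act_mean U \<theta>' a) \<le> ?\<zeta> \<and> frob (coords a) (act_cov \<theta> a - act_cov \<theta>' a) \<le> ?\<zeta>"
    by (rule param_cover[OF b \<theta>s zeta_pos[OF t x]])
  define far where "far a = {y \<in> space (leb (coords a)).
    sqrt (v_plus CARD('p) b) * (sqrt (real CARD('p)) + sqrt (2 * ?z)) < norm (dev_vec (coords a) (act_mean U \<theta>s a) y)}" for a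
  have far_sets: "far a \<in> sets (PiM (coords a) (\<lambda>_. borel))" for a
  proof -
    have [measurable]: "(\<lambda>y. norm (dev_vec (coords a) (act_mean U \<theta>s a) y)) \<in> borel_measurable (leb (coords a))"
      by (rule measurable_norm_dev_vec)
    show ?thesis unfolding far_def sets_PiM_lborel_borel[symmetric] by measurable
  qed
  have far_prob: "emeasure (act_law U \<theta>s a) (far a) \<le> ennreal (exp (- ?z))" if "a \<in> actions" for a
    unfolding act_law_def far_def
    by (intro mvn_tail[OF lo_pos lo_le_hi] act_cov_in_class[OF b] act_mean_bound(1)[OF b] \<theta>s that z)
  define Bad where "Bad s = {\<omega> \<in> space M. X s \<omega> \<in> far (act s \<omega>)}" for s
  note Bad = round_tail[OF proc prob_space_act_law _ far_sets far_prob, folded Bad_def]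
  define Y where "Y \<theta> \<omega> = (\<Sum>s=1..t. score \<theta> (act s \<omega>) (X s \<omega>))" for \<theta> \<omega>
  let ?c = "kappa_B CARD('p) b * x - ?q"
  define A where "A \<theta> = {\<omega> \<in> space M. ?c \<le> Y \<theta> \<omega>}" for \<theta>
  have Yprod: "ennreal (exp (Y \<theta> \<omega>)) = (\<Prod>s=1..t. ennreal (exp (score \<theta> (act s \<omega>) (X s \<omega>))))" for \<theta> \<omega>
    by (simp add: Y_def exp_sum prod_ennreal)
  have A: "A \<theta> \<in> sets M" "emeasure M (A \<theta>) \<le> ennreal (exp (- ?c))" if \<theta>: "\<theta> \<in> param_space b" for \<theta>
  proof -
    have sm: "(\<lambda>y. ennreal (exp (score \<theta> a y))) \<in> borel_measurable (PiM (coords a) (\<lambda>_. borel))" for a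
      using measurable_score by measurable
    have Ym: "(\<lambda>\<omega>. ennreal (exp (Y \<theta> \<omega>))) \<in> borel_measurable M"
      unfolding Yprod
      by (intro borel_measurable_prod_ennreal measurable_process_fun[OF proc, where g = "\<lambda>a y. ennreal (exp (score \<theta> a y))"] sm) auto
    have eq: "A \<theta> = {\<omega> \<in> space M. 1 \<le> ennreal (exp (- ?c)) * ennreal (exp (Y \<theta> \<omega>))}"
      unfolding A_def by (auto simp: ennreal_mult[symmetric] mult_exp_exp)
    show "A \<theta> \<in> sets M" unfolding eq using Ym by measurable
    have "emeasure M (A \<theta>) \<le> ennreal (exp (- ?c)) * (\<integral>\<^sup>+\<omega>. ennreal (exp (Y \<theta> \<omega>)) * indicator (space M) \<omega> \<partial>M)"
      unfolding eq by (rule nn_integral_Markov_inequality) (use Ym in auto)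
    also have "(\<integral>\<^sup>+\<omega>. ennreal (exp (Y \<theta> \<omega>)) * indicator (space M) \<omega> \<partial>M) = (\<integral>\<^sup>+\<omega>. ennreal (exp (Y \<theta> \<omega>)) \<partial>M)"
      by (rule nn_integral_cong) simp
    also have "\<dots> \<le> 1"
      unfolding Yprod
      by (rule supermartingale_bound[OF proc prob_space_act_law, where g = "\<lambda>a y. ennreal (exp (score \<theta> a y))"])
         (use sm score_expectation[OF \<theta>] in auto)
    finally show "emeasure M (A \<theta>) \<le> ennreal (exp (- ?c))" by (simp add: mult_left_mono)
  qed
  define W where "W = (\<Union>s\<in>{1..t}. Bad s) \<union> (\<Union>\<theta>\<in>Z. A \<theta>)"
  have ZA: "A \<theta> \<in> sets M" "emeasure M (A \<theta>) \<le> ennreal (exp (- ?c))" if "\<theta> \<in> Z" for \<theta>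
    using A Z(1) that by auto
  have BadS: "Bad s \<in> sets M" "emeasure M (Bad s) \<le> ennreal (exp (- ?z))" if "s \<in> {1..t}" for s
    using Bad[of s] that by auto
  have W: "W \<in> sets M" unfolding W_def using ZA(1) BadS(1) Z(2) by (intro sets.Un sets.finite_UN) auto
  have sub: "?E \<subseteq> W"
  proof
    fix \<omega> assume "\<omega> \<in> ?E"
    then have \<omega>: "\<omega> \<in> space M" and D: "x \<le> (\<Sum>a\<in>actions. real (act_count act t a \<omega>)
      * KL (act_law U (est t \<omega>) a) (act_law U \<theta>s a))" by auto
    have sp: "act s \<omega> \<in> actions" "X s \<omega> \<in> space (PiM (coords (act s \<omega>)) (\<lambda>_. borel))" if "s \<in> {1..t}" for s
      using process_space[OF proc _ \<omega>, of s] that by auto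
    have am: "is_arg_max (log_lik U act X t \<omega>) (\<lambda>\<theta>. \<theta> \<in> param_space b) (est t \<omega>)"
      using mle t \<omega> by (simp add: mle_process_def)
    then have \<theta>: "est t \<omega> \<in> param_space b" by (simp add: is_arg_max_def)
    have ll: "log_lik U act X t \<omega> \<theta>s \<le> log_lik U act X t \<omega> (est t \<omega>)"
      using am \<theta>s by (auto simp: is_arg_max_def not_less)
    have "x \<le> (\<Sum>s=1..t. KL (act_law U (est t \<omega>) (act s \<omega>)) (act_law U \<theta>s (act s \<omega>)))"
      using D by (subst (asm) sum_act_count) (use sp in auto)
    also have "\<dots> = (\<Sum>s=1..t. kl_act (est t \<omega>) (act s \<omega>))"
      by (intro sum.cong refl KL_act_law[OF \<theta>] sp)
    finally have "kappa_B CARD('p) b * x \<le> kappa_B CARD('p) b * (\<Sum>s=1..t. kl_act (est t \<omega>) (act s \<omega>))"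
      using kappa_nonneg by (rule mult_left_mono)
    moreover have "Y (est t \<omega>) \<omega> = (log_lik U act X t \<omega> (est t \<omega>) - log_lik U act X t \<omega> \<theta>s) / 2
        + kappa_B CARD('p) b * (\<Sum>s=1..t. kl_act (est t \<omega>) (act s \<omega>))"
      by (simp add: Y_def score_def log_lik_def sum.distrib sum_subtractf sum_divide_distrib[symmetric] sum_distrib_left)
    moreover have "0 \<le> (log_lik U act X t \<omega> (est t \<omega>) - log_lik U act X t \<omega> \<theta>s) / 2" using ll by simp
    ultimately have Yge: "kappa_B CARD('p) b * x \<le> Y (est t \<omega>) \<omega>" by linarith
    show "\<omega> \<in> W"
    proof (cases "\<exists>s\<in>{1..t}. \<omega> \<in> Bad s")
      case False
      obtain \<theta>' where \<theta>': "\<theta>' \<in> Z" and close: "\<forall>a\<in>actions.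
         norm (act_mean U (est t \<omega>) a - act_mean U \<theta>' a) \<le> ?\<zeta> \<and>
         frob (coords a) (act_cov (est t \<omega>) a - act_cov \<theta>' a) \<le> ?\<zeta>" using near \<theta> by blast
      have "score (est t \<omega>) (act s \<omega>) (X s \<omega>) - ?H * ?\<zeta> \<le> score \<theta>' (act s \<omega>) (X s \<omega>)" if s: "s \<in> {1..t}" for s
        unfolding H_lip_def
      proof (rule score_lipschitz[OF \<theta> _ sp(1)[OF s] z])
        show "\<theta>' \<in> param_space b" using \<theta>' Z(1) by blast
        have "X s \<omega> \<in> space (leb (coords (act s \<omega>)))" using sp(2)[OF s] by (simp add: space_PiM)
        then show "norm (dev_vec (coords (act s \<omega>)) (act_mean U \<theta>s (act s \<omega>)) (X s \<omega>))
            \<le> sqrt (v_plus CARD('p) b) * (sqrt (real CARD('p)) + sqrt (2 * ?z))"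
          using False s \<omega> by (auto simp: Bad_def far_def not_less)
      qed (use close sp(1)[OF s] in auto)
      then have "(\<Sum>s=1..t. score (est t \<omega>) (act s \<omega>) (X s \<omega>) - ?H * ?\<zeta>) \<le> Y \<theta>' \<omega>"
        unfolding Y_def by (rule sum_mono)
      then have "Y (est t \<omega>) \<omega> - real t * (?H * ?\<zeta>) \<le> Y \<theta>' \<omega>" by (simp add: Y_def sum_subtractf)
      then have "kappa_B CARD('p) b * x - ?q \<le> Y \<theta>' \<omega>" using Yge zeta_H_le[OF t x] by linarith
      then show ?thesis using \<omega> \<theta>' by (auto simp: W_def A_def)
    qed (auto simp: W_def)
  qed
  have "emeasure M W \<le> emeasure M (\<Union>s\<in>{1..t}. Bad s) + emeasure M (\<Union>\<theta>\<in>Z. A \<theta>)"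
    unfolding W_def using ZA(1) BadS(1) Z(2) by (intro emeasure_subadditive sets.finite_UN) auto
  also have "\<dots> \<le> (\<Sum>s\<in>{1..t}. emeasure M (Bad s)) + (\<Sum>\<theta>\<in>Z. emeasure M (A \<theta>))"
    using ZA(1) BadS(1) Z(2) by (intro add_mono emeasure_subadditive_finite) auto
  also have "\<dots> \<le> (\<Sum>s\<in>{1..t}. ennreal (exp (- ?z))) + (\<Sum>\<theta>\<in>Z. ennreal (exp (- ?c)))"
    by (intro add_mono sum_mono BadS ZA)
  also have "\<dots> = ennreal (real t * exp (- ?z) + real (card Z) * exp (- ?c))"
    by (simp add: ennreal_mult ennreal_of_nat_eq_real_of_nat)
  finally have "measure M W \<le> real t * exp (- ?z) + real (card Z) * exp (- ?c)"
    unfolding M.emeasure_eq_measure by (subst (asm) ennreal_le_iff) auto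
  \<comment> \<open>The summand 2 ln (t + 1) of \<open>z_lev\<close> pays for the union over the
    rounds: t / (t + 1) squared is at most one.\<close>
  moreover have "real t * exp (- ?z) \<le> exp (- kappa_B CARD('p) b * x)"
  proof -
    have "exp (- ?z) = exp (- kappa_B CARD('p) b * x) * exp (- (2 * ln (real t + 1)))"
      by (simp add: z_lev_def mult_exp_exp)
    also have "exp (- (2 * ln (real t + 1))) = 1 / (real t + 1)\<^sup>2"
      by (simp add: exp_minus exp_double inverse_eq_divide)
    finally have "real t * exp (- ?z) = exp (- kappa_B CARD('p) b * x) * (real t / (real t + 1)\<^sup>2)" by simp
    also have "\<dots> \<le> exp (- kappa_B CARD('p) b * x) * 1"
    proof (intro mult_left_mono)
      have "real t \<le> (real t + 1)\<^sup>2" by (simp add: power2_eq_square algebra_simps)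
      then show "real t / (real t + 1)\<^sup>2 \<le> 1" by (simp add: divide_le_eq)
    qed simp
    finally show ?thesis by simp
  qed
  moreover have "real (card Z) * exp (- ?c) \<le> exp ?q * cover_num TYPE('p) b ?\<zeta> * exp (- kappa_B CARD('p) b * x)"
  proof -
    have "exp (- ?c) = exp ?q * exp (- kappa_B CARD('p) b * x)" by (simp add: mult_exp_exp)
    then have "real (card Z) * exp (- ?c) = real (card Z) * (exp ?q * exp (- kappa_B CARD('p) b * x))" by simp
    also have "\<dots> \<le> cover_num TYPE('p) b ?\<zeta> * (exp ?q * exp (- kappa_B CARD('p) b * x))"
      by (intro mult_right_mono Z(3)) simp
    finally show ?thesis by (simp add: mult_ac)
  qed
  moreover have "measure M ?E \<le> measure M W" by (rule M.finite_measure_mono[OF sub W])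
  ultimately have "measure M ?E \<le> (exp ?q * cover_num TYPE('p) b ?\<zeta> + 1) * exp (- kappa_B CARD('p) b * x)"
    by (simp add: distrib_right)
  then show ?thesis unfolding tail_bound_def using M.prob_le_1[of ?E] by simp
qed

section \<open>Polynomial growth of the prefactor\<close>

lemma cover_num_polynomial:
  obtains C :: real and n :: nat where "C \<ge> 0"
    "\<forall>t\<ge>1. \<forall>x\<ge>0. exp (real (q_dim TYPE('p))) * cover_num TYPE('p) b (zeta TYPE('p) b t x) + 1
      \<le> C * ((1 + real t) * (1 + x) * (1 + ln (real t + 1))) ^ n"
proof -
  let ?B = "B_mu CARD('p) b" and ?p = "real CARD('p)" and ?q = "real (q_dim TYPE('p))"
  have lo: "0 < v_minus CARD('p) b" and hi: "0 < v_plus CARD('p) b" using lo_pos lo_less_hi by auto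
  note \<kappa> = kappa_nonneg and B = B_mu_nonneg and q = q_dim_pos[where 'p = 'p]
  \<comment> \<open>For the variable w below, \<open>c1\<close> w bounds R + B_mu, \<open>c2\<close>
    w\<open>\<^sup>2\<close> bounds \<open>L_ell\<close>, \<open>c3\<close> w\<open>\<^sup>2\<close>
    bounds \<open>H_lip\<close> and \<open>c4\<close> w\<open>\<^sup>3\<close> bounds 1 / \<zeta>.
    Each of the q factors of the cover number is then a constant times w\<open>\<^sup>3\<close>,
    whence the exponent 3 q.\<close>
  define c1 where "c1 = 2 * ?B + sqrt (v_plus CARD('p) b) * (sqrt ?p + 1 + 2 * (kappa_B CARD('p) b + 2))"
  define c2 where "c2 = c1 / v_minus CARD('p) b + (sqrt ?p / v_minus CARD('p) b + c1\<^sup>2 / (v_minus CARD('p) b)\<^sup>2) / 2"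
  define c3 where "c3 = c2 / 2 + kappa_B CARD('p) b * L_KL CARD('p) b"
  define c4 where "c4 = 1 + c3 / ?q"
  define k1 where "k1 = 1 + 8 * ?B * c4"
  define k2 where "k2 a = 1 + 8 * sqrt (real (d_act a)) * v_plus CARD('p) b * c4" for a :: "'p action"
  have c: "0 \<le> c1" "0 \<le> c2" "0 \<le> c3" "0 \<le> c4"
    using \<kappa> B lo hi L_KL_nonneg unfolding c1_def c2_def c3_def c4_def by auto
  define C where "C = exp ?q * (\<Prod>a\<in>(actions :: 'p action set). k1 ^ d_act a * k2 a ^ s_act a) + 1"
  have k: "0 \<le> k1" "0 \<le> k2 a" for a using c B hi by (auto simp: k1_def k2_def)
  have C0: "0 \<le> C" unfolding C_def using k by (intro add_nonneg_nonneg mult_nonneg_nonneg prod_nonneg) auto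
  have main: "exp ?q * cover_num TYPE('p) b (zeta TYPE('p) b t x) + 1
      \<le> C * ((1 + real t) * (1 + x) * (1 + ln (real t + 1))) ^ (3 * q_dim TYPE('p))"
    if t: "t \<ge> 1" and x: "x \<ge> 0" for t :: nat and x :: real
  proof -
    define L where "L = ln (real t + 1)"
    \<comment> \<open>One quantity dominating 1, t, x and ln (t + 1) at once replaces bookkeeping in
      three variables.\<close>
    define w where "w = (1 + real t) * (1 + x) * (1 + L)"
    have L: "0 \<le> L" by (simp add: L_def)
    have w: "1 \<le> w" "real t \<le> w" "x \<le> w" "L \<le> w"
    proof -
      have e: "w = 1 + real t + x + L + (real t * x + real t * L + x * L + real t * x * L)"
        by (simp add: w_def algebra_simps)
      have "0 \<le> real t * x + real t * L + x * L + real t * x * L" using x L by simp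
      then show "1 \<le> w" "real t \<le> w" "x \<le> w" "L \<le> w" unfolding e using x L by auto
    qed
    have w2: "1 \<le> w\<^sup>2" "w \<le> w\<^sup>2" using w(1) by (auto simp: power2_eq_square mult_ge1_I)
    have w3: "1 \<le> w ^ 3" "w * w\<^sup>2 = w ^ 3"
      by (rule one_le_power[OF w(1)]) (simp add: power3_eq_cube power2_eq_square)
    let ?z = "z_lev CARD('p) b t x"
    have z: "?z \<le> (kappa_B CARD('p) b + 2) * w"
      using mult_left_mono[OF w(3) \<kappa>] w(4) by (simp add: z_lev_def L_def distrib_right)
    have z0: "0 \<le> ?z" by (rule z_lev_nonneg[OF x])
    \<comment> \<open>The square root is not polynomial in x, so it is traded for a linear
      bound.\<close>
    have "sqrt (2 * ?z) \<le> 1 + 2 * ?z"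
    proof (rule real_le_lsqrt)
      show "2 * ?z \<le> (1 + 2 * ?z)\<^sup>2" using z0 by (simp add: power2_eq_square algebra_simps)
    qed (use z0 in auto)
    also have "\<dots> \<le> w + 2 * ((kappa_B CARD('p) b + 2) * w)" using z w(1) by simp
    finally have sz: "sqrt (2 * ?z) \<le> (1 + 2 * (kappa_B CARD('p) b + 2)) * w" by (simp add: algebra_simps)
    define r where "r = R_rad CARD('p) b ?z + ?B"
    have r0: "0 \<le> r" using R_rad_nonneg[OF z0] B by (simp add: r_def)
    have r: "r \<le> c1 * w"
    proof -
      have "sqrt ?p + sqrt (2 * ?z) \<le> sqrt ?p * w + (1 + 2 * (kappa_B CARD('p) b + 2)) * w"
      proof -
        have "sqrt ?p * 1 \<le> sqrt ?p * w" using w(1) by (intro mult_left_mono) auto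
        then show ?thesis using sz by linarith
      qed
      then have "sqrt (v_plus CARD('p) b) * (sqrt ?p + sqrt (2 * ?z)) \<le> sqrt (v_plus CARD('p) b) * (sqrt ?p * w + (1 + 2 * (kappa_B CARD('p) b + 2)) * w)"
        using hi by (intro mult_left_mono) auto
      moreover have "2 * ?B \<le> 2 * ?B * w" using mult_left_mono[OF w(1), of "2 * ?B"] B by simp
      ultimately show ?thesis unfolding r_def R_rad_def c1_def by (simp add: algebra_simps)
    qed
    have "L_ell CARD('p) b (R_rad CARD('p) b ?z) = r / v_minus CARD('p) b + (sqrt ?p / v_minus CARD('p) b + r\<^sup>2 / (v_minus CARD('p) b)\<^sup>2) / 2"
      by (simp add: L_ell_def r_def)
    also have "\<dots> \<le> c1 / v_minus CARD('p) b * w\<^sup>2 + (sqrt ?p / v_minus CARD('p) b * w\<^sup>2 + c1\<^sup>2 / (v_minus CARD('p) b)\<^sup>2 * w\<^sup>2) / 2"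
    proof (intro add_mono divide_right_mono)
      have "r \<le> c1 * w\<^sup>2" using r mult_left_mono[OF w2(2) c(1)] by linarith
      then show "r / v_minus CARD('p) b \<le> c1 / v_minus CARD('p) b * w\<^sup>2" using lo by (simp add: divide_right_mono)
      show "sqrt ?p / v_minus CARD('p) b \<le> sqrt ?p / v_minus CARD('p) b * w\<^sup>2" using mult_left_mono[OF w2(1), of "sqrt ?p / v_minus CARD('p) b"] lo by simp
      have "r\<^sup>2 \<le> (c1 * w)\<^sup>2" using r r0 by (intro power_mono)
      then show "r\<^sup>2 / (v_minus CARD('p) b)\<^sup>2 \<le> c1\<^sup>2 / (v_minus CARD('p) b)\<^sup>2 * w\<^sup>2" using lo by (simp add: power_mult_distrib divide_right_mono)
    qed auto
    also have "\<dots> = c2 * w\<^sup>2" by (simp add: c2_def distrib_right add_divide_distrib)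
    finally have l: "L_ell CARD('p) b (R_rad CARD('p) b ?z) \<le> c2 * w\<^sup>2" .
    have H: "H_lip CARD('p) b t x \<le> c3 * w\<^sup>2"
      using l mult_left_mono[OF w2(1), of "kappa_B CARD('p) b * L_KL CARD('p) b"] \<kappa> L_KL_nonneg
      by (simp add: H_lip_def c3_def distrib_right)
    let ?\<zeta> = "zeta TYPE('p) b t x"
    have iz: "1 / ?\<zeta> \<le> c4 * w ^ 3"
    proof -
      have h: "0 < real t * H_lip CARD('p) b t x" using t H_lip_pos[OF x] by simp
      \<comment> \<open>The reciprocal of a minimum is the larger of the two reciprocals, hence at
        most their sum.\<close>
      have "1 / ?\<zeta> \<le> 1 + real t * H_lip CARD('p) b t x / ?q"
        using h q by (auto simp: zeta_def min_def)
      also have "\<dots> \<le> w ^ 3 + w * (c3 * w\<^sup>2) / ?q"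
        using w H t H_lip_pos[OF x, of t] w3(1)
        by (intro add_mono divide_right_mono mult_mono) auto
      also have "\<dots> = c4 * w ^ 3"
        using w3(2) by (simp add: c4_def distrib_right)
      finally show ?thesis .
    qed
    have fac: "1 + y / ?\<zeta> \<le> (1 + y * c4) * w ^ 3" if "y \<ge> 0" for y
      using mult_left_mono[OF iz that] w3(1) by (simp add: distrib_right mult.assoc)
    have "cover_num TYPE('p) b ?\<zeta>
        \<le> (\<Prod>a\<in>(actions :: 'p action set). (k1 * w ^ 3) ^ d_act a * (k2 a * w ^ 3) ^ s_act a)"
      unfolding cover_num_def
    proof (intro prod_mono conjI mult_mono power_mono)
      fix a :: "'p action"
      have \<zeta>: "0 < ?\<zeta>" by (rule zeta_pos[OF t x])
      show "1 + 8 * ?B / ?\<zeta> \<le> k1 * w ^ 3" using fac[of "8 * ?B"] B by (simp add: k1_def)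
      show "1 + 8 * sqrt (real (d_act a)) * v_plus CARD('p) b / ?\<zeta> \<le> k2 a * w ^ 3"
        using fac[of "8 * sqrt (real (d_act a)) * v_plus CARD('p) b"] hi by (simp add: k2_def)
      show "0 \<le> (1 + 8 * ?B / ?\<zeta>) ^ d_act a * (1 + 8 * sqrt (real (d_act a)) * v_plus CARD('p) b / ?\<zeta>) ^ s_act a"
        "0 \<le> 1 + 8 * ?B / ?\<zeta>" "0 \<le> 1 + 8 * sqrt (real (d_act a)) * v_plus CARD('p) b / ?\<zeta>"
        "0 \<le> (1 + 8 * sqrt (real (d_act a)) * v_plus CARD('p) b / ?\<zeta>) ^ s_act a"
        "0 \<le> (k1 * w ^ 3) ^ d_act a"
        using B hi \<zeta> k w by (auto intro!: mult_nonneg_nonneg zero_le_power add_nonneg_nonneg)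
    qed
    also have "\<dots> = (\<Prod>a\<in>(actions :: 'p action set). k1 ^ d_act a * k2 a ^ s_act a) * (w ^ 3) ^ q_dim TYPE('p)"
      by (simp add: power_mult_distrib prod.distrib power_add q_dim_def power_sum mult_ac)
    finally have N: "cover_num TYPE('p) b ?\<zeta>
      \<le> (\<Prod>a\<in>(actions :: 'p action set). k1 ^ d_act a * k2 a ^ s_act a) * w ^ (3 * q_dim TYPE('p))"
      by (simp add: power_mult)
    have "exp ?q * cover_num TYPE('p) b ?\<zeta> + 1
      \<le> exp ?q * ((\<Prod>a\<in>(actions :: 'p action set). k1 ^ d_act a * k2 a ^ s_act a) * w ^ (3 * q_dim TYPE('p)))
        + w ^ (3 * q_dim TYPE('p))"
      using w(1) by (intro add_mono mult_left_mono N) auto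
    also have "\<dots> = C * w ^ (3 * q_dim TYPE('p))" by (simp add: C_def distrib_right)
    finally show ?thesis by (simp add: w_def L_def)
  qed
  show ?thesis by (rule that[OF C0, of "3 * q_dim TYPE('p)"]) (use main in blast)
qed

text \<open>Three binomial expansions turn the power of the product into explicit coefficients: C
  times a product of three binomial coefficients of n.\<close>

theorem tail_bound_polynomial:
  "\<exists>(n::nat) (c :: nat \<Rightarrow> nat \<Rightarrow> nat \<Rightarrow> real). \<forall>t\<ge>1. \<forall>x\<ge>0. tail_bound TYPE('p) b t x
    \<le> (\<Sum>i\<le>n. \<Sum>j\<le>n. \<Sum>k\<le>n. c i j k * real t ^ i * x ^ j * ln (real t + 1) ^ k) * exp (- kappa_B CARD('p) b * x)"
proof -
  obtain C :: real and n :: nat where C: "C \<ge> 0" and le: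
    "\<forall>t\<ge>1. \<forall>x\<ge>0. exp (real (q_dim TYPE('p))) * cover_num TYPE('p) b (zeta TYPE('p) b t x) + 1
      \<le> C * ((1 + real t) * (1 + x) * (1 + ln (real t + 1))) ^ n"
    by (rule cover_num_polynomial)
  let ?c = "\<lambda>i j k. C * real (n choose i) * real (n choose j) * real (n choose k)"
  have main: "tail_bound TYPE('p) b t x
    \<le> (\<Sum>i\<le>n. \<Sum>j\<le>n. \<Sum>k\<le>n. ?c i j k * real t ^ i * x ^ j * ln (real t + 1) ^ k) * exp (- kappa_B CARD('p) b * x)"
    if "t \<ge> 1" "x \<ge> 0" for t :: nat and x :: real
  proof -
    let ?L = "ln (real t + 1)"
    have bin: "(1 + y) ^ n = (\<Sum>k\<le>n. real (n choose k) * y ^ k)" for y :: real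
      using binomial_ring[of y 1 n] by (simp add: add.commute)
    have "C * ((1 + real t) * (1 + x) * (1 + ?L)) ^ n
      = C * ((\<Sum>i\<le>n. real (n choose i) * real t ^ i) * ((\<Sum>j\<le>n. real (n choose j) * x ^ j)
          * (\<Sum>k\<le>n. real (n choose k) * ?L ^ k)))"
      by (simp only: power_mult_distrib bin mult.assoc)
    also have "\<dots> = C * (\<Sum>i\<le>n. real (n choose i) * real t ^ i
        * (\<Sum>j\<le>n. \<Sum>k\<le>n. real (n choose j) * x ^ j * (real (n choose k) * ?L ^ k)))"
      by (subst sum_product[of "\<lambda>j. real (n choose j) * x ^ j"], subst sum_distrib_right) (rule refl)
    also have "\<dots> = (\<Sum>i\<le>n. \<Sum>j\<le>n. \<Sum>k\<le>n. ?c i j k * real t ^ i * x ^ j * ?L ^ k)"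
      unfolding sum_distrib_left by (intro sum.cong refl) (simp only: mult_ac)
    finally have eq: "C * ((1 + real t) * (1 + x) * (1 + ?L)) ^ n
      = (\<Sum>i\<le>n. \<Sum>j\<le>n. \<Sum>k\<le>n. ?c i j k * real t ^ i * x ^ j * ?L ^ k)" .
    have "tail_bound TYPE('p) b t x
      \<le> (exp (real (q_dim TYPE('p))) * cover_num TYPE('p) b (zeta TYPE('p) b t x) + 1) * exp (- kappa_B CARD('p) b * x)"
      by (simp add: tail_bound_def)
    also have "\<dots> \<le> C * ((1 + real t) * (1 + x) * (1 + ?L)) ^ n * exp (- kappa_B CARD('p) b * x)"
      using le that by (intro mult_right_mono) auto
    finally show ?thesis unfolding eq .
  qed
  show ?thesis by (rule exI[of _ n], rule exI[of _ ?c], intro allI impI) (rule main)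
qed

end

theorem lemma4p2:
  fixes b :: bounds
    and U :: "'p::finite \<Rightarrow> nat \<Rightarrow> real"
    and \<theta>s :: "'p param"
    and M :: "'w measure"
    and \<pi> :: "nat \<Rightarrow> (nat \<Rightarrow> 'p action \<times> ('p \<Rightarrow> real)) \<Rightarrow> 'p action pmf"
    and act :: "nat \<Rightarrow> 'w \<Rightarrow> 'p action"
    and X :: "nat \<Rightarrow> 'w \<Rightarrow> 'p \<Rightarrow> real"
    and est :: "nat \<Rightarrow> 'w \<Rightarrow> 'p param"
  assumes "valid_bounds b U"
    and "adaptive_policy \<pi>"
    and "\<theta>s \<in> param_space b"
    and "sampling_process M U \<theta>s \<pi> act X"
    and "mle_process M b U act X est"
  shows "(\<forall>t\<ge>1. \<forall>x\<ge>0.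
            measure M {\<omega> \<in> space M.
              (\<Sum>a\<in>actions. real (act_count act t a \<omega>)
                 * KL (act_law U (est t \<omega>) a) (act_law U \<theta>s a)) \<ge> x}
            \<le> tail_bound TYPE('p) b t x)
       \<and> (\<exists>(n::nat) (c :: nat \<Rightarrow> nat \<Rightarrow> nat \<Rightarrow> real). \<forall>t\<ge>1. \<forall>x\<ge>0.
            tail_bound TYPE('p) b t x
            \<le> (\<Sum>i\<le>n. \<Sum>j\<le>n. \<Sum>k\<le>n. c i j k * real t ^ i * x ^ j * ln (real t + 1) ^ k)
                * exp (- kappa_B CARD('p) b * x))"
  by (intro conjI allI impI mle_divergence_tail[OF assms(1,3,4,5)] tail_bound_polynomial[OF assms(1,3)])

end
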